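(* Let $\alpha\in\mathbb{R}$, let $m$ be a non-negative integer, and let $(s_j)_{j=0}^m\in\mathcal{K}^{\ge,cd}_{q,m,\alpha}$. Let $s_0^{[m,\alpha]}$ be the single matrix constituting the $m$-th $\alpha$-S-transform of $(s_j)_{j=0}^m$. Then: (a) $(s_j)_{j=0}^m\in\mathcal{K}^{\ge,e}_{q,m,\alpha}$ and $s_0^{[m,\alpha]}=0_{q\times q}$. (b) Let $\mathbf{V}_m=\begin{bmatrix}\mathbf{v}_{11}&\mathbf{v}_{12}\\ \mathbf{v}_{21}&\mathbf{v}_{22}\end{bmatrix}$ be the $2q\times 2q$ matrix polynomial $\mathbf{V}_m=V_{s_0^{[0,\alpha]}}V_{s_0^{[1,\alpha]}}\cdots V_{s_0^{[m,\alpha]}}$ with its $q\times q$ block representation. Then $\mathcal{S}_{q,\alpha}[(s_j)_{j=0}^m,\le]=\{\mathbf{v}_{12}\mathbf{v}_{22}^{-1}\}$. (c) $\mathcal{S}_{q,\alpha}[(s_j)_{j=0}^m,=]=\mathcal{S}_{q,\alpha}[(s_j)_{j=0}^m,\le]$.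
   Context: Notation: $q$ is a positive integer; $A^*$ is the conjugate transpose and $A^\dagger$ the Moore-Penrose inverse of a complex matrix $A$; $A\ge0$ means non-negative Hermitian; $\operatorname{Im}A=\frac1{2i}(A-A^* )$; $\|\cdot\|$ is the operator norm. Classes of sequences. For complex $q\times q$ matrices put $H_n=(s_{j+k})_{j,k=0}^n$ and $K_n=(s_{j+k+1})_{j,k=0}^n$ (block Hankel matrices). $\mathcal{K}^{\ge}_{q,0,\alpha}$ is the set of $(s_0)$ with $s_0\ge0$; for $n\ge1$, $\mathcal{K}^{\ge}_{q,2n,\alpha}$ is the set of $(s_j)_{j=0}^{2n}$ with $H_n\ge0$ and $-\alpha H_{n-1}+K_{n-1}\ge0$; for $n\ge0$, $\mathcal{K}^{\ge}_{q,2n+1,\alpha}$ is the set of $(s_j)_{j=0}^{2n+1}$ with $H_n\ge0$ and $-\alpha H_n+K_n\ge0$. $\mathcal{K}^{\ge,e}_{q,m,\alpha}$ is the set of $(s_j)_{j=0}^m$ for which there is a complex $q\times q$ matrix $s_{m+1}$ with $(s_j)_{j=0}^{m+1}\in\mathcal{K}^{\ge}_{q,m+1,\alpha}$. Put $L_0=s_0$ and, for $n\ge1$, $L_n=s_{2n}-[s_n,s_{n+1},\dots,s_{2n-1}]\,H_{n-1}^\dagger\begin{bmatrix}s_n\\ \vdots\\ s_{2n-1}\end{bmatrix}$; let $L_{\alpha,n}$ be the matrix $L_n$ formed from the sequence $(-\alpha s_j+s_{j+1})_j$ instead of $(s_j)_j$. The class of completely degenerate sequences is: $\mathcal{K}^{\ge,cd}_{q,2n,\alpha}=\{(s_j)_{j=0}^{2n}\in\mathcal{K}^{\ge}_{q,2n,\alpha}: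 L_n=0\}$ and $\mathcal{K}^{\ge,cd}_{q,2n+1,\alpha}=\{(s_j)_{j=0}^{2n+1}\in\mathcal{K}^{\ge}_{q,2n+1,\alpha}: L_{\alpha,n}=0\}$. $\alpha$-S-transforms. Given $(s_j)_{j=0}^\kappa$, put $u_j=-\alpha s_{j-1}+s_j$ with $s_{-1}=0$. The reciprocal sequence of $(u_j)$ is $u_0^\sharp=u_0^\dagger$, $u_j^\sharp=-u_0^\dagger\sum_{l=0}^{j-1}u_{j-l}u_l^\sharp$. If $\kappa\ge1$, the first $\alpha$-S-transform of $(s_j)_{j=0}^\kappa$ is $(s_j^{[1,\alpha]})_{j=0}^{\kappa-1}$, $s_j^{[1,\alpha]}=-s_0u_{j+1}^\sharp s_0$. The $0$-th $\alpha$-S-transform is the sequence itself, and the $k$-th one, $(s_j^{[k,\alpha]})_{j=0}^{\kappa-k}$, is the first $\alpha$-S-transform of the $(k-1)$-th. Matrix polynomials. For a complex $q\times q$ matrix $A$: $V_A(z)=\begin{bmatrix}0&-A\\(z-\alpha)A^\dagger&(z-\alpha)I_q\end{bmatrix}$, $z\in\mathbb{C}$. In (b), $\mathbf{v}_{12}\mathbf{v}_{22}^{-1}$ is regarded as a (meromorphic, in fact holomorphic) function in $\mathbb{C}\setminus[\alpha,\infty)$. Classes of functions. $\mathcal{S}_{q,\alpha}$ is the set of holomorphic $F:\mathbb{C}\setminus[\alpha,\infty)\to\mathbb{C}^{q\times q}$ with $\operatorname{Im}F(w)\ge0$ whenever $\operatorname{Im}w>0$ and $F(w)\ge0$ for $w\in(-\infty,\alpha)$.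 $\mathcal{S}_{0,q,\alpha}$ is the set of $F\in\mathcal{S}_{q,\alpha}$ with $\sup_{y\in[1,\infty)}y\|F(iy)\|<\infty$. For each $F\in\mathcal{S}_{0,q,\alpha}$ there is a unique non-negative Hermitian $q\times q$ measure $\sigma_F$ (a $\sigma$-additive map from the Borel subsets of $[\alpha,\infty)$ to the non-negative Hermitian matrices) with $F(z)=\int_{[\alpha,\infty)}(t-z)^{-1}\sigma_F(dt)$ (known fact). $\mathcal{S}_{q,\alpha}[(s_j)_{j=0}^m,\le]$ is the set of $F\in\mathcal{S}_{0,q,\alpha}$ such that the moments $s_j^{(\sigma_F)}=\int_{[\alpha,\infty)}t^j\sigma_F(dt)$ exist for $j=0,\dots,m$, $s_j^{(\sigma_F)}=s_j$ for $0\le j\le m-1$, and $s_m-s_m^{(\sigma_F)}\ge0$. $\mathcal{S}_{q,\alpha}[(s_j)_{j=0}^m,=]$ is defined analogously with $s_j^{(\sigma_F)}=s_j$ for all $0\le j\le m$. *)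

theory Defs
  imports
    "HOL-Complex_Analysis.Complex_Analysis"
    "Jordan_Normal_Form.Schur_Decomposition"
    "Jordan_Normal_Form.Gauss_Jordan_Elimination"
begin

hide_type (open) Finite_Cartesian_Product.vec
no_notation Finite_Cartesian_Product.vec_nth (infixl "$" 90)

text \<open>
  Complex matrices are those of \<^theory>\<open>Jordan_Normal_Form.Matrix\<close>, since the block Hankel
  matrices have sizes depending on a running index. A finite sequence \<open>s\<^sub>0, \<dots>, s\<^sub>m\<close> is represented by
  a function on \<^typ>\<open>nat\<close> of which only the values at \<open>j \<le> m\<close> matter.
\<close>


section \<open>Matrices\<close>

definition nonneg_herm :: "complex mat \<Rightarrow> bool" where
  "nonneg_herm A \<longleftrightarrow> square_mat A \<and> mat_adjoint A = A \<and>
     (\<forall>x \<in> carrier_vec (dim_row A). 0 \<le> Re ((A *\<^sub>v x) \<bullet>c x))"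

definition mat_Im :: "complex mat \<Rightarrow> complex mat" where
  "mat_Im A = (1 / (2 * \<i>)) \<cdot>\<^sub>m (A - mat_adjoint A)"

definition is_mp_inverse :: "complex mat \<Rightarrow> complex mat \<Rightarrow> bool" where
  "is_mp_inverse A X \<longleftrightarrow> X \<in> carrier_mat (dim_col A) (dim_row A) \<and>
     A * X * A = A \<and> X * A * X = X \<and>
     mat_adjoint (A * X) = A * X \<and> mat_adjoint (X * A) = X * A"

definition mp_inverse :: "complex mat \<Rightarrow> complex mat" where
  "mp_inverse A = (THE X. is_mp_inverse A X)"

definition euclid_norm :: "complex vec \<Rightarrow> real" where
  "euclid_norm x = sqrt (Re (x \<bullet>c x))"

definition op_norm :: "complex mat \<Rightarrow> real" where
  "op_norm A = (SUP x \<in> {x \<in> carrier_vec (dim_col A). euclid_norm x \<le> 1}. euclid_norm (A *\<^sub>v x))"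


section \<open>Classes of sequences\<close>

definition block_hankel :: "nat \<Rightarrow> (nat \<Rightarrow> complex mat) \<Rightarrow> nat \<Rightarrow> complex mat" where
  "block_hankel q s n = Matrix.mat ((n + 1) * q) ((n + 1) * q)
     (\<lambda>(i, j). s (i div q + j div q) $$ (i mod q, j mod q))"

definition shift_seq :: "real \<Rightarrow> (nat \<Rightarrow> complex mat) \<Rightarrow> nat \<Rightarrow> complex mat" where
  "shift_seq \<alpha> s j = complex_of_real (- \<alpha>) \<cdot>\<^sub>m s j + s (Suc j)"

definition block_K :: "nat \<Rightarrow> (nat \<Rightarrow> complex mat) \<Rightarrow> nat \<Rightarrow> complex mat" where
  "block_K q s n = block_hankel q (\<lambda>j. s (Suc j)) n"

definition K_nonneg :: "nat \<Rightarrow> nat \<Rightarrow> real \<Rightarrow> (nat \<Rightarrow> complex mat) \<Rightarrow> bool" where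
  "K_nonneg q m \<alpha> s \<longleftrightarrow> (\<forall>j\<le>m. s j \<in> carrier_mat q q) \<and>
     (if m = 0 then nonneg_herm (s 0)
      else if even m then
        nonneg_herm (block_hankel q s (m div 2)) \<and>
        nonneg_herm (complex_of_real (- \<alpha>) \<cdot>\<^sub>m block_hankel q s (m div 2 - 1)
                       + block_K q s (m div 2 - 1))
      else
        nonneg_herm (block_hankel q s (m div 2)) \<and>
        nonneg_herm (complex_of_real (- \<alpha>) \<cdot>\<^sub>m block_hankel q s (m div 2)
                       + block_K q s (m div 2)))"

definition K_nonneg_ext :: "nat \<Rightarrow> nat \<Rightarrow> real \<Rightarrow> (nat \<Rightarrow> complex mat) \<Rightarrow> bool" where
  "K_nonneg_ext q m \<alpha> s \<longleftrightarrow>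
     (\<exists>X \<in> carrier_mat q q. K_nonneg q (m + 1) \<alpha> (s(m + 1 := X)))"

definition block_row :: "nat \<Rightarrow> (nat \<Rightarrow> complex mat) \<Rightarrow> nat \<Rightarrow> complex mat" where
  \<comment> \<open>\<open>[s\<^sub>n, \<dots>, s\<^bsub>2n-1\<^esub>]\<close>\<close>
  "block_row q s n = Matrix.mat q (n * q) (\<lambda>(i, j). s (n + j div q) $$ (i, j mod q))"

definition block_col :: "nat \<Rightarrow> (nat \<Rightarrow> complex mat) \<Rightarrow> nat \<Rightarrow> complex mat" where
  "block_col q s n = Matrix.mat (n * q) q (\<lambda>(i, j). s (n + i div q) $$ (i mod q, j))"

definition L_mat :: "nat \<Rightarrow> (nat \<Rightarrow> complex mat) \<Rightarrow> nat \<Rightarrow> complex mat" where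
  "L_mat q s n = (if n = 0 then s 0
     else s (2 * n) - block_row q s n * mp_inverse (block_hankel q s (n - 1)) * block_col q s n)"

definition K_nonneg_cd :: "nat \<Rightarrow> nat \<Rightarrow> real \<Rightarrow> (nat \<Rightarrow> complex mat) \<Rightarrow> bool" where
  "K_nonneg_cd q m \<alpha> s \<longleftrightarrow> K_nonneg q m \<alpha> s \<and>
     (if even m then L_mat q s (m div 2) = 0\<^sub>m q q
      else L_mat q (shift_seq \<alpha> s) (m div 2) = 0\<^sub>m q q)"


section \<open>The \<open>\<alpha>\<close>-S-transforms\<close>

definition u_seq :: "nat \<Rightarrow> real \<Rightarrow> (nat \<Rightarrow> complex mat) \<Rightarrow> nat \<Rightarrow> complex mat" where
  "u_seq q \<alpha> s j = complex_of_real (- \<alpha>) \<cdot>\<^sub>m (if j = 0 then 0\<^sub>m q q else s (j - 1)) + s j"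

text \<open>The type of matrices has no type-class addition, so sums are formed entrywise.\<close>

definition mat_sum :: "nat \<Rightarrow> ('i \<Rightarrow> complex mat) \<Rightarrow> 'i set \<Rightarrow> complex mat" where
  "mat_sum q f I = Matrix.mat q q (\<lambda>(i, j). \<Sum>l\<in>I. f l $$ (i, j))"

lemma mat_sum_cong [fundef_cong]:
  "q = q' \<Longrightarrow> I = I' \<Longrightarrow> (\<And>l. l \<in> I' \<Longrightarrow> f l = f' l) \<Longrightarrow> mat_sum q f I = mat_sum q' f' I'"
  unfolding mat_sum_def by simp

fun recip_seq :: "nat \<Rightarrow> (nat \<Rightarrow> complex mat) \<Rightarrow> nat \<Rightarrow> complex mat" where
  "recip_seq q u j = (if j = 0 then mp_inverse (u 0)
     else - (mp_inverse (u 0) * mat_sum q (\<lambda>l. u (j - l) * recip_seq q u l) {..<j}))"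

declare recip_seq.simps [simp del]

definition S_transform1 :: "nat \<Rightarrow> real \<Rightarrow> (nat \<Rightarrow> complex mat) \<Rightarrow> nat \<Rightarrow> complex mat" where
  "S_transform1 q \<alpha> s j = - (s 0 * recip_seq q (u_seq q \<alpha> s) (j + 1) * s 0)"

definition S_transform :: "nat \<Rightarrow> real \<Rightarrow> nat \<Rightarrow> (nat \<Rightarrow> complex mat) \<Rightarrow> nat \<Rightarrow> complex mat" where
  \<comment> \<open>The \<open>j\<close>-th entry depends on \<open>s\<^sub>0, \<dots>, s\<^bsub>j+k\<^esub>\<close> only.\<close>
  "S_transform q \<alpha> k s = (S_transform1 q \<alpha> ^^ k) s"


section \<open>Matrix polynomials\<close>

definition V_mat :: "nat \<Rightarrow> real \<Rightarrow> complex mat \<Rightarrow> complex \<Rightarrow> complex mat" where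
  "V_mat q \<alpha> A z = four_block_mat
     (0\<^sub>m q q)                                    (- A)
     ((z - complex_of_real \<alpha>) \<cdot>\<^sub>m mp_inverse A)   ((z - complex_of_real \<alpha>) \<cdot>\<^sub>m 1\<^sub>m q)"

fun V_prod :: "nat \<Rightarrow> real \<Rightarrow> (nat \<Rightarrow> complex mat) \<Rightarrow> nat \<Rightarrow> complex \<Rightarrow> complex mat" where
  "V_prod q \<alpha> s 0 z = V_mat q \<alpha> (S_transform q \<alpha> 0 s 0) z"
| "V_prod q \<alpha> s (Suc k) z = V_prod q \<alpha> s k z * V_mat q \<alpha> (S_transform q \<alpha> (Suc k) s 0) z"

definition block12 :: "nat \<Rightarrow> complex mat \<Rightarrow> complex mat" where
  "block12 q M = (case split_block M q q of (A, B, C, D) \<Rightarrow> B)"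

definition block22 :: "nat \<Rightarrow> complex mat \<Rightarrow> complex mat" where
  "block22 q M = (case split_block M q q of (A, B, C, D) \<Rightarrow> D)"


section \<open>Classes of functions\<close>

definition slit_plane :: "real \<Rightarrow> complex set" where
  "slit_plane \<alpha> = - (complex_of_real ` {\<alpha>..})"

text \<open>
  Functions with domain \<^term>\<open>slit_plane \<alpha>\<close> are extensional, i.e. \<^const>\<open>undefined\<close> elsewhere, so
  that equality of such functions is equality on the domain.
\<close>

definition mat_holomorphic :: "nat \<Rightarrow> real \<Rightarrow> (complex \<Rightarrow> complex mat) set" where
  "mat_holomorphic q \<alpha> = {F \<in> slit_plane \<alpha> \<rightarrow>\<^sub>E carrier_mat q q.
     \<forall>i<q. \<forall>j<q. (\<lambda>z. F z $$ (i, j)) holomorphic_on slit_plane \<alpha>}"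

text \<open>
  \<open>G\<close> is the function \<open>N D\<^sup>-\<^sup>1\<close>: the determinant of \<open>D\<close> does not vanish identically, and \<open>G\<close> is
  holomorphic and given by the pointwise quotient wherever \<open>D\<close> is invertible.
\<close>

definition is_quotient ::
  "nat \<Rightarrow> real \<Rightarrow> (complex \<Rightarrow> complex mat) \<Rightarrow> (complex \<Rightarrow> complex mat) \<Rightarrow> (complex \<Rightarrow> complex mat) \<Rightarrow> bool"
where
  "is_quotient q \<alpha> N D G \<longleftrightarrow> G \<in> mat_holomorphic q \<alpha> \<and>
     (\<exists>z \<in> slit_plane \<alpha>. Determinant.det (D z) \<noteq> 0) \<and>
     (\<forall>z \<in> slit_plane \<alpha>. Determinant.det (D z) \<noteq> 0 \<longrightarrow> G z = N z * the (mat_inverse (D z)))"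

definition S_class :: "nat \<Rightarrow> real \<Rightarrow> (complex \<Rightarrow> complex mat) set" where
  "S_class q \<alpha> = {F \<in> mat_holomorphic q \<alpha>.
     (\<forall>w. Im w > 0 \<longrightarrow> nonneg_herm (mat_Im (F w))) \<and>
     (\<forall>w<\<alpha>. nonneg_herm (F (complex_of_real w)))}"

definition S0_class :: "nat \<Rightarrow> real \<Rightarrow> (complex \<Rightarrow> complex mat) set" where
  "S0_class q \<alpha> = {F \<in> S_class q \<alpha>.
     bdd_above ((\<lambda>y. y * op_norm (F (\<i> * complex_of_real y))) ` {1..})}"

definition half_line_sets :: "real \<Rightarrow> real set set" where
  "half_line_sets \<alpha> = sets (restrict_space borel {\<alpha>..})"

definition nonneg_herm_measure :: "nat \<Rightarrow> real \<Rightarrow> (real set \<Rightarrow> complex mat) \<Rightarrow> bool" where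
  "nonneg_herm_measure q \<alpha> \<sigma> \<longleftrightarrow>
     (\<forall>B \<in> half_line_sets \<alpha>. \<sigma> B \<in> carrier_mat q q \<and> nonneg_herm (\<sigma> B)) \<and>
     (\<forall>B :: nat \<Rightarrow> real set. range B \<subseteq> half_line_sets \<alpha> \<longrightarrow> disjoint_family B \<longrightarrow>
        (\<forall>i<q. \<forall>j<q. (\<lambda>n. \<sigma> (B n) $$ (i, j)) sums (\<sigma> (\<Union>n. B n) $$ (i, j))))"

definition form_measure :: "real \<Rightarrow> (real set \<Rightarrow> complex mat) \<Rightarrow> complex vec \<Rightarrow> real measure" where
  "form_measure \<alpha> \<sigma> x =
     measure_of {\<alpha>..} (half_line_sets \<alpha>) (\<lambda>B. ennreal (Re ((\<sigma> B *\<^sub>v x) \<bullet>c x)))"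

text \<open>
  The integral of a scalar function with respect to a matrix measure is taken entrywise. The complex
  measure \<open>\<sigma>\<^sub>j\<^sub>k\<close> is written as a linear combination of finite positive measures by polarization,
  \<open>\<sigma>\<^sub>j\<^sub>k = 1/4 \<Sum>\<^bsub>r<4\<^esub> (-\<i>)\<^sup>r (e\<^sub>j + \<i>\<^sup>r e\<^sub>k)\<^sup>* \<sigma> (e\<^sub>j + \<i>\<^sup>r e\<^sub>k)\<close>.
\<close>

definition mat_integrable :: "nat \<Rightarrow> real \<Rightarrow> (real set \<Rightarrow> complex mat) \<Rightarrow> (real \<Rightarrow> complex) \<Rightarrow> bool" where
  "mat_integrable q \<alpha> \<sigma> f \<longleftrightarrow> (\<forall>x \<in> carrier_vec q. integrable (form_measure \<alpha> \<sigma> x) f)"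

definition mat_integral :: "nat \<Rightarrow> real \<Rightarrow> (real set \<Rightarrow> complex mat) \<Rightarrow> (real \<Rightarrow> complex) \<Rightarrow> complex mat" where
  "mat_integral q \<alpha> \<sigma> f = Matrix.mat q q (\<lambda>(j, k).
     1 / 4 * (\<Sum>r<4::nat. (- \<i>) ^ r *
       integral\<^sup>L (form_measure \<alpha> \<sigma> (unit_vec q j + (\<i> ^ r) \<cdot>\<^sub>v unit_vec q k)) f))"

definition mat_moment :: "nat \<Rightarrow> real \<Rightarrow> (real set \<Rightarrow> complex mat) \<Rightarrow> nat \<Rightarrow> complex mat" where
  "mat_moment q \<alpha> \<sigma> j = mat_integral q \<alpha> \<sigma> (\<lambda>t. complex_of_real (t ^ j))"

definition moments_exist :: "nat \<Rightarrow> real \<Rightarrow> (real set \<Rightarrow> complex mat) \<Rightarrow> nat \<Rightarrow> bool" where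
  "moments_exist q \<alpha> \<sigma> m \<longleftrightarrow> (\<forall>j\<le>m. mat_integrable q \<alpha> \<sigma> (\<lambda>t. complex_of_real (t ^ j)))"

text \<open>
  \<open>\<sigma>\<close> is the measure \<open>\<sigma>\<^sub>F\<close> of the integral representation of \<open>F\<close>. It is unique on the Borel subsets
  of \<open>[\<alpha>, \<infinity>)\<close>; the values of \<open>\<sigma>\<close> at other sets are irrelevant.
\<close>

definition is_stieltjes_measure ::
  "nat \<Rightarrow> real \<Rightarrow> (complex \<Rightarrow> complex mat) \<Rightarrow> (real set \<Rightarrow> complex mat) \<Rightarrow> bool"
where
  "is_stieltjes_measure q \<alpha> F \<sigma> \<longleftrightarrow> nonneg_herm_measure q \<alpha> \<sigma> \<and>
     (\<forall>z \<in> slit_plane \<alpha>. F z = mat_integral q \<alpha> \<sigma> (\<lambda>t. 1 / (complex_of_real t - z)))"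

definition S_moment_le :: "nat \<Rightarrow> real \<Rightarrow> (nat \<Rightarrow> complex mat) \<Rightarrow> nat \<Rightarrow> (complex \<Rightarrow> complex mat) set" where
  "S_moment_le q \<alpha> s m = {F \<in> S0_class q \<alpha>. \<exists>\<sigma>. is_stieltjes_measure q \<alpha> F \<sigma> \<and>
     moments_exist q \<alpha> \<sigma> m \<and> (\<forall>j<m. mat_moment q \<alpha> \<sigma> j = s j) \<and>
     nonneg_herm (s m - mat_moment q \<alpha> \<sigma> m)}"

definition S_moment_eq :: "nat \<Rightarrow> real \<Rightarrow> (nat \<Rightarrow> complex mat) \<Rightarrow> nat \<Rightarrow> (complex \<Rightarrow> complex mat) set" where
  "S_moment_eq q \<alpha> s m = {F \<in> S0_class q \<alpha>. \<exists>\<sigma>. is_stieltjes_measure q \<alpha> F \<sigma> \<and>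
     moments_exist q \<alpha> \<sigma> m \<and> (\<forall>j\<le>m. mat_moment q \<alpha> \<sigma> j = s j)}"

end

theory Submission
  imports Defs
begin

text \<open>
  A sequence \<open>(s\<^sub>j)\<close> in the class is a moment sequence \<open>s\<^sub>j = B\<^sup>* T\<^sup>j B\<close> of a finite-dimensional
  Hermitian operator \<open>T = \<alpha> + R\<^sup>* R\<close>, read off from a factorization of the block Hankel matrices.
  Complete degeneracy says that the last Krylov vector (\<open>T\<^sup>n B\<close> for \<open>m = 2n\<close>, \<open>R T\<^sup>n B\<close> for
  \<open>m = 2n + 1\<close>) is a combination of the earlier ones.

  The \<open>\<alpha>\<close>-S-transform acts on models by \<open>(R, B) \<mapsto> (Q R\<^sup>*, R B)\<close>, where \<open>Q\<close> projects onto the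
  orthogonal complement of the range of \<open>B\<close>. Each step turns degeneracy for \<open>m\<close> into degeneracy for
  \<open>m - 1\<close>, so that \<open>B\<close> has become \<open>0\<close> after \<open>m\<close> steps, that is, \<open>s\<^sub>0\<^sup>[\<^sup>m\<^sup>,\<^sup>\<alpha>\<^sup>] = 0\<close>. A Schur complement
  identity relates the compressed resolvents \<open>F(z) = B\<^sup>* (T - z)\<inverse> B\<close> and \<open>F\<^sub>1\<close> of the two models,
  \<open>-(z - \<alpha>) F (1 + s\<^sub>0\<^sup>\<dagger> F\<^sub>1) = s\<^sub>0\<close>, which iterates to \<open>v\<^sub>1\<^sub>2 = F v\<^sub>2\<^sub>2\<close>. The spectral measure of \<open>T\<close>
  shows that \<open>F\<close> is a solution, with equality in the last moment.

  For uniqueness, let \<open>\<sigma>\<close> be the measure of any solution. The Gram matrices with respect to \<open>\<sigma>\<close> of the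
  functions \<open>(t - \<alpha>)\<^sup>e\<^sup>/\<^sup>2 t\<^sup>a\<close> and \<open>(t - \<alpha>)\<^sup>e\<^sup>/\<^sup>2 / (t - z)\<close>, \<open>e\<close> the parity of \<open>m\<close>, are non-negative, so the
  dependence relation of the Krylov vectors also holds for these functions. Hence \<open>F(z)\<close> times a
  monic matrix polynomial is determined by the moments, which fixes \<open>F(z)\<close> for large \<open>|z|\<close> and,
  by analytic continuation, everywhere.
\<close>

section \<open>Matrix algebra with adjoints\<close>

text \<open>Non-negative block Hankel matrices alone do not give a model: for \<open>q = 1\<close>
  the sequence \<open>(0, 1)\<close> lies in the class with \<open>m = 1\<close>, but
  \<open>B\<^sup>* B = 0\<close> forces all moments of a model to vanish. Degeneracy removes this
  obstacle. For odd \<open>m\<close> it makes the form given by \<open>- \<alpha> H + K\<close>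
  vanish on the coefficients of zero combinations of Krylov vectors; for even \<open>m\<close> it
  keeps the last Krylov vector inside the space on which the operator is determined. Once a model
  exists, extendability in (a) is free, because its moments continue beyond \<open>m\<close>.

  The factor \<open>R\<close> is kept, instead of \<open>T\<close> alone, because the two Hankel
  conditions concern the Gram matrices of \<open>T\<^sup>a B\<close> and of
  \<open>R T\<^sup>a B\<close>. The transformed model has the operator
  \<open>\<alpha> + R Q R\<^sup>*\<close>, and this exchange of the two sides of \<open>R\<close>
  switches the parity of \<open>m\<close>. Since \<open>s\<^sub>0\<close> may be singular,
  \<open>v\<^sub>1\<^sub>2 = F v\<^sub>2\<^sub>2\<close> is proved as a product identity on the
  whole slit plane, and invertibility of \<open>v\<^sub>2\<^sub>2\<close> only at
  \<open>\<alpha> - 1\<close>, where all compressed resolvents are non-negative.\<close>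

lemma dim_row_adjoint [simp]: "dim_row (mat_adjoint A) = dim_col A"
  and dim_col_adjoint [simp]: "dim_col (mat_adjoint A) = dim_row A"
  by (simp_all add: mat_adjoint_def)

lemma index_adjoint [simp]:
  fixes A :: "complex mat"
  assumes "i < dim_col A" "j < dim_row A"
  shows "mat_adjoint A $$ (i, j) = cnj (A $$ (j, i))"
  using assms by (simp add: mat_adjoint_def mat_of_rows_def)

lemma adjoint_adjoint [simp]: "mat_adjoint (mat_adjoint A) = (A :: complex mat)"
  by (rule eq_matI) auto

lemma index_mult_sum:
  assumes "dim_col A = dim_row B" "i < dim_row A" "j < dim_col B"
  shows "(A * B) $$ (i, j) = (\<Sum>k<dim_row B. A $$ (i, k) * B $$ (k, j))"
  using assms by (simp add: scalar_prod_def atLeast0LessThan)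

lemma adjoint_mult:
  fixes A B :: "complex mat"
  assumes "dim_col A = dim_row B"
  shows "mat_adjoint (A * B) = mat_adjoint B * mat_adjoint A"
  by (rule eq_matI) (use assms in \<open>auto simp: index_mult_sum mult.commute simp del: index_mult_mat(1)\<close>)

lemma adjoint_add:
  fixes A B :: "complex mat"
  assumes "dim_row A = dim_row B" "dim_col A = dim_col B"
  shows "mat_adjoint (A + B) = mat_adjoint A + mat_adjoint B"
  by (rule eq_matI) (use assms in auto)

lemma adjoint_minus:
  fixes A B :: "complex mat"
  assumes "dim_row A = dim_row B" "dim_col A = dim_col B"
  shows "mat_adjoint (A - B) = mat_adjoint A - mat_adjoint B"
  by (rule eq_matI) (use assms in auto)

lemma adjoint_uminus: "mat_adjoint (- A) = - mat_adjoint (A :: complex mat)"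
  by (rule eq_matI) auto

lemma adjoint_smult: "mat_adjoint (c \<cdot>\<^sub>m A) = cnj c \<cdot>\<^sub>m mat_adjoint A"
  by (rule eq_matI) auto

lemma adjoint_one [simp]: "mat_adjoint (1\<^sub>m n :: complex mat) = 1\<^sub>m n"
  by (rule eq_matI) auto

lemma adjoint_zero [simp]: "mat_adjoint (0\<^sub>m n m :: complex mat) = 0\<^sub>m m n"
  by (rule eq_matI) auto

text \<open>The side conditions compare dimensions instead of naming carriers, so that the
  simplifier can discharge them for arbitrary products. With the laws below this becomes
  \<open>mat_simps\<close>, which nests products to the right and moves adjoints inwards.\<close>

lemma mat_assoc:
  fixes A B C :: "'a :: semiring_0 mat"
  shows "dim_col A = dim_row B \<Longrightarrow> dim_col B = dim_row C \<Longrightarrow> A * B * C = A * (B * C)"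
  by (rule assoc_mult_mat[of _ "dim_row A" "dim_col A" _ "dim_col B" _ "dim_col C"]) (auto intro: carrier_matI)

lemma mat_distribs:
  fixes A B C :: "'a :: comm_ring_1 mat"
  shows "dim_row A = dim_row B \<Longrightarrow> dim_col A = dim_col B \<Longrightarrow> dim_col B = dim_row C \<Longrightarrow>
      (A + B) * C = A * C + B * C"
    and "dim_row A = dim_row B \<Longrightarrow> dim_col A = dim_col B \<Longrightarrow> dim_col C = dim_row B \<Longrightarrow>
      C * (A + B) = C * A + C * B"
    and "dim_row A = dim_row B \<Longrightarrow> dim_col A = dim_col B \<Longrightarrow> dim_col B = dim_row C \<Longrightarrow>
      (A - B) * C = A * C - B * C"
    and "dim_row A = dim_row B \<Longrightarrow> dim_col A = dim_col B \<Longrightarrow> dim_col C = dim_row B \<Longrightarrow>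
      C * (A - B) = C * A - C * B"
    and "dim_col A = dim_row B \<Longrightarrow> (- A) * B = - (A * B)"
    and "dim_col A = dim_row B \<Longrightarrow> A * (- B) = - (A * B)"
    and "dim_col A = dim_row B \<Longrightarrow> (c \<cdot>\<^sub>m A) * B = c \<cdot>\<^sub>m (A * B)"
    and "dim_col A = dim_row B \<Longrightarrow> A * (c \<cdot>\<^sub>m B) = c \<cdot>\<^sub>m (A * B)"
  by (metis add_mult_distrib_mat carrier_matI) (metis mult_add_distrib_mat carrier_matI,
    metis minus_mult_distrib_mat carrier_matI, metis mult_minus_distrib_mat carrier_matI,
    metis uminus_mult_left_mat, metis uminus_mult_right_mat,
    metis mult_smult_assoc_mat carrier_matI, metis mult_smult_distrib carrier_matI)

lemma mat_carrier_iffs [simp]: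
  shows "A * B \<in> carrier_mat n m \<longleftrightarrow> dim_row A = n \<and> dim_col B = m"
    and "A + B \<in> carrier_mat n m \<longleftrightarrow> B \<in> carrier_mat n m"
    and "A - B \<in> carrier_mat n m \<longleftrightarrow> B \<in> carrier_mat n m"
    and "- A \<in> carrier_mat n m \<longleftrightarrow> A \<in> carrier_mat n m"
    and "c \<cdot>\<^sub>m A \<in> carrier_mat n m \<longleftrightarrow> A \<in> carrier_mat n m"
    and "mat_adjoint A \<in> carrier_mat n m \<longleftrightarrow> A \<in> carrier_mat m n"
  unfolding carrier_mat_def mem_Collect_eq by auto

lemma mat_minus_eq_0D:
  fixes A B :: "'a :: group_add mat"
  assumes "A - B = 0\<^sub>m n m" "dim_row A = dim_row B" "dim_col A = dim_col B"
  shows "A = B"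
proof (rule eq_matI)
  fix i j assume "i < dim_row B" "j < dim_col B"
  moreover have "n = dim_row B" "m = dim_col B"
    using arg_cong[OF assms(1), of dim_row] arg_cong[OF assms(1), of dim_col] by simp_all
  moreover have "(A - B) $$ (i, j) = 0\<^sub>m n m $$ (i, j)" using assms(1) by simp
  ultimately show "A $$ (i, j) = B $$ (i, j)" by simp
qed (rule assms)+

lemmas mat_simps = mat_assoc mat_distribs
  adjoint_mult adjoint_add adjoint_minus adjoint_uminus adjoint_smult

text \<open>The \<open>j\<close>-th diagonal entry of \<open>A\<^sup>* A\<close> is the squared norm
  of the \<open>j\<close>-th column, and a unit vector tests it. This is how an inequality between
  Gram matrices is later turned into an identity.\<close>

lemma adjoint_mult_self_eq_0D:
  fixes A :: "complex mat"
  assumes "nonneg_herm (- (mat_adjoint A * A))"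
  shows "A = 0\<^sub>m (dim_row A) (dim_col A)"
proof (rule eq_matI)
  fix i j assume ij: "i < dim_row (0\<^sub>m (dim_row A) (dim_col A))" "j < dim_col (0\<^sub>m (dim_row A) (dim_col A))"
  then have ij: "i < dim_row A" "j < dim_col A" by auto
  let ?M = "- (mat_adjoint A * A)"
  have "0 \<le> Re ((?M *\<^sub>v unit_vec (dim_col A) j) \<bullet>c unit_vec (dim_col A) j)"
    using assms by (auto simp: nonneg_herm_def)
  also have "(?M *\<^sub>v unit_vec (dim_col A) j) \<bullet>c unit_vec (dim_col A) j = ?M $$ (j, j)"
  proof -
    have "conjugate (unit_vec (dim_col A) j) = (unit_vec (dim_col A) j :: complex vec)"
      by (rule eq_vecI) (auto simp: unit_vec_def)
    moreover have "?M *\<^sub>v unit_vec (dim_col A) j = col ?M j"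
      by (rule eq_vecI) (use ij in \<open>auto simp: scalar_prod_right_unit\<close>)
    ultimately show ?thesis using ij
      by (simp add: scalar_prod_right_unit[where n = "dim_col A"])
  qed
  also have "\<dots> = - (\<Sum>k<dim_row A. cnj (A $$ (k, j)) * A $$ (k, j))"
    using ij by (simp add: index_mult_sum del: index_mult_mat(1))
  also have "Re \<dots> = - (\<Sum>k<dim_row A. (cmod (A $$ (k, j)))\<^sup>2)"
    by (simp add: cmod_power2 sum.distrib flip: power2_eq_square)
  finally have "(\<Sum>k<dim_row A. (cmod (A $$ (k, j)))\<^sup>2) \<le> 0" by simp
  then have "(\<Sum>k<dim_row A. (cmod (A $$ (k, j)))\<^sup>2) = 0"
    by (intro antisym sum_nonneg) auto
  then have "(cmod (A $$ (i, j)))\<^sup>2 = 0" using ij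
    by (subst (asm) sum_nonneg_eq_0_iff) auto
  then show "A $$ (i, j) = 0\<^sub>m (dim_row A) (dim_col A) $$ (i, j)" using ij by simp
qed auto


lemma quadratic_form:
  fixes A :: "complex mat"
  assumes "dim_row A = n" "dim_col A = n" "dim_vec x = n"
  shows "(A *\<^sub>v x) \<bullet>c x = (\<Sum>i<n. \<Sum>j<n. cnj (x $ i) * A $$ (i, j) * x $ j)"
proof -
  have "(A *\<^sub>v x) \<bullet>c x = (\<Sum>i<n. (\<Sum>j<n. A $$ (i, j) * x $ j) * cnj (x $ i))"
    using assms by (simp add: scalar_prod_def atLeast0LessThan)
  then show ?thesis by (simp add: sum_distrib_left sum_distrib_right mult.assoc mult.commute mult.left_commute)
qed

lemma nonneg_hermI:
  assumes "A \<in> carrier_mat n n" "mat_adjoint A = A"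
    and "\<And>x. 0 \<le> Re (\<Sum>i<n. \<Sum>j<n. cnj (x i) * A $$ (i, j) * x j)"
  shows "nonneg_herm A"
  unfolding nonneg_herm_def
proof (intro conjI ballI)
  fix x :: "complex vec" assume "x \<in> carrier_vec (dim_row A)"
  then show "0 \<le> Re ((A *\<^sub>v x) \<bullet>c x)"
    using assms(1) assms(3)[of "\<lambda>i. x $ i"] by (subst quadratic_form[where n = n]) auto
qed (use assms in auto)

lemma nonneg_hermD:
  assumes "nonneg_herm A" "A \<in> carrier_mat n n"
  shows "mat_adjoint A = A" "0 \<le> Re (\<Sum>i<n. \<Sum>j<n. cnj (x i) * A $$ (i, j) * x j)"
proof -
  show "mat_adjoint A = A" using assms by (simp add: nonneg_herm_def)
  have "0 \<le> Re ((A *\<^sub>v Matrix.vec n x) \<bullet>c Matrix.vec n x)"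
    using assms by (auto simp: nonneg_herm_def)
  then show "0 \<le> Re (\<Sum>i<n. \<Sum>j<n. cnj (x i) * A $$ (i, j) * x j)"
    using assms by (subst (asm) quadratic_form[where n = n]) auto
qed

lemma nonneg_herm_adjoint_mult: "nonneg_herm (mat_adjoint A * A)"
proof (rule nonneg_hermI)
  let ?n = "dim_col A"
  fix x :: "nat \<Rightarrow> complex"
  have "(\<Sum>i<?n. \<Sum>j<?n. cnj (x i) * (mat_adjoint A * A) $$ (i, j) * x j)
      = (\<Sum>i<?n. \<Sum>j<?n. \<Sum>k<dim_row A. cnj (A $$ (k, i) * x i) * (A $$ (k, j) * x j))"
  proof (intro sum.cong refl)
    fix i j assume "i \<in> {..<?n}" "j \<in> {..<?n}"
    then have "(mat_adjoint A * A) $$ (i, j) = (\<Sum>k<dim_row A. cnj (A $$ (k, i)) * A $$ (k, j))"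
      by (subst index_mult_sum) auto
    show "cnj (x i) * (mat_adjoint A * A) $$ (i, j) * x j
        = (\<Sum>k<dim_row A. cnj (A $$ (k, i) * x i) * (A $$ (k, j) * x j))"
      unfolding \<open>_ = _\<close> sum_distrib_left sum_distrib_right by (intro sum.cong refl) simp
  qed
  also have "\<dots> = (\<Sum>i<?n. \<Sum>k<dim_row A. \<Sum>j<?n. cnj (A $$ (k, i) * x i) * (A $$ (k, j) * x j))"
    by (intro sum.cong refl sum.swap)
  also have "\<dots> = (\<Sum>k<dim_row A. \<Sum>i<?n. \<Sum>j<?n. cnj (A $$ (k, i) * x i) * (A $$ (k, j) * x j))"
    by (rule sum.swap)
  also have "\<dots> = (\<Sum>k<dim_row A. cnj (\<Sum>i<?n. A $$ (k, i) * x i) * (\<Sum>i<?n. A $$ (k, i) * x i))"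
    by (simp only: sum_product cnj_sum)
  also have "\<dots> = (\<Sum>k<dim_row A. of_real ((cmod (\<Sum>i<?n. A $$ (k, i) * x i))\<^sup>2))"
    by (intro sum.cong refl) (simp only: complex_norm_square mult.commute)
  finally show "0 \<le> Re (\<Sum>i<?n. \<Sum>j<?n. cnj (x i) * (mat_adjoint A * A) $$ (i, j) * x j)"
    by (simp add: sum_nonneg flip: of_real_sum)
qed (auto simp: mat_simps)

text \<open>The deflation step of the spectral theorem. A basis beginning with \<open>v\<close> is
  orthogonalized; the resulting vectors are not yet normalized, so they are divided by their norms
  \<open>r\<close>, and \<open>c\<close> is what this does to \<open>v\<close>.\<close>

lemma unitary_completion:
  fixes v :: "complex vec"
  assumes v: "v \<in> carrier_vec n" "v \<noteq> 0\<^sub>v n"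
  obtains W c where "W \<in> carrier_mat n n" "mat_adjoint W * W = 1\<^sub>m n" "W * mat_adjoint W = 1\<^sub>m n"
    "col W 0 = c \<cdot>\<^sub>v v"
proof -
  interpret cof_vec_space n "TYPE(complex)" .
  define b where "b = basis_completion v"
  define ws where "ws = gram_schmidt n b"
  note bc = basis_completion[OF v, folded b_def]
  note gs = gram_schmidt_result[OF bc(2,4,5) ws_def]
  have len: "length ws = n" using gs(4) bc(6) by simp
  have "n \<noteq> 0" using v by (metis eq_vecI carrier_vecD index_zero_vec(2) less_nat_zero_code)
  obtain bs where b: "b = v # bs" using bc(6,7) \<open>n \<noteq> 0\<close> by (cases b) auto
  have hd: "ws ! 0 = v"
    using gram_schmidt_hd[OF v(1), of bs] len \<open>n \<noteq> 0\<close> b unfolding ws_def[symmetric]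
    by (metis b hd_conv_nth length_0_conv ws_def)
  have dim: "dim_vec (ws ! i) = n" if "i < n" for i
    using gs(3) that len by (metis carrier_vecD nth_mem subsetD)
  define r where "r i = sqrt (\<Sum>k<n. (cmod (ws ! i $ k))\<^sup>2)" for i
  have self: "(\<Sum>k<n. ws ! i $ k * cnj (ws ! i $ k)) = of_real ((r i)\<^sup>2)" for i
    by (simp add: r_def sum_nonneg flip: complex_norm_square)
  have orth: "(\<Sum>k<n. ws ! i $ k * cnj (ws ! j $ k)) = 0 \<longleftrightarrow> i \<noteq> j" if "i < n" "j < n" for i j
    using corthogonalD[OF gs(2), of i j] that len dim by (simp add: scalar_prod_def atLeast0LessThan)
  have r0: "r i \<noteq> 0" if "i < n" for i using orth[OF that that] self[of i] by auto
  define W where "W = Matrix.mat n n (\<lambda>(i, j). ws ! j $ i / of_real (r j))"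
  have W: "W \<in> carrier_mat n n" by (simp add: W_def)
  have WW: "mat_adjoint W * W = 1\<^sub>m n"
  proof (rule eq_matI)
    fix i j assume "i < dim_row (1\<^sub>m n :: complex mat)" "j < dim_col (1\<^sub>m n :: complex mat)"
    then have ij: "i < n" "j < n" by auto
    have "(mat_adjoint W * W) $$ (i, j) = (\<Sum>k<n. ws ! j $ k * cnj (ws ! i $ k)) / of_real (r i * r j)"
      using ij W by (subst index_mult_sum) (auto simp: W_def sum_divide_distrib mult_ac)
    also have "\<dots> = (if i = j then 1 else 0)"
      using orth[OF ij(2,1)] self[of i] r0[OF ij(1)] by (auto simp: power2_eq_square)
    finally show "(mat_adjoint W * W) $$ (i, j) = 1\<^sub>m n $$ (i, j)" using ij by simp
  qed (use W in auto)
  have "W * mat_adjoint W = 1\<^sub>m n"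
    by (rule mat_mult_left_right_inverse[OF _ W WW]) (use W in simp)
  moreover have "col W 0 = (1 / of_real (r 0)) \<cdot>\<^sub>v v"
    by (rule eq_vecI) (use hd v \<open>n \<noteq> 0\<close> in \<open>auto simp: W_def\<close>)
  ultimately show ?thesis using that W WW by blast
qed

section \<open>Spectral theorem and factorization of non-negative Hermitian matrices\<close>

lemma index_mult_diag_adjoint:
  fixes U :: "complex mat"
  assumes "U \<in> carrier_mat m n" "i < m" "j < m"
  shows "(U * mat_diag n f * mat_adjoint U) $$ (i, j) = (\<Sum>k<n. U $$ (i, k) * f k * cnj (U $$ (j, k)))"
proof -
  have "U * mat_diag n f = Matrix.mat m n (\<lambda>(i, j). U $$ (i, j) * f j)"
    using mat_diag_mult_right[OF assms(1)] by simp
  then show ?thesis using assms by (simp only:) (subst index_mult_sum, auto)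
qed

lemma index_adjoint_mult_self:
  fixes U :: "complex mat"
  assumes "U \<in> carrier_mat m n" "i < n" "j < n"
  shows "(mat_adjoint U * U) $$ (i, j) = (\<Sum>k<m. cnj (U $$ (k, i)) * U $$ (k, j))"
  using assms by (subst index_mult_sum) auto

lemma complex_eigenvector_exists:
  fixes A :: "complex mat"
  assumes A: "A \<in> carrier_mat n n" and "0 < n"
  obtains v e where "v \<in> carrier_vec n" "v \<noteq> 0\<^sub>v n" "A *\<^sub>v v = e \<cdot>\<^sub>v v"
proof -
  have "degree (char_poly A) = n" using degree_monic_char_poly[OF A] by simp
  then have "\<not> constant (poly (char_poly A))" using \<open>0 < n\<close> by (simp add: constant_degree)
  then obtain e where "poly (char_poly A) e = 0" using fundamental_theorem_of_algebra by blast
  then have "eigenvalue A e" using eigenvalue_root_char_poly[OF A] by simp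
  then show ?thesis using that A unfolding eigenvalue_def eigenvector_def by auto
qed

text \<open>Products are kept nested to the right, so a cancellation has to be available in front of
  a remaining factor \<open>X\<close>.\<close>

lemma mat_inverse_cancel:
  fixes P Q X :: "'a :: semiring_1 mat"
  assumes "P * Q = 1\<^sub>m n" "dim_col P = dim_row Q" "dim_row X = n"
  shows "P * (Q * X) = X"
proof -
  have "dim_col Q = n" using arg_cong[OF assms(1), of dim_col] by simp
  then have "P * (Q * X) = P * Q * X" using assms(2,3) by (simp add: mat_assoc)
  then show ?thesis using assms by simp
qed

text \<open>Induction on the dimension. Conjugation with a unitary matrix whose first column is an
  eigenvector leaves only the eigenvalue in the first column; the Hermitian property clears the
  first row as well, and the induction hypothesis diagonalizes the remaining corner.\<close>

theorem hermitian_spectral: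
  fixes A :: "complex mat"
  assumes "A \<in> carrier_mat n n" "mat_adjoint A = A"
  obtains U and d :: "nat \<Rightarrow> real" where "U \<in> carrier_mat n n" "mat_adjoint U * U = 1\<^sub>m n" "U * mat_adjoint U = 1\<^sub>m n"
    "A = U * mat_diag n (\<lambda>i. of_real (d i)) * mat_adjoint U"
proof -
  have "\<exists>U (d :: nat \<Rightarrow> real). U \<in> carrier_mat n n \<and> mat_adjoint U * U = 1\<^sub>m n \<and> U * mat_adjoint U = 1\<^sub>m n
    \<and> A = U * mat_diag n (\<lambda>i. of_real (d i)) * mat_adjoint U"
    using assms
  proof (induction n arbitrary: A)
    case 0
    then show ?case by (intro exI[of _ "1\<^sub>m 0"] exI[of _ "\<lambda>_. 0"]) (auto intro!: eq_matI)
  next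
    case (Suc n)
    note A = Suc.prems(1)
    obtain v e where v: "v \<in> carrier_vec (Suc n)" "v \<noteq> 0\<^sub>v (Suc n)" and ev: "A *\<^sub>v v = e \<cdot>\<^sub>v v"
      using complex_eigenvector_exists[OF A] by auto
    obtain W c where W: "W \<in> carrier_mat (Suc n) (Suc n)" and WW: "mat_adjoint W * W = 1\<^sub>m (Suc n)"
      "W * mat_adjoint W = 1\<^sub>m (Suc n)" and c: "col W 0 = c \<cdot>\<^sub>v v"
      using unitary_completion[OF v] by blast
    define A' where "A' = mat_adjoint W * A * W"
    have A': "A' \<in> carrier_mat (Suc n) (Suc n)" using A W by (simp add: A'_def)
    have hA': "mat_adjoint A' = A'" using A W Suc.prems(2) by (simp add: A'_def mat_simps)
    have AW: "(A * W) $$ (k, 0) = e * W $$ (k, 0)" if "k < Suc n" for k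
    proof -
      have "A *\<^sub>v col W 0 = e \<cdot>\<^sub>v col W 0"
        unfolding c using A v ev by (simp add: mult_mat_vec smult_smult_assoc mult.commute)
      moreover have "(A * W) $$ (k, 0) = (A *\<^sub>v col W 0) $ k" using A W that by simp
      ultimately show ?thesis using W that by simp
    qed
    have col0: "A' $$ (i, 0) = (if i = 0 then e else 0)" if i: "i < Suc n" for i
    proof -
      have "A' $$ (i, 0) = (mat_adjoint W * (A * W)) $$ (i, 0)" using A W by (simp add: A'_def mat_simps)
      also have "\<dots> = (\<Sum>k<Suc n. cnj (W $$ (k, i)) * (A * W) $$ (k, 0))"
        using A W i by (subst index_mult_sum) auto
      also have "\<dots> = e * (\<Sum>k<Suc n. cnj (W $$ (k, i)) * W $$ (k, 0))"
        unfolding sum_distrib_left by (intro sum.cong refl) (simp add: AW)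
      also have "\<dots> = e * (mat_adjoint W * W) $$ (i, 0)"
        using index_adjoint_mult_self[OF W i, of 0] by simp
      finally show ?thesis using i by (simp add: WW)
    qed
    have row0: "A' $$ (0, i) = (if i = 0 then cnj e else 0)" if i: "i < Suc n" for i
      using col0[OF i] A' i arg_cong[OF hA', of "\<lambda>M. M $$ (0, i)"] by auto
    have e: "e = of_real (Re e)"
      using col0[of 0] row0[of 0] by (simp add: complex_eq_iff)
    define A3 where "A3 = Matrix.mat n n (\<lambda>(i, j). A' $$ (Suc i, Suc j))"
    have "mat_adjoint A3 = A3"
    proof (rule eq_matI)
      fix i j assume "i < dim_row A3" "j < dim_col A3"
      then show "mat_adjoint A3 $$ (i, j) = A3 $$ (i, j)"
        using A' arg_cong[OF hA', of "\<lambda>M. M $$ (Suc i, Suc j)"] by (simp add: A3_def)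
    qed (simp_all add: A3_def)
    then obtain U d where U: "U \<in> carrier_mat n n" and UU: "mat_adjoint U * U = 1\<^sub>m n" "U * mat_adjoint U = 1\<^sub>m n"
      and A3: "A3 = U * mat_diag n (\<lambda>i. of_real (d i :: real)) * mat_adjoint U"
      using Suc.IH[of A3] by (auto simp: A3_def)
    \<comment> \<open>The block diagonal matrix of \<open>1\<close> and \<open>U\<close>, which
      diagonalizes the corner without touching the eigenvalue.\<close>
    define V where "V = Matrix.mat (Suc n) (Suc n) (\<lambda>(i, j). case (i, j) of (0, 0) \<Rightarrow> 1 | (Suc i, Suc j) \<Rightarrow> U $$ (i, j) | _ \<Rightarrow> 0)"
    have V: "V \<in> carrier_mat (Suc n) (Suc n)" by (simp add: V_def)
    have VV: "mat_adjoint V * V = 1\<^sub>m (Suc n)"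
    proof (rule eq_matI)
      fix i j assume "i < dim_row (1\<^sub>m (Suc n) :: complex mat)" "j < dim_col (1\<^sub>m (Suc n) :: complex mat)"
      then have ij: "i < Suc n" "j < Suc n" by auto
      have *: "(\<Sum>k<n. cnj (U $$ (k, i)) * U $$ (k, j)) = (if i = j then 1 else 0)" if "i < n" "j < n" for i j
        using index_adjoint_mult_self[OF U that] that by (simp add: UU)
      show "(mat_adjoint V * V) $$ (i, j) = 1\<^sub>m (Suc n) $$ (i, j)"
        unfolding index_adjoint_mult_self[OF V ij] sum.lessThan_Suc_shift
        using ij by (auto simp: V_def * split: nat.split)
    qed (use V in auto)
    have VV': "V * mat_adjoint V = 1\<^sub>m (Suc n)"
      by (rule mat_mult_left_right_inverse[OF _ V VV]) (use V in simp)
    define D where "D = mat_diag (Suc n) (\<lambda>i. complex_of_real (case i of 0 \<Rightarrow> Re e | Suc i \<Rightarrow> d i))"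
    have D: "D \<in> carrier_mat (Suc n) (Suc n)" by (simp add: D_def)
    have A'V: "A' = V * D * mat_adjoint V"
    proof (rule eq_matI)
      fix i j assume "i < dim_row (V * D * mat_adjoint V)" "j < dim_col (V * D * mat_adjoint V)"
      then have ij: "i < Suc n" "j < Suc n" using V by auto
      have *: "(\<Sum>k<n. U $$ (i, k) * of_real (d k) * cnj (U $$ (j, k))) = A' $$ (Suc i, Suc j)"
        if "i < n" "j < n" for i j
        using index_mult_diag_adjoint[OF U that] arg_cong[OF A3, of "\<lambda>M. M $$ (i, j)"] that
        by (simp add: A3_def)
      show "A' $$ (i, j) = (V * D * mat_adjoint V) $$ (i, j)"
        unfolding D_def index_mult_diag_adjoint[OF V ij] sum.lessThan_Suc_shift
        using ij e by (auto simp: V_def * col0 row0 split: nat.split)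
    qed (use A' V in auto)
    have "(W * V) * D * mat_adjoint (W * V) = W * (A' * mat_adjoint W)"
      using W V D by (simp add: A'V mat_simps)
    also have "\<dots> = A"
      using A W by (simp add: A'_def mat_simps mat_inverse_cancel[OF WW(2)] WW)
    finally have "A = (W * V) * D * mat_adjoint (W * V)" ..
    moreover have 1: "mat_adjoint (W * V) * (W * V) = 1\<^sub>m (Suc n)"
      using W V by (simp add: mat_simps mat_inverse_cancel[OF WW(1)] VV)
    moreover have "(W * V) * mat_adjoint (W * V) = 1\<^sub>m (Suc n)"
      by (rule mat_mult_left_right_inverse[OF _ _ 1]) (use W V in auto)
    ultimately show ?case using W V unfolding D_def by (intro exI[of _ "W * V"] exI conjI) simp_all
  qed
  then show ?thesis using that by blast
qed

lemma adjoint_inner: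
  fixes C :: "complex mat"
  assumes "dim_row C = dim_vec y" "dim_col C = dim_vec x"
  shows "(mat_adjoint C *\<^sub>v y) \<bullet>c x = y \<bullet>c (C *\<^sub>v x)"
proof -
  have "(mat_adjoint C *\<^sub>v y) \<bullet>c x = (\<Sum>i<dim_col C. \<Sum>k<dim_row C. cnj (C $$ (k, i)) * y $ k * cnj (x $ i))"
    using assms by (simp add: scalar_prod_def atLeast0LessThan sum_distrib_right)
  also have "\<dots> = (\<Sum>k<dim_row C. \<Sum>i<dim_col C. cnj (C $$ (k, i)) * y $ k * cnj (x $ i))"
    by (rule sum.swap)
  also have "\<dots> = y \<bullet>c (C *\<^sub>v x)"
    using assms by (simp add: scalar_prod_def atLeast0LessThan sum_distrib_left mult_ac)
  finally show ?thesis .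
qed

lemma nonneg_herm_congruence:
  assumes "nonneg_herm A" "A \<in> carrier_mat n n" "C \<in> carrier_mat n m"
  shows "nonneg_herm (mat_adjoint C * A * C)"
  unfolding nonneg_herm_def
proof (intro conjI ballI)
  fix x :: "complex vec" assume "x \<in> carrier_vec (dim_row (mat_adjoint C * A * C))"
  then have x: "x \<in> carrier_vec m" using assms by simp
  have "(mat_adjoint C * A * C) *\<^sub>v x = mat_adjoint C *\<^sub>v (A *\<^sub>v (C *\<^sub>v x))"
    using assms x by (simp add: assoc_mult_mat_vec[of "mat_adjoint C" m n A n] mat_assoc
      assoc_mult_mat_vec[of "mat_adjoint C" m n "A * C" m] assoc_mult_mat_vec[of A n n C m])
  then have "((mat_adjoint C * A * C) *\<^sub>v x) \<bullet>c x = (A *\<^sub>v (C *\<^sub>v x)) \<bullet>c (C *\<^sub>v x)"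
    using assms x by (simp add: adjoint_inner)
  moreover have "0 \<le> Re ((A *\<^sub>v (C *\<^sub>v x)) \<bullet>c (C *\<^sub>v x))"
    using assms x unfolding nonneg_herm_def by (metis mult_mat_vec_carrier carrier_matD(1))
  ultimately show "0 \<le> Re (((mat_adjoint C * A * C) *\<^sub>v x) \<bullet>c x)" by simp
qed (use assms nonneg_hermD(1)[OF assms(1,2)] in \<open>auto simp: mat_simps\<close>)

lemma nonneg_herm_diag:
  assumes "nonneg_herm A" "A \<in> carrier_mat n n" "i < n"
  shows "0 \<le> Re (A $$ (i, i))"
proof -
  have "(\<Sum>k<n. \<Sum>l<n. cnj (if k = i then 1 else 0) * A $$ (k, l) * (if l = i then 1 else 0))
    = (\<Sum>k<n. \<Sum>l<n. if l = i then (if k = i then A $$ (k, l) else 0) else 0)"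
    by (intro sum.cong refl) auto
  also have "\<dots> = A $$ (i, i)" using assms by (simp add: sum.delta)
  finally show ?thesis
    using nonneg_hermD(2)[OF assms(1,2), of "\<lambda>k. if k = i then 1 else 0"] by simp
qed

lemma dim_mat_diag [simp]: "dim_row (mat_diag n f) = n" "dim_col (mat_diag n f) = n"
  by (simp_all add: mat_diag_def)

lemma diag_calculus_mult:
  fixes U :: "complex mat"
  assumes "U \<in> carrier_mat n n" "mat_adjoint U * U = 1\<^sub>m n"
  shows "(U * mat_diag n f * mat_adjoint U) * (U * mat_diag n g * mat_adjoint U)
    = U * mat_diag n (\<lambda>i. f i * g i) * mat_adjoint U"
proof -
  have "mat_adjoint U * (U * (mat_diag n g * mat_adjoint U)) = mat_diag n g * mat_adjoint U"
    using assms by (intro mat_inverse_cancel[OF assms(2)]) auto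
  moreover have "mat_diag n f * (mat_diag n g * mat_adjoint U) = mat_diag n (\<lambda>i. f i * g i) * mat_adjoint U"
    using assms by (simp add: mat_diag_diag flip: mat_assoc)
  ultimately show ?thesis using assms by (simp add: mat_simps)
qed

lemma adjoint_diag: "mat_adjoint (mat_diag n f) = mat_diag n (\<lambda>i. cnj (f i))"
  by (rule eq_matI) (auto simp: mat_diag_def)

lemma diag_calculus_adjoint:
  fixes U :: "complex mat"
  assumes "U \<in> carrier_mat n n"
  shows "mat_adjoint (U * mat_diag n f * mat_adjoint U) = U * mat_diag n (\<lambda>i. cnj (f i)) * mat_adjoint U"
  using assms by (simp add: mat_simps adjoint_diag)

lemma nonneg_herm_spectral:
  assumes "nonneg_herm A" "A \<in> carrier_mat n n"
  obtains U and d :: "nat \<Rightarrow> real" where "U \<in> carrier_mat n n" "mat_adjoint U * U = 1\<^sub>m n" "U * mat_adjoint U = 1\<^sub>m n"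
    "A = U * mat_diag n (\<lambda>i. of_real (d i)) * mat_adjoint U" "\<And>i. i < n \<Longrightarrow> 0 \<le> d i"
proof -
  obtain U and d :: "nat \<Rightarrow> real" where U: "U \<in> carrier_mat n n" "mat_adjoint U * U = 1\<^sub>m n" "U * mat_adjoint U = 1\<^sub>m n"
    and A: "A = U * mat_diag n (\<lambda>i. of_real (d i)) * mat_adjoint U"
    by (rule hermitian_spectral[OF assms(2) nonneg_hermD(1)[OF assms]])
  have "mat_adjoint U * A * U = mat_diag n (\<lambda>i. of_real (d i))"
    unfolding A using U(1) by (simp add: mat_simps mat_inverse_cancel[OF U(2)] U(2))
  then have "0 \<le> d i" if "i < n" for i
    using nonneg_herm_diag[OF nonneg_herm_congruence[OF assms U(1)], of n i] that U(1) assms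
    by (simp add: mat_diag_def)
  then show ?thesis using that U A by blast
qed

lemma nonneg_herm_factor:
  assumes "nonneg_herm A" "A \<in> carrier_mat n n"
  obtains C where "C \<in> carrier_mat n n" "A = mat_adjoint C * C"
proof -
  obtain U and d :: "nat \<Rightarrow> real" where U: "U \<in> carrier_mat n n" "mat_adjoint U * U = 1\<^sub>m n" "U * mat_adjoint U = 1\<^sub>m n"
    and A: "A = U * mat_diag n (\<lambda>i. of_real (d i)) * mat_adjoint U" and d: "\<And>i. i < n \<Longrightarrow> 0 \<le> d i"
    using nonneg_herm_spectral[OF assms] by blast
  define C where "C = mat_diag n (\<lambda>i. of_real (sqrt (d i))) * mat_adjoint U"
  have eq: "mat_diag n (\<lambda>i. of_real (d i)) = (mat_diag n (\<lambda>i. of_real (sqrt (d i)) * of_real (sqrt (d i))) :: complex mat)"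
    by (rule eq_matI) (auto simp: mat_diag_def d simp flip: of_real_mult)
  show ?thesis
  proof
    show "C \<in> carrier_mat n n" using U by (simp add: C_def)
    have "mat_adjoint C * C = U * ((mat_diag n (\<lambda>i. of_real (sqrt (d i))) * mat_diag n (\<lambda>i. of_real (sqrt (d i)))) * mat_adjoint U)"
      using U(1) by (simp add: C_def mat_simps adjoint_diag del: mat_diag_diag)
    then show "A = mat_adjoint C * C" unfolding A eq using U(1) by (simp add: mat_simps)
  qed
qed

lemma adjoint_mult_self_eq_0:
  fixes A :: "complex mat"
  assumes "mat_adjoint A * A = 0\<^sub>m m m" "A \<in> carrier_mat n m"
  shows "A = 0\<^sub>m n m"
proof -
  have "nonneg_herm (0\<^sub>m m m)" by (rule nonneg_hermI[of _ m]) auto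
  moreover have "- 0\<^sub>m m m = (0\<^sub>m m m :: complex mat)" by (rule eq_matI) auto
  ultimately show ?thesis using adjoint_mult_self_eq_0D[of A] assms by simp
qed

section \<open>Moore-Penrose inverses\<close>

lemma is_mp_inverse_unique:
  assumes "is_mp_inverse A X" "is_mp_inverse A Y"
  shows "X = Y"
proof -
  have dims: "dim_row X = dim_col A" "dim_col X = dim_row A" "dim_row Y = dim_col A" "dim_col Y = dim_row A"
    using assms by (auto simp: is_mp_inverse_def)
  note X = assms(1)[unfolded is_mp_inverse_def] note Y = assms(2)[unfolded is_mp_inverse_def]
  \<comment> \<open>\<open>A X\<close> and \<open>A Y\<close> are orthogonal projections onto the
    same range, so each absorbs the other; taking adjoints turns this into equality. The same works
    for \<open>X A\<close> and \<open>Y A\<close>.\<close>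
  have "A * X = A * Y"
  proof -
    have "A * X = (A * Y) * (A * X)" using Y dims by (metis index_mult_mat(3) mat_assoc)
    then have "mat_adjoint (A * X) = mat_adjoint (A * X) * mat_adjoint (A * Y)"
      using dims adjoint_mult[of "A * Y" "A * X"] by simp
    then have "A * X = (A * X) * (A * Y)" using X Y by simp
    also have "\<dots> = A * Y" using X dims by (metis index_mult_mat(3) mat_assoc)
    finally show ?thesis .
  qed
  moreover have "X * A = Y * A"
  proof -
    have "Y * A = Y * (A * X * A)" using X by simp
    also have "\<dots> = (Y * A) * (X * A)" using dims by (simp add: mat_assoc)
    finally have "mat_adjoint (Y * A) = mat_adjoint (X * A) * mat_adjoint (Y * A)"
      using dims adjoint_mult[of "Y * A" "X * A"] by simp
    then have "Y * A = X * (A * (Y * A))" using X Y dims by (simp add: mat_assoc)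
    also have "A * (Y * A) = A" using Y dims by (metis mat_assoc)
    finally show ?thesis by simp
  qed
  ultimately show ?thesis using X Y dims by (metis mat_assoc)
qed

lemma mp_inverse_hermitian:
  fixes A :: "complex mat"
  assumes "A \<in> carrier_mat n n" "mat_adjoint A = A"
  shows "mp_inverse A \<in> carrier_mat n n" "A * (mp_inverse A * A) = A" "mp_inverse A * (A * mp_inverse A) = mp_inverse A"
    "mat_adjoint (mp_inverse A) = mp_inverse A" "mp_inverse A * A = A * mp_inverse A"
proof -
  obtain U and d :: "nat \<Rightarrow> real" where U: "U \<in> carrier_mat n n" "mat_adjoint U * U = 1\<^sub>m n" "U * mat_adjoint U = 1\<^sub>m n"
    and A: "A = U * mat_diag n (\<lambda>i. of_real (d i)) * mat_adjoint U"
    using hermitian_spectral[OF assms] by blast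
  \<comment> \<open>Since \<open>inverse 0 = 0\<close>, exactly the non-zero eigenvalues are
    inverted.\<close>
  define X where "X = U * mat_diag n (\<lambda>i. inverse (of_real (d i))) * mat_adjoint U"
  have inv: "x * inverse x * x = x" "inverse x * x * inverse x = inverse x" for x :: complex
    by (cases "x = 0"; simp)+
  have X: "X \<in> carrier_mat n n" using U by (simp add: X_def)
  have AXA: "A * X * A = A" "X * A * X = X"
    unfolding A X_def by (simp_all add: diag_calculus_mult[OF U(1,2)] inv)
  have AX: "mat_adjoint (A * X) = A * X" "mat_adjoint (X * A) = X * A" "mat_adjoint X = X" "X * A = A * X"
    unfolding A X_def by (simp_all add: diag_calculus_mult[OF U(1,2)] diag_calculus_adjoint[OF U(1)] mult.commute)
  have "is_mp_inverse A X" using AXA AX X assms by (simp add: is_mp_inverse_def)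
  then have mp: "mp_inverse A = X"
    unfolding mp_inverse_def using is_mp_inverse_unique by (intro the_equality) auto
  have "A * (X * A) = A" "X * (A * X) = X" using AXA X assms(1) by (simp_all only: mat_assoc carrier_matD)
  then show "mp_inverse A \<in> carrier_mat n n" "A * (mp_inverse A * A) = A" "mp_inverse A * (A * mp_inverse A) = mp_inverse A"
    "mat_adjoint (mp_inverse A) = mp_inverse A" "mp_inverse A * A = A * mp_inverse A"
    using X AX unfolding mp by blast+
qed

section \<open>Operator models of moment sequences\<close>

lemma mat_sum_carrier [simp]: "mat_sum q f I \<in> carrier_mat q q"
  by (simp add: mat_sum_def)

lemma mat_sum_dims [simp]: "dim_row (mat_sum q f I) = q" "dim_col (mat_sum q f I) = q"
  by (simp_all add: mat_sum_def)

lemma index_mat_sum: "i < q \<Longrightarrow> j < q \<Longrightarrow> mat_sum q f I $$ (i, j) = (\<Sum>l\<in>I. f l $$ (i, j))"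
  by (simp add: mat_sum_def)

lemma mat_sum_empty [simp]: "mat_sum q f {} = 0\<^sub>m q q"
  by (rule eq_matI) (auto simp: index_mat_sum)

lemma mat_sum_Suc:
  "f n \<in> carrier_mat q q \<Longrightarrow> mat_sum q f {..<Suc n} = mat_sum q f {..<n} + f n"
  by (rule eq_matI) (auto simp: index_mat_sum)

lemma mat_sum_Suc_shift:
  "f 0 \<in> carrier_mat q q \<Longrightarrow> mat_sum q f {..<Suc n} = f 0 + mat_sum q (\<lambda>l. f (Suc l)) {..<n}"
  by (rule eq_matI) (auto simp: index_mat_sum sum.lessThan_Suc_shift simp del: sum.lessThan_Suc)

lemma mat_sum_uminus:
  assumes "\<And>l. l \<in> I \<Longrightarrow> f l \<in> carrier_mat q q"
  shows "mat_sum q (\<lambda>l. - f l) I = - mat_sum q f I"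
  by (rule eq_matI) (auto simp: index_mat_sum carrier_matD[OF assms] simp flip: sum_negf)

lemma mult_mat_sum:
  assumes "X \<in> carrier_mat q q" "\<And>l. l \<in> I \<Longrightarrow> f l \<in> carrier_mat q q"
  shows "X * mat_sum q f I = mat_sum q (\<lambda>l. X * f l) I"
proof (rule eq_matI)
  fix i j assume "i < dim_row (mat_sum q (\<lambda>l. X * f l) I)" "j < dim_col (mat_sum q (\<lambda>l. X * f l) I)"
  then have ij: "i < q" "j < q" by auto
  have "(X * mat_sum q f I) $$ (i, j) = (\<Sum>k<q. \<Sum>l\<in>I. X $$ (i, k) * f l $$ (k, j))"
    using assms(1) ij by (subst index_mult_sum) (auto simp: index_mat_sum sum_distrib_left)
  also have "\<dots> = (\<Sum>l\<in>I. \<Sum>k<q. X $$ (i, k) * f l $$ (k, j))" by (rule sum.swap)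
  also have "\<dots> = (\<Sum>l\<in>I. (X * f l) $$ (i, j))"
  proof (rule sum.cong[OF refl])
    fix l assume "l \<in> I"
    from assms(2)[OF this] show "(\<Sum>k<q. X $$ (i, k) * f l $$ (k, j)) = (X * f l) $$ (i, j)"
      using assms(1) ij by (subst index_mult_sum) auto
  qed
  finally show "(X * mat_sum q f I) $$ (i, j) = mat_sum q (\<lambda>l. X * f l) I $$ (i, j)"
    using ij by (simp add: index_mat_sum)
qed (use assms in auto)

lemma mat_sum_mult:
  assumes "X \<in> carrier_mat q q" "\<And>l. l \<in> I \<Longrightarrow> f l \<in> carrier_mat q q"
  shows "mat_sum q f I * X = mat_sum q (\<lambda>l. f l * X) I"
proof (rule eq_matI)
  fix i j assume "i < dim_row (mat_sum q (\<lambda>l. f l * X) I)" "j < dim_col (mat_sum q (\<lambda>l. f l * X) I)"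
  then have ij: "i < q" "j < q" by auto
  have "(mat_sum q f I * X) $$ (i, j) = (\<Sum>k<q. \<Sum>l\<in>I. f l $$ (i, k) * X $$ (k, j))"
    using assms(1) ij by (subst index_mult_sum) (auto simp: index_mat_sum sum_distrib_right)
  also have "\<dots> = (\<Sum>l\<in>I. \<Sum>k<q. f l $$ (i, k) * X $$ (k, j))" by (rule sum.swap)
  also have "\<dots> = (\<Sum>l\<in>I. (f l * X) $$ (i, j))"
  proof (rule sum.cong[OF refl])
    fix l assume "l \<in> I"
    from assms(2)[OF this] show "(\<Sum>k<q. f l $$ (i, k) * X $$ (k, j)) = (f l * X) $$ (i, j)"
      using assms(1) ij by (subst index_mult_sum) auto
  qed
  finally show "(mat_sum q f I * X) $$ (i, j) = mat_sum q (\<lambda>l. f l * X) I $$ (i, j)"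
    using ij by (simp add: index_mat_sum)
qed (use assms in auto)

definition model_op :: "real \<Rightarrow> complex mat \<Rightarrow> complex mat" where
  "model_op \<alpha> R = complex_of_real \<alpha> \<cdot>\<^sub>m 1\<^sub>m (dim_col R) + mat_adjoint R * R"

primrec krylov :: "real \<Rightarrow> complex mat \<Rightarrow> complex mat \<Rightarrow> nat \<Rightarrow> complex mat" where
  "krylov \<alpha> R B 0 = B"
| "krylov \<alpha> R B (Suc j) = model_op \<alpha> R * krylov \<alpha> R B j"

definition model_moment :: "real \<Rightarrow> complex mat \<Rightarrow> complex mat \<Rightarrow> nat \<Rightarrow> complex mat" where
  "model_moment \<alpha> R B j = mat_adjoint B * krylov \<alpha> R B j"

text \<open>The vectors whose Gram matrix is the Hankel matrix containing the last moment
  \<open>s\<^sub>m\<close>: \<open>H\<^sub>n\<close> for \<open>m = 2n\<close>, and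
  \<open>- \<alpha> H\<^sub>n + K\<^sub>n\<close> for \<open>m = 2n + 1\<close>.\<close>

definition model_vec :: "real \<Rightarrow> nat \<Rightarrow> complex mat \<Rightarrow> complex mat \<Rightarrow> nat \<Rightarrow> complex mat" where
  "model_vec \<alpha> m R B j = (if even m then krylov \<alpha> R B j else R * krylov \<alpha> R B j)"

text \<open>
  The range of the last Krylov vector lies in the span of the ranges of the earlier ones, in terms
  of orthogonal complements. The test matrices \<open>V\<close> have as many columns as \<open>B\<close> only to avoid vectors.
\<close>

definition degenerate :: "real \<Rightarrow> nat \<Rightarrow> complex mat \<Rightarrow> complex mat \<Rightarrow> bool" where
  "degenerate \<alpha> m R B \<longleftrightarrow> (\<forall>V \<in> carrier_mat (dim_row B) (dim_col B).
     (\<forall>j < m div 2. mat_adjoint (model_vec \<alpha> m R B j) * V = 0\<^sub>m (dim_col B) (dim_col B)) \<longrightarrow>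
     mat_adjoint (model_vec \<alpha> m R B (m div 2)) * V = 0\<^sub>m (dim_col B) (dim_col B))"

locale stieltjes_model =
  fixes N q :: nat and \<alpha> :: real and R B :: "complex mat"
  assumes R: "R \<in> carrier_mat N N" and B: "B \<in> carrier_mat N q"
begin

definition "S = mat_adjoint R * R"
definition "T = complex_of_real \<alpha> \<cdot>\<^sub>m 1\<^sub>m N + S"
definition "A = mat_adjoint B * B"
definition "P = mp_inverse A"
text \<open>\<open>B P B\<^sup>*\<close> is the orthogonal projection onto the range of
  \<open>B\<close>, also when \<open>A\<close> is singular; \<open>Q\<close> is the complementary
  projection.\<close>

definition "Q = 1\<^sub>m N - B * (P * mat_adjoint B)"

abbreviation "k \<equiv> krylov \<alpha> R B"
abbreviation "s \<equiv> model_moment \<alpha> R B"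

lemma R_dims [simp]: "dim_row R = N" "dim_col R = N" using R by auto
lemma B_dims [simp]: "dim_row B = N" "dim_col B = q" using B by auto
lemma S_dims [simp]: "dim_row S = N" "dim_col S = N" by (simp_all add: S_def)
lemma T_dims [simp]: "dim_row T = N" "dim_col T = N" by (simp_all add: T_def)
lemma A_dims [simp]: "dim_row A = q" "dim_col A = q" by (simp_all add: A_def)
lemma A_carrier: "A \<in> carrier_mat q q" by (simp add: A_def)
lemma A_adj [simp]: "mat_adjoint A = A" by (simp add: A_def mat_simps)
lemma S_adj [simp]: "mat_adjoint S = S" by (simp add: S_def mat_simps)
lemma T_adj [simp]: "mat_adjoint T = T" by (simp add: T_def mat_simps)
lemmas P_facts = mp_inverse_hermitian[OF A_carrier A_adj, folded P_def]
lemma P_dims [simp]: "dim_row P = q" "dim_col P = q" using P_facts(1) by auto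
lemma P_adj [simp]: "mat_adjoint P = P" by (rule P_facts)
lemma APA: "A * (P * A) = A" by (rule P_facts)
lemma PAP: "P * (A * P) = P" by (rule P_facts)
lemma Q_dims [simp]: "dim_row Q = N" "dim_col Q = N" by (simp_all add: Q_def)
lemma Q_adj [simp]: "mat_adjoint Q = Q" by (simp add: Q_def mat_simps)
lemma model_op [simp]: "model_op \<alpha> R = T" by (simp add: model_op_def T_def S_def)
lemma k_dims [simp]: "dim_row (k j) = N" "dim_col (k j) = q" by (induction j) simp_all
lemma s_dims [simp]: "dim_row (s j) = q" "dim_col (s j) = q" by (simp_all add: model_moment_def)
lemma s_carrier [simp]: "s j \<in> carrier_mat q q" by (intro carrier_matI) simp_all
lemma s_0: "s 0 = A" by (simp add: model_moment_def A_def)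

text \<open>For the difference \<open>D\<close> of both sides, \<open>D\<^sup>* D\<close> contains
  only \<open>A\<close> and \<open>P\<close>, which reduces the claim to
  \<open>A P A = A\<close>.\<close>

lemma BPA: "B * (P * A) = B"
proof -
  let ?D = "B * (P * A) - B"
  have "mat_adjoint ?D * ?D = (A * P - 1\<^sub>m q) * (A * (P * A) - A)"
    by (simp add: mat_simps A_def[symmetric] flip: mat_assoc[of "mat_adjoint B" B])
  also have "A * (P * A) - A = 0\<^sub>m q q" unfolding APA by (rule eq_matI) auto
  finally have "mat_adjoint ?D * ?D = 0\<^sub>m q q" by simp
  then have D0: "?D = 0\<^sub>m N q" by (rule adjoint_mult_self_eq_0) (simp add: B)
  show ?thesis by (rule mat_minus_eq_0D[OF D0]) simp_all
qed

lemma APB: "A * (P * mat_adjoint B) = mat_adjoint B"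
  using arg_cong[OF BPA, of mat_adjoint] by (simp add: mat_simps P_facts(5) flip: mat_assoc)

lemma QB: "Q * B = 0\<^sub>m N q"
proof -
  have "Q * B = B - B * (P * A)" by (simp add: Q_def mat_simps A_def)
  then show ?thesis unfolding BPA by (auto intro!: eq_matI)
qed

lemma BQ: "mat_adjoint B * Q = 0\<^sub>m q N"
  using arg_cong[OF QB, of mat_adjoint] by (simp add: mat_simps)

lemma QQ: "Q * Q = Q"
proof -
  have "Q * Q = Q * 1\<^sub>m N - Q * B * (P * mat_adjoint B)"
    by (subst (2) Q_def) (simp add: mat_simps)
  also have "\<dots> = Q" unfolding QB by (rule eq_matI) auto
  finally show ?thesis .
qed

lemma TS: "T * S = S * T"
  by (simp add: T_def mat_simps)

lemma k_move: "mat_adjoint (k i) * k j = s (i + j)"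
proof (induction i arbitrary: j)
  case (Suc i)
  have "mat_adjoint (k (Suc i)) * k j = mat_adjoint (k i) * k (Suc j)" by (simp add: mat_simps)
  then show ?case using Suc.IH[of "Suc j"] by simp
qed (simp add: model_moment_def)

end

section \<open>The S-transform of a model\<close>

lemma krylov_dims: "dim_row R = n \<Longrightarrow> dim_col R = n \<Longrightarrow> dim_row B = n \<Longrightarrow> dim_row (krylov \<alpha> R B j) = n"
  "dim_col (krylov \<alpha> R B j) = dim_col B"
  by (induction j) (simp_all add: model_op_def)

context stieltjes_model
begin

abbreviation "c \<equiv> model_moment \<alpha> (Q * mat_adjoint R) (R * B)"

text \<open>Chosen so that \<open>R * Z j\<close> are the Krylov vectors of the transformed model;
  the subtracted term accounts for the projection \<open>Q\<close>. \<open>Z j\<close> differs from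
  \<open>k j\<close> only by a combination of earlier Krylov vectors.\<close>

primrec Z :: "nat \<Rightarrow> complex mat" where
  "Z 0 = B"
| "Z (Suc j) = T * Z j - B * (P * c j)"

lemma Z_dims [simp]: "dim_row (Z j) = N" "dim_col (Z j) = q"
  by (induction j) (simp_all add: model_moment_def krylov_dims(1)[of _ N] krylov_dims(2))

lemma c_dims [simp]: "dim_row (c j) = q" "dim_col (c j) = q"
  by (simp_all add: model_moment_def krylov_dims)

lemma c_carrier [simp]: "c j \<in> carrier_mat q q" by (intro carrier_matI) simp_all

text \<open>The new operator is \<open>\<alpha> + R Q R\<^sup>*\<close>, and applied to
  \<open>R Z\<close> it gives \<open>R (\<alpha> Z + Q S Z)\<close>. Here
  \<open>Q S Z = S Z - B P c\<close> because \<open>c = B\<^sup>* S Z\<close>, which is the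
  recursion of \<open>Z\<close>.\<close>

lemma krylov_next: "krylov \<alpha> (Q * mat_adjoint R) (R * B) j = R * Z j"
  and moment_next: "c j = mat_adjoint B * (S * Z j)"
proof -
  have T1: "model_op \<alpha> (Q * mat_adjoint R) = complex_of_real \<alpha> \<cdot>\<^sub>m 1\<^sub>m N + R * (Q * mat_adjoint R)"
    using QQ by (simp add: model_op_def mat_simps flip: mat_assoc[of Q Q])
  have c: "c j = mat_adjoint B * (S * Z j)" if "krylov \<alpha> (Q * mat_adjoint R) (R * B) j = R * Z j" for j
    by (simp add: model_moment_def that mat_simps S_def)
  show k: "krylov \<alpha> (Q * mat_adjoint R) (R * B) j = R * Z j"
  proof (induction j)
    case (Suc j)
    have "krylov \<alpha> (Q * mat_adjoint R) (R * B) (Suc j) = complex_of_real \<alpha> \<cdot>\<^sub>m (R * Z j) + R * (Q * (S * Z j))"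
      by (simp add: Suc T1 mat_simps S_def)
    also have "Q * (S * Z j) = S * Z j - B * (P * c j)"
      unfolding c[OF Suc] by (simp add: Q_def mat_simps)
    also have "complex_of_real \<alpha> \<cdot>\<^sub>m (R * Z j) + R * (S * Z j - B * (P * c j))
        = R * (complex_of_real \<alpha> \<cdot>\<^sub>m Z j + (S * Z j - B * (P * c j)))"
      by (simp add: mat_simps)
    also have "complex_of_real \<alpha> \<cdot>\<^sub>m Z j + (S * Z j - B * (P * c j)) = Z (Suc j)"
      by (rule eq_matI) (simp_all add: T_def mat_simps del: index_mult_mat(1))
    finally show ?case .
  qed simp
  show "c j = mat_adjoint B * (S * Z j)" by (rule c[OF k])
qed

text \<open>The shifted moments, that is, the sequence \<open>u\<close> of the \<open>\<alpha>\<close>-S-transform up to an index shift.\<close>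

definition "w j = mat_adjoint B * (S * k j)"

lemma w_dims [simp]: "dim_row (w j) = q" "dim_col (w j) = q" by (simp_all add: w_def)
lemma w_carrier [simp]: "w j \<in> carrier_mat q q" by (intro carrier_matI) simp_all

lemma ST: "dim_row X = N \<Longrightarrow> S * (T * X) = T * (S * X)"
  by (simp add: TS flip: mat_assoc)

lemma w_move: "mat_adjoint (k i) * (S * k j) = w (i + j)"
proof (induction i arbitrary: j)
  case (Suc i)
  have "mat_adjoint (k (Suc i)) * (S * k j) = mat_adjoint (k i) * (S * k (Suc j))" by (simp add: mat_simps ST)
  then show ?case using Suc.IH[of "Suc j"] by simp
qed (simp add: w_def)

lemma w_eq: "w j = complex_of_real (- \<alpha>) \<cdot>\<^sub>m s j + s (Suc j)"
  by (rule eq_matI)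
    (simp_all add: w_def model_moment_def T_def mat_simps del: index_mult_mat(1))

text \<open>Unfolding \<open>Z\<close> gives a convolution recursion of the same shape as the one
  that defines the reciprocal sequence.\<close>

lemma moment_next_rec: "c i = w i - mat_sum q (\<lambda>l. w (i - 1 - l) * (P * c l)) {..<i}"
proof -
  \<comment> \<open>The index \<open>a\<close> is needed for the induction: the factor
    \<open>T\<close> in \<open>Z (Suc i)\<close> moves to the left and turns \<open>k a\<close> into
    \<open>k (Suc a)\<close>.\<close>
  have gen: "mat_adjoint (k a) * (S * Z i) = w (a + i) - mat_sum q (\<lambda>l. w (a + i - 1 - l) * (P * c l)) {..<i}" for a
  proof (induction i arbitrary: a)
    case 0
    show ?case using w_move[of a 0] by (auto intro!: eq_matI simp del: index_mult_mat(1))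
  next
    case (Suc i)
    have "mat_adjoint (k a) * (S * Z (Suc i)) = mat_adjoint (k (Suc a)) * (S * Z i) - mat_adjoint (k a) * (S * k 0) * (P * c i)"
      by (simp add: mat_simps ST)
    also have "mat_adjoint (k a) * (S * k 0) = w (a + Suc i - 1 - i)" unfolding w_move by simp
    finally have *: "mat_adjoint (k a) * (S * Z (Suc i)) = mat_adjoint (k (Suc a)) * (S * Z i) - w (a + Suc i - 1 - i) * (P * c i)" .
    show ?case
      unfolding * Suc.IH[of "Suc a"]
      by (subst mat_sum_Suc) (auto intro!: eq_matI carrier_matI simp del: index_mult_mat(1))
  qed
  show ?thesis using gen[of 0] by (simp add: moment_next)
qed

text \<open>The columns of \<open>w j\<close> lie in the range of \<open>B\<^sup>*\<close>, on which
  the projection \<open>A P\<close> acts as the identity.\<close>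

lemma APw: "A * (P * w j) = w j"
  using arg_cong[OF APB, of "\<lambda>M. M * (S * k j)"] by (simp add: w_def mat_simps)

lemma APw_mult: "dim_row X = q \<Longrightarrow> A * (P * (w j * X)) = w j * X"
  using arg_cong[OF APw[of j], of "\<lambda>M. M * X"] by (simp add: mat_simps)

lemma wPA: "w j * (P * A) = w j"
  unfolding w_move[of j 0, simplified, symmetric] by (simp add: mat_assoc BPA)

text \<open>Justifies the passage from \<open>(R, B)\<close> to \<open>(Q R\<^sup>*, R B)\<close>.
  With \<open>r\<close> the reciprocal sequence, the core is
  \<open>A r\<^sub>i\<^sub>+\<^sub>1 A = - c\<^sub>i\<close>: between two factors \<open>A\<close>
  all Moore-Penrose inverses are absorbed by \<open>w\<close>, and the recursion of \<open>r\<close>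
  becomes \<open>moment_next_rec\<close>. As in the transform of a finite sequence, one entry is
  lost.\<close>

lemma S_transform1_model:
  assumes t: "\<And>j. j \<le> m \<Longrightarrow> t j = s j" and "j < m"
  shows "S_transform1 q \<alpha> t j = c j"
proof -
  let ?u = "u_seq q \<alpha> t" and ?r = "recip_seq q (u_seq q \<alpha> t)"
  have u0: "?u 0 = A" using t[of 0] by (auto intro!: eq_matI simp: u_seq_def s_0)
  have uS: "?u (Suc i) = w i" if "i < m" for i using t[of i] t[of "Suc i"] that by (simp add: u_seq_def w_eq)
  have r0: "?r 0 = P" by (simp add: recip_seq.simps u0 P_def)
  have rS: "?r (Suc i) = - (P * mat_sum q (\<lambda>l. ?u (Suc i - l) * ?r l) {..<Suc i})" for i
    by (subst recip_seq.simps) (simp add: u0 P_def)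
  have r_dims: "dim_row (?r i) = q" "dim_col (?r i) = q" for i
    by (cases i; simp add: r0 rS)+
  \<comment> \<open>The entries begin with the factor \<open>P\<close>, and
    \<open>P A P = P\<close>. Hence \<open>r A\<close> can be recovered from \<open>A r A\<close>,
    the expression known by induction.\<close>
  have PAr: "P * (A * ?r (Suc i)) = ?r (Suc i)" for i
    unfolding rS using PAP by (simp add: mat_simps flip: mat_assoc)
  have main: "i < m \<Longrightarrow> A * (?r (Suc i) * A) = - c i" for i
  proof (induction i rule: less_induct)
    case (less i)
    have u_car: "?u (Suc i - l) * ?r l \<in> carrier_mat q q" if "l \<in> {..<Suc i}" for l
      using that less.prems uS[of "i - l"] by (auto simp: Suc_diff_le r_dims)
    \<comment> \<open>The term \<open>l = 0\<close> contains \<open>r\<^sub>0 = P\<close> and yields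
      \<open>w i\<close>; a term \<open>l = Suc l'\<close> yields the earlier \<open>c l'\<close>,
      whence the index shift.\<close>
    have summand: "A * (P * (?u (Suc i - l) * (?r l * A))) = (if l = 0 then w i else - (w (i - l) * (P * c (l - 1))))"
      if "l \<in> {..<Suc i}" for l
    proof (cases l)
      case 0
      then show ?thesis using less.prems uS[of i] by (simp add: r0 APw APw_mult wPA)
    next
      case (Suc l')
      then have l': "l' < i" "l' < m" using that less.prems by auto
      have u: "?u (Suc i - l) = w (i - l)" using that less.prems uS[of "i - l"] by (simp add: Suc_diff_le)
      have "?r l * A = P * (A * (?r l * A))"
        using arg_cong[OF PAr[of l'], of "\<lambda>M. M * A"] Suc by (simp add: r_dims mat_assoc)
      then have "?r l * A = - (P * c l')" using less.IH[OF l'] Suc by (simp add: mat_simps)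
      then show ?thesis using Suc unfolding u by (simp add: mat_simps APw_mult)
    qed
    have "A * (?r (Suc i) * A) = - ((A * P) * (mat_sum q (\<lambda>l. ?u (Suc i - l) * ?r l) {..<Suc i} * A))"
      unfolding rS by (simp add: mat_simps)
    also have "mat_sum q (\<lambda>l. ?u (Suc i - l) * ?r l) {..<Suc i} * A = mat_sum q (\<lambda>l. ?u (Suc i - l) * ?r l * A) {..<Suc i}"
      by (rule mat_sum_mult) (use u_car A_carrier in auto)
    also have "(A * P) * \<dots> = mat_sum q (\<lambda>l. (A * P) * (?u (Suc i - l) * ?r l * A)) {..<Suc i}"
      by (rule mult_mat_sum) (use u_car A_carrier in auto)
    also have "\<dots> = mat_sum q (\<lambda>l. if l = 0 then w i else - (w (i - l) * (P * c (l - 1)))) {..<Suc i}"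
    proof (rule mat_sum_cong[OF refl refl])
      fix l assume l: "l \<in> {..<Suc i}"
      have "(A * P) * (?u (Suc i - l) * ?r l * A) = A * (P * (?u (Suc i - l) * (?r l * A)))"
        using u_car[OF l] l less.prems uS[of "i - l"] by (simp add: mat_assoc r_dims Suc_diff_le)
      then show "(A * P) * (?u (Suc i - l) * ?r l * A) = (if l = 0 then w i else - (w (i - l) * (P * c (l - 1))))"
        using summand[OF l] by simp
    qed
    also have "\<dots> = w i + mat_sum q (\<lambda>l. - (w (i - 1 - l) * (P * c l))) {..<i}"
      by (subst mat_sum_Suc_shift) simp_all
    also have "mat_sum q (\<lambda>l. - (w (i - 1 - l) * (P * c l))) {..<i} = - mat_sum q (\<lambda>l. w (i - 1 - l) * (P * c l)) {..<i}"
      by (rule mat_sum_uminus) simp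
    also have "w i + - mat_sum q (\<lambda>l. w (i - 1 - l) * (P * c l)) {..<i} = c i"
      unfolding moment_next_rec[of i] by (rule eq_matI) simp_all
    finally show ?case .
  qed
  have "S_transform1 q \<alpha> t j = - (A * ?r (Suc j) * A)"
    using t[of 0] by (simp add: S_transform1_def s_0)
  also have "A * ?r (Suc j) * A = - c j" using main[OF assms(2)] by (simp add: mat_assoc r_dims)
  finally show ?thesis by simp
qed

end

section \<open>Resolvents and the polynomials V\<close>

text \<open>Kernel vectors are taken as one-column matrices, so that the matrix laws in
  \<open>mat_simps\<close> apply to them.\<close>

lemma det_nonzeroI:
  fixes M :: "complex mat"
  assumes M: "M \<in> carrier_mat n n"
    and inj: "\<And>V. V \<in> carrier_mat n 1 \<Longrightarrow> M * V = 0\<^sub>m n 1 \<Longrightarrow> V = 0\<^sub>m n 1"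
  shows "Determinant.det M \<noteq> 0"
proof
  assume "Determinant.det M = 0"
  then obtain v where v: "v \<in> carrier_vec n" "v \<noteq> 0\<^sub>v n" "M *\<^sub>v v = 0\<^sub>v n"
    using det_0_iff_vec_prod_zero[OF M] by blast
  define V where "V = Matrix.mat n 1 (\<lambda>(i, j). vec_index v i)"
  have V: "V \<in> carrier_mat n 1" "col V 0 = v" using v(1) by (auto simp: V_def)
  have dims: "dim_row M = n" "dim_col V = 1" using M V(1) by blast+
  have "M * V = 0\<^sub>m n 1"
  proof (rule eq_matI)
    fix i j assume "i < dim_row (0\<^sub>m n 1 :: complex mat)" "j < dim_col (0\<^sub>m n 1 :: complex mat)"
    then have ij: "i < n" "j = 0" by auto
    have "(M * V) $$ (i, 0) = row M i \<bullet> col V 0"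
      by (rule index_mult_mat(1)) (use dims ij in simp_all)
    also have "\<dots> = vec_index (M *\<^sub>v v) i"
      unfolding V(2) by (rule index_mult_mat_vec[symmetric]) (use dims ij in simp)
    also have "\<dots> = 0" unfolding v(3) using ij by simp
    finally show "(M * V) $$ (i, j) = 0\<^sub>m n 1 $$ (i, j)" using ij by simp
  qed (simp_all only: index_mult_mat dims index_zero_mat)
  then have V0: "V = 0\<^sub>m n 1" by (rule inj[OF V(1)])
  have "v = 0\<^sub>v n" unfolding V(2)[symmetric] unfolding V0 by (auto intro!: eq_vecI)
  then show False using v by simp
qed

text \<open>If \<open>V = - P F V\<close> and \<open>F = D\<^sup>* D\<close>, then
  \<open>(D V)\<^sup>* D V = V\<^sup>* F V = - (F V)\<^sup>* P (F V)\<close> is both non-negative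
  and non-positive. So \<open>D V = 0\<close>, hence \<open>F V = 0\<close> and
  \<open>V = 0\<close>.\<close>

lemma det_one_plus_nonneg_herm:
  assumes "nonneg_herm P" "P \<in> carrier_mat n n" "nonneg_herm F" "F \<in> carrier_mat n n"
  shows "Determinant.det (1\<^sub>m n + P * F) \<noteq> 0"
proof (rule det_nonzeroI)
  fix V assume V: "V \<in> carrier_mat n 1" "(1\<^sub>m n + P * F) * V = 0\<^sub>m n 1"
  obtain D where D: "D \<in> carrier_mat n n" "F = mat_adjoint D * D" using nonneg_herm_factor[OF assms(3,4)] .
  have V': "V = - (P * (F * V))"
  proof (rule eq_matI)
    fix i j assume "i < dim_row (- (P * (F * V)))" "j < dim_col (- (P * (F * V)))"
    then show "V $$ (i, j) = (- (P * (F * V))) $$ (i, j)"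
      using arg_cong[OF V(2), of "\<lambda>M. M $$ (i, j)"] V(1) assms(2,4)
      by (simp add: mat_simps add_eq_0_iff2 del: index_mult_mat(1))
  qed (use V assms in auto)
  have FV: "mat_adjoint (F * V) = mat_adjoint V * F"
    using V assms nonneg_hermD(1)[OF assms(3,4)] by (simp add: mat_simps)
  have "- (mat_adjoint (D * V) * (D * V)) = mat_adjoint (F * V) * P * (F * V)"
  proof -
    have "mat_adjoint (D * V) * (D * V) = mat_adjoint (F * V) * V"
      using V(1) D by (simp add: FV mat_simps)
    also have "\<dots> = mat_adjoint (F * V) * - (P * (F * V))" using V' by simp
    finally show ?thesis using V(1) assms D by (simp add: mat_assoc)
  qed
  also have "nonneg_herm \<dots>"
    by (rule nonneg_herm_congruence[of _ n _ 1]) (use assms V in auto)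
  finally have "D * V = 0\<^sub>m n 1" using adjoint_mult_self_eq_0D[of "D * V"] D V by simp
  then have "F * V = 0\<^sub>m n 1" using D V by (simp add: mat_assoc)
  then have "V = - (P * 0\<^sub>m n 1)" using V' by simp
  then show "V = 0\<^sub>m n 1" using assms by (auto intro!: eq_matI)
qed (use assms in auto)

text \<open>The eigenvalues of \<open>R\<^sup>* R\<close> are non-negative and therefore differ from
  \<open>w\<close>; the inverse is formed in the eigenbasis.\<close>

lemma nonneg_herm_resolvent:
  assumes R: "R \<in> carrier_mat n n" and w: "w \<notin> complex_of_real ` {0..}"
  obtains Y where "Y \<in> carrier_mat n n" "(mat_adjoint R * R - w \<cdot>\<^sub>m 1\<^sub>m n) * Y = 1\<^sub>m n"
    "Y * (mat_adjoint R * R - w \<cdot>\<^sub>m 1\<^sub>m n) = 1\<^sub>m n"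
proof -
  have SR: "mat_adjoint R * R \<in> carrier_mat n n" using R by simp
  obtain U and d :: "nat \<Rightarrow> real" where U: "U \<in> carrier_mat n n" "mat_adjoint U * U = 1\<^sub>m n" "U * mat_adjoint U = 1\<^sub>m n"
    and S: "mat_adjoint R * R = U * mat_diag n (\<lambda>i. of_real (d i)) * mat_adjoint U" and d: "\<And>i. i < n \<Longrightarrow> 0 \<le> d i"
    using nonneg_herm_spectral[OF nonneg_herm_adjoint_mult SR] by blast
  have dw: "of_real (d i) \<noteq> w" if "i < n" for i using w d[OF that] by auto
  let ?M = "U * mat_diag n (\<lambda>i. of_real (d i) - w) * mat_adjoint U"
  have M: "mat_adjoint R * R - w \<cdot>\<^sub>m 1\<^sub>m n = ?M"
  proof -
    have "mat_diag n (\<lambda>i. of_real (d i) - w) = mat_diag n (\<lambda>i. of_real (d i)) - w \<cdot>\<^sub>m 1\<^sub>m n"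
      by (rule eq_matI) (auto simp: mat_diag_def)
    then show ?thesis using U by (simp add: S mat_simps)
  qed
  let ?Y = "U * mat_diag n (\<lambda>i. inverse (of_real (d i) - w)) * mat_adjoint U"
  have one: "U * mat_diag n f * mat_adjoint U = 1\<^sub>m n" if "\<And>i. i < n \<Longrightarrow> f i = 1" for f
  proof -
    have "mat_diag n f = 1\<^sub>m n" using that by (auto intro!: eq_matI simp: mat_diag_def)
    then show ?thesis using U by simp
  qed
  show ?thesis
  proof
    show "?Y \<in> carrier_mat n n" using U by simp
    show "(mat_adjoint R * R - w \<cdot>\<^sub>m 1\<^sub>m n) * ?Y = 1\<^sub>m n" "?Y * (mat_adjoint R * R - w \<cdot>\<^sub>m 1\<^sub>m n) = 1\<^sub>m n"
      unfolding M diag_calculus_mult[OF U(1,2)] by (rule one, simp add: dw)+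
  qed
qed

section \<open>Degeneracy and resolvents under the transform of models\<close>

context stieltjes_model
begin

lemma adjoint_Z_Suc:
  assumes "dim_row V = N"
  shows "mat_adjoint (Z (Suc j)) * V = mat_adjoint (Z j) * (T * V) - mat_adjoint (c j) * (P * (mat_adjoint B * V))"
  using assms by (simp add: mat_simps)

text \<open>\<open>Z n\<close> is \<open>k n\<close> plus a combination of earlier
  \<open>k j\<close>, which \<open>V\<close> does not see. The induction replaces \<open>V\<close>
  by \<open>T V\<close>, which is orthogonal to one Krylov vector fewer.\<close>

lemma Z_triangular:
  assumes "V \<in> carrier_mat N q" "\<And>j. j < n \<Longrightarrow> mat_adjoint (k j) * V = 0\<^sub>m q q"
  shows "mat_adjoint (Z n) * V = mat_adjoint (k n) * V"
  using assms
proof (induction n arbitrary: V)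
  case (Suc n)
  have "mat_adjoint (k j) * (T * V) = 0\<^sub>m q q" if "j < n" for j
    using Suc.prems(2)[of "Suc j"] Suc.prems(1) that by (simp add: mat_simps)
  then have "mat_adjoint (Z n) * (T * V) = mat_adjoint (k n) * (T * V)"
    using Suc.prems(1) by (intro Suc.IH) simp_all
  also have "\<dots> = mat_adjoint (k (Suc n)) * V" using Suc.prems(1) by (simp add: mat_simps)
  finally have *: "mat_adjoint (Z n) * (T * V) = mat_adjoint (k (Suc n)) * V" .
  have "mat_adjoint B * V = 0\<^sub>m q q" using Suc.prems(2)[of 0] by simp
  then show ?case using Suc.prems(1) *
    by (subst adjoint_Z_Suc) (auto intro!: eq_matI simp del: krylov.simps Z.simps(2) index_mult_mat(1))
qed simp

lemma Z_triangular':
  assumes "V \<in> carrier_mat N q" "\<And>j. j < n \<Longrightarrow> mat_adjoint (Z j) * V = 0\<^sub>m q q"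
  shows "j < n \<Longrightarrow> mat_adjoint (k j) * V = 0\<^sub>m q q"
proof (induction j rule: less_induct)
  case (less j)
  then have "mat_adjoint (k j) * V = mat_adjoint (Z j) * V"
    using assms(1) by (intro Z_triangular[symmetric]) auto
  then show ?case using assms(2)[OF less.prems] by simp
qed

text \<open>Orthogonality to the vectors of the new model is translated, through \<open>Z\<close>,
  into orthogonality to the Krylov vectors of the old one, where the assumption supplies the missing
  index. The translation depends on the parity of \<open>m\<close>.\<close>

lemma degenerate_next:
  assumes "degenerate \<alpha> (Suc m) R B"
  shows "degenerate \<alpha> m (Q * mat_adjoint R) (R * B)"
proof -
  let ?W = "model_vec \<alpha> m (Q * mat_adjoint R) (R * B)" and ?n = "m div 2"
  have "mat_adjoint (?W ?n) * V = 0\<^sub>m q q"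
    if V: "V \<in> carrier_mat N q" and 0: "\<And>j. j < ?n \<Longrightarrow> mat_adjoint (?W j) * V = 0\<^sub>m q q" for V
  proof (cases "even m")
    case True
    then have m: "Suc m div 2 = ?n" "odd (Suc m)" by auto
    \<comment> \<open>The new vectors are \<open>R Z\<close>, so testing them on \<open>V\<close>
      means testing \<open>Z\<close>, equivalently \<open>k\<close>, on \<open>R\<^sup>* V\<close>.
      That is the test of the old vectors \<open>R k\<close> on \<open>V\<close>, with the same
      range of indices.\<close>
    let ?V = "mat_adjoint R * V"
    have V': "?V \<in> carrier_mat N q" using V by simp
    have W: "mat_adjoint (?W j) * V = mat_adjoint (Z j) * ?V" for j
      using True V by (simp add: model_vec_def krylov_next mat_simps)
    have Z: "mat_adjoint (Z j) * ?V = 0\<^sub>m q q" if "j < ?n" for j using 0[OF that] W by simp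
    have k: "mat_adjoint (k j) * ?V = 0\<^sub>m q q" if "j < ?n" for j
      using Z_triangular'[OF V'] Z that by blast
    have "mat_adjoint (k ?n) * ?V = 0\<^sub>m q q"
      using assms V k unfolding degenerate_def by (simp add: m True model_vec_def mat_simps)
    then show ?thesis using Z_triangular[OF V'] k W by metis
  next
    case False
    then have m: "Suc m div 2 = Suc ?n" "even (Suc m)" by auto
    \<comment> \<open>The new vectors are \<open>Q S Z\<close>. Since
      \<open>B\<^sup>* Q V = 0\<close>, the correction term of \<open>Z (Suc j)\<close> drops out on
      \<open>Q V\<close>, so orthogonality to \<open>Z j\<close> and to \<open>S Z j\<close> gives
      orthogonality to \<open>Z (Suc j)\<close>. One index is gained, matching
      \<open>Suc m div 2 = Suc (m div 2)\<close>.\<close>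
    let ?V = "Q * V"
    have V': "?V \<in> carrier_mat N q" using V by simp
    have BV: "mat_adjoint B * ?V = 0\<^sub>m q q"
      using arg_cong[OF BQ, of "\<lambda>M. M * V"] V by (simp add: mat_simps)
    have W: "mat_adjoint (?W j) * V = mat_adjoint (Z j) * (S * ?V)" for j
      using False V by (simp add: model_vec_def krylov_next mat_simps S_def)
    have step: "mat_adjoint (Z (Suc j)) * ?V = mat_adjoint (Z j) * (S * ?V)"
      if "mat_adjoint (Z j) * ?V = 0\<^sub>m q q" for j
    proof -
      have "mat_adjoint (Z (Suc j)) * ?V = mat_adjoint (Z j) * (T * ?V) - 0\<^sub>m q q"
        using V' BV by (subst adjoint_Z_Suc) auto
      also have "mat_adjoint (Z j) * (T * ?V) = complex_of_real \<alpha> \<cdot>\<^sub>m (mat_adjoint (Z j) * ?V) + mat_adjoint (Z j) * (S * ?V)"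
        using V by (simp add: T_def mat_simps)
      finally show ?thesis using V that by (auto intro!: eq_matI simp del: index_mult_mat(1) Z.simps(2))
    qed
    have SZ: "mat_adjoint (Z j) * (S * ?V) = 0\<^sub>m q q" if "j < ?n" for j using 0[OF that] W by simp
    have Z: "mat_adjoint (Z j) * ?V = 0\<^sub>m q q" if "j < Suc ?n" for j
      using that by (induction j) (simp_all add: BV step SZ del: Z.simps(2))
    have k: "mat_adjoint (k j) * ?V = 0\<^sub>m q q" if "j < Suc ?n" for j
      using Z_triangular'[OF V'] Z that by blast
    have "mat_adjoint (k (Suc ?n)) * ?V = 0\<^sub>m q q"
      using assms V' k unfolding degenerate_def by (simp add: m False model_vec_def del: krylov.simps)
    then have "mat_adjoint (Z (Suc ?n)) * ?V = 0\<^sub>m q q" using Z_triangular[OF V'] k by metis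
    then show ?thesis using step[OF Z] W by simp
  qed
  then show ?thesis unfolding degenerate_def by simp
qed

text \<open>There are no earlier vectors to be orthogonal to, so \<open>V = B\<close> is an
  admissible test and gives \<open>B\<^sup>* B = 0\<close>.\<close>

lemma degenerate_0:
  assumes "degenerate \<alpha> 0 R B"
  shows "B = 0\<^sub>m N q"
  using assms B unfolding degenerate_def model_vec_def by (auto intro: adjoint_mult_self_eq_0)

text \<open>Here \<open>x = z - \<alpha>\<close>, and \<open>X\<close>, \<open>Y\<close> are the
  resolvents of the two models applied to \<open>B\<close> and \<open>R B\<close>. With
  \<open>G = 1 + P F\<^sub>1\<close>, the matrix \<open>E = Q R\<^sup>* Y\<close> satisfies
  \<open>(S - x) (E - B) = x B G\<close>, hence \<open>E - B = x X G\<close>. Applying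
  \<open>B\<^sup>*\<close>, which annihilates \<open>E\<close>, yields the identity.\<close>

lemma resolvent_next:
  assumes x: "x \<notin> complex_of_real ` {0..}"
    and X: "X \<in> carrier_mat N q" "S * X - x \<cdot>\<^sub>m X = B"
    and Y: "Y \<in> carrier_mat N q" "R * (Q * (mat_adjoint R * Y)) - x \<cdot>\<^sub>m Y = R * B"
  shows "- x \<cdot>\<^sub>m (mat_adjoint B * X * (1\<^sub>m q + P * (mat_adjoint (R * B) * Y))) = A"
proof -
  define G where "G = 1\<^sub>m q + P * (mat_adjoint (R * B) * Y)"
  define E where "E = Q * (mat_adjoint R * Y)"
  have G: "dim_row G = q" "dim_col G = q" using Y by (simp_all add: G_def)
  have E: "dim_row E = N" "dim_col E = q" using Y by (simp_all add: E_def)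
  obtain M where M: "M \<in> carrier_mat N N" "M * (S - x \<cdot>\<^sub>m 1\<^sub>m N) = 1\<^sub>m N"
    using nonneg_herm_resolvent[OF R x] unfolding S_def by metis
  have EY: "E = mat_adjoint R * Y + B - B * G"
    using Y by (auto intro!: eq_matI simp: E_def G_def Q_def mat_simps simp del: index_mult_mat(1))
  have RY: "S * E = x \<cdot>\<^sub>m (mat_adjoint R * Y) + S * B"
  proof -
    have "R * E = x \<cdot>\<^sub>m Y + R * B"
      unfolding Y(2)[symmetric] using Y(1) by (auto intro!: eq_matI simp: E_def simp del: index_mult_mat(1))
    then have "mat_adjoint R * (R * E) = mat_adjoint R * (x \<cdot>\<^sub>m Y + R * B)" by simp
    then show ?thesis using Y E by (simp add: S_def mat_simps)
  qed
  have "(S - x \<cdot>\<^sub>m 1\<^sub>m N) * (E - B) = x \<cdot>\<^sub>m (B * G)"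
  proof -
    have "(S - x \<cdot>\<^sub>m 1\<^sub>m N) * (E - B) = (S * E - S * B) - x \<cdot>\<^sub>m (E - B)"
      using E by (auto intro!: eq_matI simp: mat_simps right_diff_distrib simp del: index_mult_mat(1))
    also have "\<dots> = x \<cdot>\<^sub>m (B * G)"
      unfolding RY unfolding EY using Y G by (auto intro!: eq_matI simp: ring_distribs simp del: index_mult_mat(1))
    finally show ?thesis .
  qed
  also have "\<dots> = (S - x \<cdot>\<^sub>m 1\<^sub>m N) * (x \<cdot>\<^sub>m (X * G))"
    using arg_cong[OF X(2), of "\<lambda>M. x \<cdot>\<^sub>m (M * G)"] X(1) G by (simp add: mat_simps)
  finally have "M * ((S - x \<cdot>\<^sub>m 1\<^sub>m N) * (E - B)) = M * ((S - x \<cdot>\<^sub>m 1\<^sub>m N) * (x \<cdot>\<^sub>m (X * G)))" by simp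
  then have EB: "E - B = x \<cdot>\<^sub>m (X * G)"
    using M X E by (simp add: mat_inverse_cancel[OF M(2)])
  have "mat_adjoint B * E = 0\<^sub>m q q"
    using arg_cong[OF BQ, of "\<lambda>M. M * (mat_adjoint R * Y)"] Y(1) by (simp add: E_def mat_simps)
  then have "mat_adjoint B * (E - B) = - A"
    using E by (auto intro!: eq_matI simp: A_def mat_simps simp del: index_mult_mat(1))
  then have "- A = mat_adjoint B * (x \<cdot>\<^sub>m (X * G))"
    unfolding EB by simp
  then have "A = - (mat_adjoint B * (x \<cdot>\<^sub>m (X * G)))"
    by (metis uminus_uminus_mat)
  then show ?thesis using X G unfolding G_def[symmetric]
    by (auto intro!: eq_matI simp: mat_simps simp del: index_mult_mat(1))
qed

end

lemma nonneg_herm_add: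
  assumes "nonneg_herm A" "nonneg_herm B" "A \<in> carrier_mat n n" "B \<in> carrier_mat n n"
  shows "nonneg_herm (A + B)"
proof (rule nonneg_hermI)
  fix x :: "nat \<Rightarrow> complex"
  have "(\<Sum>i<n. \<Sum>j<n. cnj (x i) * (A + B) $$ (i, j) * x j)
    = (\<Sum>i<n. \<Sum>j<n. cnj (x i) * A $$ (i, j) * x j) + (\<Sum>i<n. \<Sum>j<n. cnj (x i) * B $$ (i, j) * x j)"
    unfolding sum.distrib[symmetric] using assms(3,4) by (intro sum.cong refl) (simp add: ring_distribs)
  then show "0 \<le> Re (\<Sum>i<n. \<Sum>j<n. cnj (x i) * (A + B) $$ (i, j) * x j)"
    using nonneg_hermD(2)[OF assms(1,3), of x] nonneg_hermD(2)[OF assms(2,4), of x] by simp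
qed (use assms nonneg_hermD(1)[OF assms(1,3)] nonneg_hermD(1)[OF assms(2,4)] in \<open>auto simp: mat_simps\<close>)

section \<open>The second block column of the product of the matrices \<open>V\<close>\<close>

lemma V_mat_dims [simp]: "dim_row (V_mat q \<alpha> X z) = q + q" "dim_col (V_mat q \<alpha> X z) = q + q"
  by (simp_all add: V_mat_def)

lemma V_prod_dims [simp]: "dim_row (V_prod q \<alpha> s n z) = q + q" "dim_col (V_prod q \<alpha> s n z) = q + q"
  by (induction n) simp_all

lemma S_transform_0 [simp]: "S_transform q \<alpha> 0 s = s"
  by (simp add: S_transform_def)

lemma S_transform_Suc: "S_transform q \<alpha> (Suc n) s = S_transform q \<alpha> n (S_transform1 q \<alpha> s)"
  by (simp add: S_transform_def funpow_swap1)

text \<open>\<open>V_prod\<close> grows on the right, whereas the induction over models splits off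
  the first factor and passes to the transformed sequence.\<close>

lemma V_prod_Suc_left: "V_prod q \<alpha> s (Suc n) z = V_mat q \<alpha> (s 0) z * V_prod q \<alpha> (S_transform1 q \<alpha> s) n z"
proof (induction n)
  case (Suc n)
  have "V_prod q \<alpha> s (Suc (Suc n)) z = V_prod q \<alpha> s (Suc n) z * V_mat q \<alpha> (S_transform q \<alpha> (Suc (Suc n)) s 0) z"
    by simp
  then show ?case unfolding Suc S_transform_Suc[of _ _ "Suc n"] by (simp add: mat_assoc)
qed (simp add: S_transform_Suc)

lemma block_carrier:
  assumes "M \<in> carrier_mat (q + q) (q + q)"
  shows "block12 q M \<in> carrier_mat q q" "block22 q M \<in> carrier_mat q q"
  using assms by (auto simp: block12_def block22_def split_block_def Let_def)

text \<open>The second block column of a product involves only the second block column of the right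
  factor, so \<open>v\<^sub>1\<^sub>2\<close> and \<open>v\<^sub>2\<^sub>2\<close> satisfy a
  recursion of their own.\<close>

lemma blocks_V_mat_mult:
  assumes M: "M \<in> carrier_mat (q + q) (q + q)" and X: "X \<in> carrier_mat q q" "mp_inverse X \<in> carrier_mat q q"
  shows "block12 q (V_mat q \<alpha> X z * M) = - (X * block22 q M)"
    and "block22 q (V_mat q \<alpha> X z * M) = (z - complex_of_real \<alpha>) \<cdot>\<^sub>m (mp_inverse X * block12 q M + block22 q M)"
proof -
  obtain M1 M2 M3 M4 where sb: "split_block M q q = (M1, M2, M3, M4)" by (metis prod_cases4)
  have M': "M1 \<in> carrier_mat q q" "M2 \<in> carrier_mat q q" "M3 \<in> carrier_mat q q" "M4 \<in> carrier_mat q q"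
    "M = four_block_mat M1 M2 M3 M4"
    using split_block[OF sb, of q q] M by auto
  have bl: "block12 q (four_block_mat X1 X2 X3 X4) = X2" "block22 q (four_block_mat X1 X2 X3 X4) = X4"
    if "X1 \<in> carrier_mat q q" "X2 \<in> carrier_mat q q" "X3 \<in> carrier_mat q q" "X4 \<in> carrier_mat q q"
    for X1 X2 X3 X4 :: "complex mat"
    using that by (auto intro!: eq_matI simp: block12_def block22_def split_block_def Let_def)
  have bM: "block12 q M = M2" "block22 q M = M4" using sb by (simp_all add: block12_def block22_def)
  have "V_mat q \<alpha> X z * M = four_block_mat (0\<^sub>m q q * M1 + - X * M3) (0\<^sub>m q q * M2 + - X * M4)
      ((z - complex_of_real \<alpha>) \<cdot>\<^sub>m mp_inverse X * M1 + (z - complex_of_real \<alpha>) \<cdot>\<^sub>m 1\<^sub>m q * M3)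
      ((z - complex_of_real \<alpha>) \<cdot>\<^sub>m mp_inverse X * M2 + (z - complex_of_real \<alpha>) \<cdot>\<^sub>m 1\<^sub>m q * M4)"
    unfolding V_mat_def M'(5) by (rule mult_four_block_mat) (use X M' in auto)
  note VM = this
  show "block12 q (V_mat q \<alpha> X z * M) = - (X * block22 q M)"
    unfolding VM bM using M'(1-4) X by (subst bl) (auto intro!: eq_matI simp del: index_mult_mat(1))
  show "block22 q (V_mat q \<alpha> X z * M) = (z - complex_of_real \<alpha>) \<cdot>\<^sub>m (mp_inverse X * block12 q M + block22 q M)"
    unfolding VM bM using M'(1-4) X by (subst bl) (auto intro!: eq_matI simp: mat_simps ring_distribs simp del: index_mult_mat(1))
qed

lemma slit_plane_shift: "z \<in> slit_plane \<alpha> \<longleftrightarrow> z - complex_of_real \<alpha> \<notin> complex_of_real ` {0..}"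
proof -
  have "z \<in> complex_of_real ` {\<alpha>..} \<longleftrightarrow> z - complex_of_real \<alpha> \<in> complex_of_real ` {0..}"
  proof
    assume "z \<in> complex_of_real ` {\<alpha>..}"
    then obtain t where "t \<ge> \<alpha>" "z = of_real t" by auto
    then show "z - complex_of_real \<alpha> \<in> complex_of_real ` {0..}" by (intro image_eqI[of _ _ "t - \<alpha>"]) auto
  next
    assume "z - complex_of_real \<alpha> \<in> complex_of_real ` {0..}"
    then obtain t where "t \<ge> 0" "z - of_real \<alpha> = of_real t" by auto
    then show "z \<in> complex_of_real ` {\<alpha>..}" by (intro image_eqI[of _ _ "t + \<alpha>"]) (auto simp: algebra_simps)
  qed
  then show ?thesis by (simp add: slit_plane_def)
qed

text \<open>The resolvent enters as any solution \<open>X\<close> of its equation. One more factor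
  on the left replaces \<open>v\<^sub>2\<^sub>2\<close> by
  \<open>(z - \<alpha>) (1 + P F\<^sub>1) v\<^sub>2\<^sub>2\<close> and
  \<open>v\<^sub>1\<^sub>2\<close> by \<open>- A v\<^sub>2\<^sub>2\<close>, and
  \<open>resolvent_next\<close> says that \<open>F\<close> links the two. The determinant claim
  needs the second claim for the transformed model, hence the joint induction.\<close>

lemma V_prod_model:
  assumes "R \<in> carrier_mat N N" "B \<in> carrier_mat N q" "\<And>j. j \<le> m \<Longrightarrow> t j = model_moment \<alpha> R B j"
    and "degenerate \<alpha> m R B"
  shows "S_transform q \<alpha> m t 0 = 0\<^sub>m q q \<and>
    (\<forall>z \<in> slit_plane \<alpha>. \<forall>X \<in> carrier_mat N q. mat_adjoint R * R * X - (z - complex_of_real \<alpha>) \<cdot>\<^sub>m X = B \<longrightarrow>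
      block12 q (V_prod q \<alpha> t m z) = mat_adjoint B * X * block22 q (V_prod q \<alpha> t m z)) \<and>
    Determinant.det (block22 q (V_prod q \<alpha> t m (complex_of_real (\<alpha> - 1)))) \<noteq> 0"
  using assms
proof (induction m arbitrary: R B t)
  case 0
  interpret stieltjes_model N q \<alpha> R B using 0 by unfold_locales
  have B0: "B = 0\<^sub>m N q" by (rule degenerate_0) (use 0 in simp)
  have "A = 0\<^sub>m q q" unfolding A_def by (simp add: B0)
  then have t0: "t 0 = 0\<^sub>m q q" using 0(3)[of 0] s_0 by simp
  have V0: "block12 q (V_prod q \<alpha> t 0 z) = 0\<^sub>m q q" "block22 q (V_prod q \<alpha> t 0 z) = (z - complex_of_real \<alpha>) \<cdot>\<^sub>m 1\<^sub>m q" for z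
    by (auto intro!: eq_matI simp: t0 V_mat_def block12_def block22_def split_block_def Let_def)
  have "block12 q (V_prod q \<alpha> t 0 z) = mat_adjoint B * X * block22 q (V_prod q \<alpha> t 0 z)" if "X \<in> carrier_mat N q" for z X
    unfolding V0 B0 using that by simp
  moreover have "Determinant.det (block22 q (V_prod q \<alpha> t 0 (complex_of_real (\<alpha> - 1)))) \<noteq> 0"
    unfolding V0 by (simp add: det_smult)
  ultimately show ?case using t0 by simp
next
  case (Suc m)
  interpret stieltjes_model N q \<alpha> R B using Suc.prems by unfold_locales
  let ?t = "S_transform1 q \<alpha> t" and ?R = "Q * mat_adjoint R" and ?B = "R * B"
  let ?a = "complex_of_real \<alpha>"
  have t1: "?t j = model_moment \<alpha> ?R ?B j" if "j \<le> m" for j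
    by (rule S_transform1_model[of "Suc m"]) (use Suc.prems(3) that in auto)
  have RB: "?R \<in> carrier_mat N N" "?B \<in> carrier_mat N q" by simp_all
  note IH = Suc.IH[OF RB t1 degenerate_next[OF Suc.prems(4)]]
  have t0: "t 0 = A" using Suc.prems(3)[of 0] by (simp add: s_0)
  have RR: "mat_adjoint ?R * ?R = R * (Q * mat_adjoint R)"
    using QQ by (simp add: mat_simps flip: mat_assoc[of Q Q])
  have ex: "\<exists>Y \<in> carrier_mat N q. R * (Q * (mat_adjoint R * Y)) - (z - ?a) \<cdot>\<^sub>m Y = ?B" if z: "z \<in> slit_plane \<alpha>" for z
  proof -
    obtain Y where Y: "Y \<in> carrier_mat N N" "(mat_adjoint ?R * ?R - (z - ?a) \<cdot>\<^sub>m 1\<^sub>m N) * Y = 1\<^sub>m N"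
      using nonneg_herm_resolvent[OF RB(1), of "z - ?a"] z unfolding slit_plane_shift by metis
    have "(mat_adjoint ?R * ?R - (z - ?a) \<cdot>\<^sub>m 1\<^sub>m N) * (Y * ?B) = ?B"
      using Y(1) by (intro mat_inverse_cancel[OF Y(2)]) auto
    then have "R * (Q * (mat_adjoint R * (Y * ?B))) - (z - ?a) \<cdot>\<^sub>m (Y * ?B) = ?B"
      unfolding RR using Y(1) by (simp add: mat_simps)
    then show ?thesis using Y(1) by (intro bexI[of _ "Y * ?B"]) auto
  qed
  have M: "V_prod q \<alpha> ?t m z \<in> carrier_mat (q + q) (q + q)" for z by (intro carrier_matI) simp_all
  note bV = blocks_V_mat_mult[OF M A_carrier, folded P_def, OF P_facts(1), of \<alpha>]
  note bc = block_carrier[OF M]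
  have IH12: "block12 q (V_prod q \<alpha> ?t m z) = mat_adjoint ?B * Y * block22 q (V_prod q \<alpha> ?t m z)"
    if "z \<in> slit_plane \<alpha>" "Y \<in> carrier_mat N q" "R * (Q * (mat_adjoint R * Y)) - (z - ?a) \<cdot>\<^sub>m Y = ?B" for z Y
    using IH that unfolding RR by (auto simp: mat_assoc)
  have b22: "block22 q (V_prod q \<alpha> t (Suc m) z)
      = (z - ?a) \<cdot>\<^sub>m ((1\<^sub>m q + P * (mat_adjoint ?B * Y)) * block22 q (V_prod q \<alpha> ?t m z))"
    if "z \<in> slit_plane \<alpha>" "Y \<in> carrier_mat N q" "R * (Q * (mat_adjoint R * Y)) - (z - ?a) \<cdot>\<^sub>m Y = ?B" for z Y
    unfolding V_prod_Suc_left t0 bV IH12[OF that] using that bc[of z]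
    by (auto intro!: eq_matI simp: mat_simps simp del: index_mult_mat(1))
  have "block12 q (V_prod q \<alpha> t (Suc m) z) = mat_adjoint B * X * block22 q (V_prod q \<alpha> t (Suc m) z)"
    if z: "z \<in> slit_plane \<alpha>" and X: "X \<in> carrier_mat N q" "mat_adjoint R * R * X - (z - ?a) \<cdot>\<^sub>m X = B" for z X
  proof -
    obtain Y where Y: "Y \<in> carrier_mat N q" "R * (Q * (mat_adjoint R * Y)) - (z - ?a) \<cdot>\<^sub>m Y = ?B"
      using ex[OF z] by blast
    have "- (z - ?a) \<cdot>\<^sub>m (mat_adjoint B * X * (1\<^sub>m q + P * (mat_adjoint ?B * Y))) = A"
      by (rule resolvent_next) (use z X Y in \<open>auto simp: slit_plane_shift S_def\<close>)
    then have "- (A * block22 q (V_prod q \<alpha> ?t m z))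
        = - ((- (z - ?a) \<cdot>\<^sub>m (mat_adjoint B * X * (1\<^sub>m q + P * (mat_adjoint ?B * Y)))) * block22 q (V_prod q \<alpha> ?t m z))"
      by simp
    also have "\<dots> = mat_adjoint B * X * block22 q (V_prod q \<alpha> t (Suc m) z)"
      unfolding b22[OF z Y] using bc[of z] X Y by (auto intro!: eq_matI simp: mat_simps ring_distribs simp del: index_mult_mat(1))
    finally show ?thesis unfolding V_prod_Suc_left t0 bV .
  qed
  moreover have "Determinant.det (block22 q (V_prod q \<alpha> t (Suc m) (complex_of_real (\<alpha> - 1)))) \<noteq> 0"
  proof -
    \<comment> \<open>At this point \<open>z - \<alpha> = - 1\<close>, so the equation of
      \<open>Y\<close> involves the positive matrix \<open>R Q R\<^sup>* + 1\<close>, and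
      \<open>1 + P F\<^sub>1\<close> with \<open>P\<close>, \<open>F\<^sub>1\<close> non-negative is
      invertible.\<close>
    let ?z = "complex_of_real (\<alpha> - 1)"
    have z: "?z \<in> slit_plane \<alpha>" by (auto simp: slit_plane_def simp del: of_real_diff)
    obtain Y where Y: "Y \<in> carrier_mat N q" "R * (Q * (mat_adjoint R * Y)) - (?z - ?a) \<cdot>\<^sub>m Y = ?B"
      using ex[OF z] by blast
    have za: "?z - ?a = - 1" by simp
    \<comment> \<open>Writing \<open>R B\<close> through \<open>Y\<close> exhibits
      \<open>F\<^sub>1 = (R B)\<^sup>* Y\<close> as a sum of two Gram matrices.\<close>
    have B1: "?B = mat_adjoint ?R * (?R * Y) + Y"
    proof -
      have "mat_adjoint ?R * (?R * Y) = R * (Q * (mat_adjoint R * Y))"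
        using arg_cong[OF RR, of "\<lambda>M. M * Y"] Y(1) by (simp add: mat_simps)
      then show ?thesis unfolding Y(2)[symmetric] za using Y(1) by (auto intro!: eq_matI simp del: index_mult_mat(1))
    qed
    have psd: "nonneg_herm (mat_adjoint ?B * Y)"
    proof -
      have "mat_adjoint ?B * Y = mat_adjoint (?R * Y) * (?R * Y) + mat_adjoint Y * Y"
        unfolding B1 using Y(1) by (simp add: mat_simps)
      then show ?thesis using Y(1) by (auto intro!: nonneg_herm_add[where n = q] nonneg_herm_adjoint_mult)
    qed
    have "nonneg_herm (mat_adjoint P * A * P)"
      by (rule nonneg_herm_congruence[of _ q _ q]) (auto simp: A_def nonneg_herm_adjoint_mult intro: carrier_matI)
    then have "nonneg_herm P" using PAP by (simp add: mat_assoc)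
    then have "Determinant.det (1\<^sub>m q + P * (mat_adjoint ?B * Y)) \<noteq> 0"
      by (intro det_one_plus_nonneg_herm psd) (use Y in \<open>auto intro: carrier_matI\<close>)
    then show ?thesis
      unfolding b22[OF z Y] za using IH bc[of ?z] Y(1)
      by (simp add: det_smult det_mult[of _ q])
  qed
  ultimately show ?case using IH by (simp add: S_transform_Suc)
qed

section \<open>Completely degenerate sequences have degenerate models\<close>

definition hcat :: "nat \<Rightarrow> nat \<Rightarrow> (nat \<Rightarrow> complex mat) \<Rightarrow> nat \<Rightarrow> complex mat" where
  "hcat N q g n = Matrix.mat N (n * q) (\<lambda>(i, j). g (j div q) $$ (i, j mod q))"

definition blocks :: "nat \<Rightarrow> nat \<Rightarrow> (nat \<Rightarrow> nat \<Rightarrow> complex mat) \<Rightarrow> complex mat" where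
  "blocks q n J = Matrix.mat (n * q) (n * q) (\<lambda>(i, j). J (i div q) (j div q) $$ (i mod q, j mod q))"

lemma hcat_dims [simp]: "dim_row (hcat N q g n) = N" "dim_col (hcat N q g n) = n * q"
  by (simp_all add: hcat_def)

lemma blocks_dims [simp]: "dim_row (blocks q n J) = n * q" "dim_col (blocks q n J) = n * q"
  by (simp_all add: blocks_def)

lemma hcat_carrier [simp]: "hcat N q g n \<in> carrier_mat N (n * q)"
  by (simp add: hcat_def)

lemma blocks_carrier [simp]: "blocks q n J \<in> carrier_mat (n * q) (n * q)"
  by (simp add: blocks_def)

lemma div_mod_bound:
  fixes i n q :: nat
  assumes "i < n * q"
  shows "i div q < n" "i mod q < q"
  using assms by (auto simp: less_mult_imp_div_less) (metis mult_0_right mod_less_divisor neq0_conv not_less_zero)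

lemma block_index_bound:
  fixes b n q j :: nat
  assumes "b < n" "j < q"
  shows "b * q + j < n * q"
proof -
  have "b * q + j < Suc b * q" using assms(2) by simp
  also have "\<dots> \<le> n * q" using assms(1) by (intro mult_right_mono) auto
  finally show ?thesis .
qed

lemma blocks_eqD:
  assumes "blocks q n J = blocks q n J'" "a < n" "b < n"
    and "J a b \<in> carrier_mat q q" "J' a b \<in> carrier_mat q q"
  shows "J a b = J' a b"
proof (rule eq_matI)
  fix i j assume "i < dim_row (J' a b)" "j < dim_col (J' a b)"
  then have ij: "i < q" "j < q" using assms(5) by auto
  show "J a b $$ (i, j) = J' a b $$ (i, j)"
    using arg_cong[OF assms(1), of "\<lambda>M. M $$ (a * q + i, b * q + j)"] ij
      block_index_bound[OF assms(2) ij(1)] block_index_bound[OF assms(3) ij(2)]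
    by (simp add: blocks_def)
qed (use assms in auto)

lemma blocks_cong:
  "n = n' \<Longrightarrow> (\<And>a b. a < n' \<Longrightarrow> b < n' \<Longrightarrow> J a b = J' a b) \<Longrightarrow> blocks q n J = blocks q n' J'"
  by (rule eq_matI) (auto simp: blocks_def div_mod_bound)

lemma hcat_eqD:
  assumes "hcat N q g n = hcat N q g' n" "b < n" "g b \<in> carrier_mat N q" "g' b \<in> carrier_mat N q"
  shows "g b = g' b"
proof (rule eq_matI)
  fix i j assume "i < dim_row (g' b)" "j < dim_col (g' b)"
  then have ij: "i < N" "j < q" using assms(4) by auto
  show "g b $$ (i, j) = g' b $$ (i, j)"
    using arg_cong[OF assms(1), of "\<lambda>M. M $$ (i, b * q + j)"] ij block_index_bound[OF assms(2) ij(2)]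
    by (simp add: hcat_def)
qed (use assms in auto)

lemma hcat_cong:
  "n = n' \<Longrightarrow> (\<And>b. b < n' \<Longrightarrow> g b = g' b) \<Longrightarrow> hcat N q g n = hcat N q g' n'"
  by (rule eq_matI) (auto simp: hcat_def div_mod_bound)

lemma mult_hcat:
  assumes "X \<in> carrier_mat N' N" "\<And>b. b < n \<Longrightarrow> g b \<in> carrier_mat N q"
  shows "X * hcat N q g n = hcat N' q (\<lambda>b. X * g b) n"
proof (rule eq_matI)
  fix i j assume "i < dim_row (hcat N' q (\<lambda>b. X * g b) n)" "j < dim_col (hcat N' q (\<lambda>b. X * g b) n)"
  then have ij: "i < N'" "j < n * q" by auto
  note dm = div_mod_bound[OF ij(2)]
  have dims: "dim_row X = N'" "dim_col X = N" "dim_row (g (j div q)) = N" "dim_col (g (j div q)) = q"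
    using assms(1) assms(2)[OF dm(1)] by auto
  have "(X * hcat N q g n) $$ (i, j) = (\<Sum>l<N. X $$ (i, l) * g (j div q) $$ (l, j mod q))"
    using ij dims by (subst index_mult_sum) (auto simp: hcat_def)
  also have "\<dots> = (X * g (j div q)) $$ (i, j mod q)"
    using ij dims dm by (subst index_mult_sum) auto
  finally show "(X * hcat N q g n) $$ (i, j) = hcat N' q (\<lambda>b. X * g b) n $$ (i, j)"
    using ij by (simp add: hcat_def)
qed (use assms in auto)

lemma index_adjoint_hcat_mult:
  assumes "V \<in> carrier_mat N p" "\<And>b. b < n \<Longrightarrow> g b \<in> carrier_mat N q" "i < n * q" "j < p"
  shows "(mat_adjoint (hcat N q g n) * V) $$ (i, j) = (mat_adjoint (g (i div q)) * V) $$ (i mod q, j)"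
proof -
  note dm = div_mod_bound[OF assms(3)]
  have dims: "dim_row V = N" "dim_col V = p" "dim_row (g (i div q)) = N" "dim_col (g (i div q)) = q"
    using assms(1) assms(2)[OF dm(1)] by auto
  have "(mat_adjoint (hcat N q g n) * V) $$ (i, j) = (\<Sum>l<N. cnj (g (i div q) $$ (l, i mod q)) * V $$ (l, j))"
    using assms(3,4) dims by (subst index_mult_sum) (auto simp: hcat_def)
  also have "\<dots> = (mat_adjoint (g (i div q)) * V) $$ (i mod q, j)"
    using assms(4) dims dm by (subst index_mult_sum) auto
  finally show ?thesis .
qed

lemma adjoint_hcat_mult_eq_0:
  assumes "V \<in> carrier_mat N p" "\<And>b. b < n \<Longrightarrow> g b \<in> carrier_mat N q"
    and "\<And>b. b < n \<Longrightarrow> mat_adjoint (g b) * V = 0\<^sub>m q p"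
  shows "mat_adjoint (hcat N q g n) * V = 0\<^sub>m (n * q) p"
proof (rule eq_matI)
  fix i j assume "i < dim_row (0\<^sub>m (n * q) p :: complex mat)" "j < dim_col (0\<^sub>m (n * q) p :: complex mat)"
  then have ij: "i < n * q" "j < p" by auto
  show "(mat_adjoint (hcat N q g n) * V) $$ (i, j) = 0\<^sub>m (n * q) p $$ (i, j)"
    using ij div_mod_bound[OF ij(1)] by (subst index_adjoint_hcat_mult[OF assms(1,2)]) (simp_all add: assms(3))
qed (use assms in auto)

lemma adjoint_hcat_mult_hcat:
  assumes "\<And>b. b < n \<Longrightarrow> g b \<in> carrier_mat N q" "\<And>b. b < n \<Longrightarrow> h b \<in> carrier_mat N q"
  shows "mat_adjoint (hcat N q g n) * hcat N q h n = blocks q n (\<lambda>a b. mat_adjoint (g a) * h b)"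
proof (rule eq_matI)
  fix i j assume "i < dim_row (blocks q n (\<lambda>a b. mat_adjoint (g a) * h b))" "j < dim_col (blocks q n (\<lambda>a b. mat_adjoint (g a) * h b))"
  then have ij: "i < n * q" "j < n * q" by auto
  note dm = div_mod_bound[OF ij(1)] div_mod_bound[OF ij(2)]
  have dims: "dim_row (g (i div q)) = N" "dim_col (g (i div q)) = q" "dim_row (h (j div q)) = N" "dim_col (h (j div q)) = q"
    using assms(1)[OF dm(1)] assms(2)[OF dm(3)] by auto
  have "(mat_adjoint (hcat N q g n) * hcat N q h n) $$ (i, j) = (mat_adjoint (g (i div q)) * hcat N q h n) $$ (i mod q, j)"
    using ij assms(1) by (intro index_adjoint_hcat_mult[where p = "n * q"]) auto
  also have "mat_adjoint (g (i div q)) * hcat N q h n = hcat q q (\<lambda>b. mat_adjoint (g (i div q)) * h b) n"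
    using assms(1)[OF dm(1)] assms(2) by (intro mult_hcat) auto
  finally show "(mat_adjoint (hcat N q g n) * hcat N q h n) $$ (i, j) = blocks q n (\<lambda>a b. mat_adjoint (g a) * h b) $$ (i, j)"
    using ij dm by (simp add: blocks_def hcat_def)
qed auto

section \<open>Hankel matrices as Gram matrices\<close>

lemma block_hankel_eq_blocks: "block_hankel q s n = blocks q (Suc n) (\<lambda>a b. s (a + b))"
  by (simp add: block_hankel_def blocks_def)

lemma nonneg_herm_blocks:
  assumes "\<And>a. a < n \<Longrightarrow> g a \<in> carrier_mat N q"
    and "\<And>a b. a < n \<Longrightarrow> b < n \<Longrightarrow> J a b = mat_adjoint (g a) * g b"
  shows "nonneg_herm (blocks q n J)"
proof -
  have "blocks q n J = mat_adjoint (hcat N q g n) * hcat N q g n"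
    using assms by (simp add: adjoint_hcat_mult_hcat cong: blocks_cong)
  then show ?thesis by (simp add: nonneg_herm_adjoint_mult)
qed

text \<open>A factor \<open>C\<close> with \<open>C\<^sup>* C\<close> equal to the block matrix is
  cut into block columns, which serve as Gram vectors.\<close>

lemma blocks_gram:
  assumes psd: "nonneg_herm (blocks q n J)"
    and J: "\<And>a b. a < n \<Longrightarrow> b < n \<Longrightarrow> J a b \<in> carrier_mat q q"
  obtains g where "\<And>a. g a \<in> carrier_mat (n * q) q"
    "\<And>a b. a < n \<Longrightarrow> b < n \<Longrightarrow> mat_adjoint (g a) * g b = J a b"
proof -
  obtain C where C: "C \<in> carrier_mat (n * q) (n * q)" "blocks q n J = mat_adjoint C * C"
    by (rule nonneg_herm_factor[OF psd, of "n * q"]) (auto intro: carrier_matI)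
  define g where "g a = Matrix.mat (n * q) q (\<lambda>(i, j). C $$ (i, a * q + j))" for a
  have g: "g a \<in> carrier_mat (n * q) q" for a by (simp add: g_def)
  have "C = hcat (n * q) q g n"
    by (rule eq_matI) (use C(1) in \<open>auto simp: hcat_def g_def div_mod_bound\<close>)
  then have "blocks q n J = blocks q n (\<lambda>a b. mat_adjoint (g a) * g b)"
    using C(2) g by (simp add: adjoint_hcat_mult_hcat)
  note eq = this
  have "mat_adjoint (g a) * g b = J a b" if ab: "a < n" "b < n" for a b
    by (rule blocks_eqD[OF eq ab, symmetric]) (use J[OF ab] g[of a] g[of b] in simp_all)
  then show ?thesis by (rule that[OF g])
qed

text \<open>\<open>L\<^sub>n\<close> is a Schur complement: it equals \<open>E\<^sup>* E\<close> for
  the residual \<open>E\<close> left by the orthogonal projection of \<open>g n\<close> onto the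
  span of the earlier \<open>g a\<close>. The coefficients \<open>X = P (G\<^sup>* g n)\<close>,
  with \<open>P\<close> the Moore-Penrose inverse of the Gram matrix, are those of this
  projection.\<close>

lemma L_mat_eq_0:
  assumes g: "\<And>a. a \<le> n \<Longrightarrow> g a \<in> carrier_mat N q"
    and gram: "\<And>a b. a \<le> n \<Longrightarrow> b \<le> n \<Longrightarrow> mat_adjoint (g a) * g b = h (a + b)"
    and L: "L_mat q h n = 0\<^sub>m q q"
  obtains X where "X \<in> carrier_mat (n * q) q" "g n = hcat N q g n * X"
proof -
  define G where "G = hcat N q g n"
  define H where "H = mat_adjoint G * G"
  define P where "P = mp_inverse H"
  define y where "y = mat_adjoint G * g n"
  define X where "X = P * y"
  have gn [simp]: "dim_row (g n) = N" "dim_col (g n) = q" using g[of n] by auto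
  have G [simp]: "dim_row G = N" "dim_col G = n * q" by (simp_all add: G_def)
  have H: "H \<in> carrier_mat (n * q) (n * q)" "mat_adjoint H = H" by (simp_all add: H_def mat_simps)
  note P = mp_inverse_hermitian[OF H, folded P_def]
  have [simp]: "dim_row P = n * q" "dim_col P = n * q" "dim_row y = n * q" "dim_col y = q"
    using P(1) by (auto simp: y_def)
  have L': "L_mat q h n = mat_adjoint (g n) * g n - mat_adjoint y * (P * y)"
  proof (cases "n = 0")
    case True
    have "mat_adjoint y * (P * y) = 0\<^sub>m q q" by (rule eq_matI) (auto simp: True scalar_prod_def)
    moreover have "L_mat q h n = mat_adjoint (g n) * g n" using True gram[of 0 0] by (simp add: L_mat_def)
    ultimately show ?thesis by (auto intro!: eq_matI simp del: index_mult_mat(1))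
  next
    case False
    have "block_hankel q h (n - 1) = H"
    proof -
      have "Suc (n - 1) = n" using False by simp
      then show ?thesis unfolding block_hankel_eq_blocks H_def G_def
        using g by (simp add: adjoint_hcat_mult_hcat gram cong: blocks_cong)
    qed
    moreover have "block_row q h n = mat_adjoint y"
    proof (rule eq_matI)
      fix i j assume "i < dim_row (mat_adjoint y)" "j < dim_col (mat_adjoint y)"
      then have ij: "i < q" "j < n * q" by auto
      have "(mat_adjoint (g n) * G) $$ (i, j) = hcat q q (\<lambda>b. mat_adjoint (g n) * g b) n $$ (i, j)"
        unfolding G_def using g by (subst mult_hcat) auto
      also have "\<dots> = h (n + j div q) $$ (i, j mod q)"
        using ij div_mod_bound[OF ij(2)] by (simp add: hcat_def gram)
      finally show "block_row q h n $$ (i, j) = mat_adjoint y $$ (i, j)"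
        using ij by (simp add: block_row_def y_def mat_simps)
    qed (auto simp: block_row_def)
    moreover have "block_col q h n = y"
    proof (rule eq_matI)
      fix i j assume "i < dim_row y" "j < dim_col y"
      then have ij: "i < n * q" "j < q" by auto
      have "y $$ (i, j) = (mat_adjoint (g (i div q)) * g n) $$ (i mod q, j)"
        unfolding y_def G_def using g ij by (intro index_adjoint_hcat_mult) auto
      then show "block_col q h n $$ (i, j) = y $$ (i, j)"
        using ij div_mod_bound[OF ij(1)] by (simp add: block_col_def gram add.commute)
    qed (auto simp: block_col_def)
    ultimately show ?thesis
      using False gram[of n n] by (simp add: L_mat_def P_def[symmetric] mat_assoc mult_2)
  qed
  have "mat_adjoint (g n - G * X) * (g n - G * X)
      = mat_adjoint (g n) * g n - mat_adjoint y * (P * y) - (mat_adjoint y * (P * y) - mat_adjoint y * ((P * (H * P)) * y))"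
    by (auto intro!: eq_matI simp: X_def y_def H_def mat_simps P(4)[unfolded P_def, folded P_def] simp del: index_mult_mat(1))
  also have "\<dots> = 0\<^sub>m q q"
    unfolding P(3) using L L' by (auto intro!: eq_matI simp del: index_mult_mat(1))
  finally have "g n - G * X = 0\<^sub>m N q"
    by (rule adjoint_mult_self_eq_0) (simp add: X_def)
  then have "g n = G * X" by (rule mat_minus_eq_0D) (simp_all add: X_def)
  then show ?thesis using that[of X] by (simp add: X_def G_def)
qed

lemma shift_seq_blocks:
  assumes "\<And>j. j \<le> 2 * n + 1 \<Longrightarrow> s j \<in> carrier_mat q q"
  shows "complex_of_real (- \<alpha>) \<cdot>\<^sub>m block_hankel q s n + block_K q s n = blocks q (Suc n) (\<lambda>a b. shift_seq \<alpha> s (a + b))"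
proof (rule eq_matI)
  fix i j assume "i < dim_row (blocks q (Suc n) (\<lambda>a b. shift_seq \<alpha> s (a + b)))"
    "j < dim_col (blocks q (Suc n) (\<lambda>a b. shift_seq \<alpha> s (a + b)))"
  then have ij: "i < Suc n * q" "j < Suc n * q" by auto
  note dm = div_mod_bound[OF ij(1)] div_mod_bound[OF ij(2)]
  have "s (i div q + j div q) \<in> carrier_mat q q" "s (Suc (i div q + j div q)) \<in> carrier_mat q q"
    using dm by (auto intro!: assms)
  then show "(complex_of_real (- \<alpha>) \<cdot>\<^sub>m block_hankel q s n + block_K q s n) $$ (i, j)
      = blocks q (Suc n) (\<lambda>a b. shift_seq \<alpha> s (a + b)) $$ (i, j)"
    using ij dm by (simp add: block_K_def block_hankel_eq_blocks blocks_def shift_seq_def)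
qed (auto simp: block_K_def block_hankel_eq_blocks)

lemma degenerate_hcat:
  assumes "R \<in> carrier_mat N N" "B \<in> carrier_mat N q" "X \<in> carrier_mat (m div 2 * q) q"
    and "model_vec \<alpha> m R B (m div 2) = hcat N q (model_vec \<alpha> m R B) (m div 2) * X"
  shows "degenerate \<alpha> m R B"
  unfolding degenerate_def
proof (intro ballI impI)
  fix V assume V: "V \<in> carrier_mat (dim_row B) (dim_col B)"
    and 0: "\<forall>j<m div 2. mat_adjoint (model_vec \<alpha> m R B j) * V = 0\<^sub>m (dim_col B) (dim_col B)"
  have W: "model_vec \<alpha> m R B j \<in> carrier_mat N q" for j
    using assms(1,2) by (auto simp: model_vec_def krylov_dims intro!: carrier_matI)
  have "mat_adjoint (hcat N q (model_vec \<alpha> m R B) (m div 2)) * V = 0\<^sub>m (m div 2 * q) q"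
    by (rule adjoint_hcat_mult_eq_0) (use V W 0 assms in auto)
  then show "mat_adjoint (model_vec \<alpha> m R B (m div 2)) * V = 0\<^sub>m (dim_col B) (dim_col B)"
    unfolding assms(4) using assms(2,3) V by (simp add: mat_simps)
qed

context stieltjes_model
begin

text \<open>The Gram vectors are \<open>k a\<close> for the Hankel matrix and \<open>R * k a\<close>
  for the shifted one. Taken at order \<open>m + 1\<close> this gives extendability.\<close>

lemma K_nonneg_model:
  assumes "\<And>j. j \<le> m \<Longrightarrow> t j = s j"
  shows "K_nonneg q m \<alpha> t"
proof -
  have t: "t j \<in> carrier_mat q q" if "j \<le> m" for j using assms[OF that] by simp
  have H: "nonneg_herm (block_hankel q t n)" if "2 * n \<le> m" for n
    unfolding block_hankel_eq_blocks
    by (rule nonneg_herm_blocks[of _ k N]) (use that assms in \<open>auto simp: k_move intro!: carrier_matI\<close>)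
  have K: "nonneg_herm (complex_of_real (- \<alpha>) \<cdot>\<^sub>m block_hankel q t n + block_K q t n)" if "2 * n + 1 \<le> m" for n
  proof (subst shift_seq_blocks)
    show "nonneg_herm (blocks q (Suc n) (\<lambda>a b. shift_seq \<alpha> t (a + b)))"
    proof (rule nonneg_herm_blocks[of _ "\<lambda>a. R * k a" N])
      fix a b assume "a < Suc n" "b < Suc n"
      then have "shift_seq \<alpha> t (a + b) = w (a + b)"
        using that assms by (simp add: shift_seq_def w_eq)
      then show "shift_seq \<alpha> t (a + b) = mat_adjoint (R * k a) * (R * k b)"
        using w_move[of a b] by (simp add: mat_simps S_def)
    qed auto
  qed (use that t in auto)
  have "nonneg_herm (t 0)" using assms[of 0] by (simp add: s_0 A_def nonneg_herm_adjoint_mult)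
  moreover have "2 * (m div 2) \<le> m" "odd m \<Longrightarrow> 2 * (m div 2) + 1 \<le> m" by auto
  moreover have "2 * (m div 2 - 1) + 1 \<le> m" if "m \<noteq> 0" "even m" using that by (auto elim!: evenE)
  ultimately show ?thesis using t H K by (auto simp: K_nonneg_def)
qed

end

text \<open>\<open>g\<close> will be Gram vectors of \<open>H\<^sub>n\<close>, and \<open>J\<close>
  is the form that \<open>R\<^sup>* R\<close> has to represent on the first \<open>r\<close> of
  them. For even \<open>m\<close>, \<open>r = n\<close> and \<open>g n\<close> lies in their span;
  for odd \<open>m\<close>, \<open>r = n + 1\<close> and Gram vectors \<open>\<theta>\<close> of
  \<open>J\<close> have a dependent last member. With \<open>P\<close> the Moore-Penrose inverse of
  the Gram matrix of \<open>G\<close>, the operator \<open>G P K P G\<^sup>*\<close> is the only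
  candidate supported on the range of \<open>G\<close>.\<close>

lemma operator_from_gram:
  assumes g: "\<And>a. a \<le> n \<Longrightarrow> g a \<in> carrier_mat N q" and r: "r = n \<or> r = Suc n"
    and span: "r = n \<Longrightarrow> \<exists>X \<in> carrier_mat (n * q) q. g n = hcat N q g n * X"
    and M: "nonneg_herm (blocks q r J)" "\<And>a b. a < r \<Longrightarrow> b < r \<Longrightarrow> J a b \<in> carrier_mat q q"
    and J: "\<And>a b. a < r \<Longrightarrow> b < n \<Longrightarrow> J a b = mat_adjoint (g a) * (g (Suc b) - complex_of_real \<alpha> \<cdot>\<^sub>m g b)"
    and deg: "r = Suc n \<Longrightarrow> \<exists>\<theta> N' X. (\<forall>a\<le>n. \<theta> a \<in> carrier_mat N' q) \<and> X \<in> carrier_mat (n * q) q \<and>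
      (\<forall>a\<le>n. \<forall>b\<le>n. J a b = mat_adjoint (\<theta> a) * \<theta> b) \<and> \<theta> n = hcat N' q \<theta> n * X"
  obtains R where "R \<in> carrier_mat N N"
    "\<And>b. b < n \<Longrightarrow> model_op \<alpha> R * g b = g (Suc b)"
    "\<And>a b. a < r \<Longrightarrow> b < r \<Longrightarrow> mat_adjoint (g a) * (mat_adjoint R * R * g b) = J a b"
proof -
  define G where "G = hcat N q g r"
  define K where "K = blocks q r J"
  define H where "H = mat_adjoint G * G"
  define P where "P = mp_inverse H"
  have rn: "a \<le> n" if "a < r" for a using r that by auto
  have [simp]: "dim_row G = N" "dim_col G = r * q" "dim_row K = r * q" "dim_col K = r * q"
    by (simp_all add: G_def K_def)
  have H: "H \<in> carrier_mat (r * q) (r * q)" "mat_adjoint H = H" by (simp_all add: H_def mat_simps)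
  note P = mp_inverse_hermitian[OF H, folded P_def]
  have [simp]: "dim_row P = r * q" "dim_col P = r * q" using P(1) by auto
  have Hdims [simp]: "dim_row H = r * q" "dim_col H = r * q" using H by auto
  have Kadj: "mat_adjoint K = K" using nonneg_hermD(1)[OF M(1), of "r * q"] by (simp add: K_def)
  \<comment> \<open>\<open>V\<close> projects coefficients onto the kernel of \<open>G\<close>; the
    form \<open>K\<close> descends to the range of \<open>G\<close> exactly if
    \<open>K V = 0\<close>.\<close>
  define V where "V = 1\<^sub>m (r * q) - P * H"
  have V: "V \<in> carrier_mat (r * q) (r * q)" by (simp add: V_def)
  have GV: "G * V = 0\<^sub>m N (r * q)"
  proof (rule adjoint_mult_self_eq_0[of _ "r * q"])
    have "mat_adjoint (G * V) * (G * V) = mat_adjoint V * (H * V)" using V by (simp add: H_def mat_simps)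
    also have "H * V = H - H * (P * H)" by (simp add: V_def mat_simps)
    also have "\<dots> = 0\<^sub>m (r * q) (r * q)" unfolding P(2) by (auto intro!: eq_matI)
    finally show "mat_adjoint (G * V) * (G * V) = 0\<^sub>m (r * q) (r * q)" using V by simp
  qed (use V in simp)
  have "G - G * (P * H) = 0\<^sub>m N (r * q)" using GV by (simp add: V_def mat_simps)
  from mat_minus_eq_0D[OF this] have GPH: "G * (P * H) = G" by simp
  \<comment> \<open>\<open>G P G\<^sup>*\<close> is the projection onto the range of
    \<open>G\<close>. For \<open>r = n\<close> the vector \<open>g n\<close> is not a column block
    of \<open>G\<close> and lies in the range by the assumed dependence.\<close>
  have proj: "G * (P * (mat_adjoint G * g b)) = g b" if b: "b \<le> n" for b
  proof (cases "b < r")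
    case True
    define E where "E = G * (P * mat_adjoint G)"
    have E: "E \<in> carrier_mat N N" by (simp add: E_def)
    have "E * G = G" using GPH by (simp add: E_def mat_assoc H_def)
    then have "hcat N q (\<lambda>b. E * g b) r = hcat N q g r"
      using mult_hcat[OF E, of r g q] g rn by (simp add: G_def)
    then have "E * g b = g b"
      by (rule hcat_eqD[OF _ True]) (use g[OF b] E in auto)
    then have "G * (P * mat_adjoint G) * g b = g b" unfolding E_def .
    then show ?thesis using g[OF b] by (simp add: mat_assoc)
  next
    case False
    then have "b = n" "r = n" using r b by auto
    then obtain X where X: "X \<in> carrier_mat (n * q) q" "g b = G * X" using span by (auto simp: G_def)
    then have "G * (P * (mat_adjoint G * g b)) = G * (P * H) * X"
      using \<open>r = n\<close> by (simp add: mat_assoc H_def)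
    then show ?thesis unfolding GPH using X by simp
  qed
  have KV: "K * V = 0\<^sub>m (r * q) (r * q)"
  proof (cases "r = n")
    case True
    \<comment> \<open>Here every column of \<open>J\<close> is covered, so
      \<open>K = G\<^sup>* \<Delta>\<close>; self-adjointness turns this into
      \<open>K = \<Delta>\<^sup>* G\<close>, which annihilates \<open>V\<close>.\<close>
    define \<Delta> where "\<Delta> b = g (Suc b) - complex_of_real \<alpha> \<cdot>\<^sub>m g b" for b
    have \<Delta>: "\<Delta> b \<in> carrier_mat N q" if "b < n" for b using g[of b] g[of "Suc b"] that by (simp add: \<Delta>_def)
    have "K = mat_adjoint G * hcat N q \<Delta> r"
      unfolding K_def G_def using J g \<Delta> True by (subst adjoint_hcat_mult_hcat) (auto intro!: blocks_cong simp: \<Delta>_def)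
    then have "K = mat_adjoint (mat_adjoint G * hcat N q \<Delta> r)" using Kadj by simp
    then have "K * V = mat_adjoint (hcat N q \<Delta> r) * (G * V)" using V by (simp add: mat_simps)
    then show ?thesis unfolding GV by simp
  next
    case False
    then have rS: "r = Suc n" using r by simp
    then obtain \<theta> N' X where \<theta>: "\<And>a. a \<le> n \<Longrightarrow> \<theta> a \<in> carrier_mat N' q" and X: "X \<in> carrier_mat (n * q) q"
      and J\<theta>: "\<And>a b. a \<le> n \<Longrightarrow> b \<le> n \<Longrightarrow> J a b = mat_adjoint (\<theta> a) * \<theta> b" and \<theta>n: "\<theta> n = hcat N' q \<theta> n * X"
      using deg by metis
    define \<Theta> where "\<Theta> = hcat N' q \<theta> r"
    have [simp]: "dim_row \<Theta> = N'" "dim_col \<Theta> = r * q" by (simp_all add: \<Theta>_def)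
    have K: "K = mat_adjoint \<Theta> * \<Theta>"
      unfolding K_def \<Theta>_def using rS \<theta> by (subst adjoint_hcat_mult_hcat) (auto intro!: blocks_cong J\<theta>)
    \<comment> \<open>The formula for \<open>J\<close> covers only the columns \<open>b < n\<close>,
      which by symmetry gives the rows \<open>a < n\<close>. The last row is then a combination of
      these, because \<open>\<theta> n\<close> depends on the earlier
      \<open>\<theta> a\<close>.\<close>
    have small: "mat_adjoint (\<theta> a) * (\<Theta> * V) = 0\<^sub>m q (r * q)" if a: "a < n" for a
    proof -
      let ?D = "g (Suc a) - complex_of_real \<alpha> \<cdot>\<^sub>m g a"
      have D: "?D \<in> carrier_mat N q" using g[of a] g[of "Suc a"] a by simp
      have "mat_adjoint (\<theta> a) * \<theta> b = mat_adjoint ?D * g b" if "b < r" for b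
      proof -
        have "mat_adjoint (\<theta> b) * \<theta> a = mat_adjoint (g b) * ?D"
          using J\<theta>[of b a] J[of b a] a that rS by simp
        then have "mat_adjoint (mat_adjoint (\<theta> b) * \<theta> a) = mat_adjoint (mat_adjoint (g b) * ?D)" by simp
        then show ?thesis using \<theta>[of a] \<theta>[of b] g[of b] D a rn[OF that] by (simp add: adjoint_mult del: adjoint_minus)
      qed
      then have "hcat q q (\<lambda>b. mat_adjoint (\<theta> a) * \<theta> b) r = hcat q q (\<lambda>b. mat_adjoint ?D * g b) r"
        by (intro hcat_cong refl)
      moreover have "mat_adjoint (\<theta> a) * \<Theta> = hcat q q (\<lambda>b. mat_adjoint (\<theta> a) * \<theta> b) r"
        unfolding \<Theta>_def by (rule mult_hcat) (use \<theta> a rn in auto)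
      moreover have "mat_adjoint ?D * G = hcat q q (\<lambda>b. mat_adjoint ?D * g b) r"
        unfolding G_def by (rule mult_hcat) (use g D rn in auto)
      ultimately have "mat_adjoint (\<theta> a) * \<Theta> = mat_adjoint ?D * G" by simp
      then have "mat_adjoint (\<theta> a) * \<Theta> * V = mat_adjoint ?D * (G * V)" using V D by (simp add: mat_assoc)
      then show ?thesis unfolding GV using \<theta>[of a] a V D by (simp add: mat_assoc)
    qed
    have "mat_adjoint (hcat N' q \<theta> n) * (\<Theta> * V) = 0\<^sub>m (n * q) (r * q)"
      by (rule adjoint_hcat_mult_eq_0) (use V \<theta> small in auto)
    then have "mat_adjoint (\<theta> n) * (\<Theta> * V) = 0\<^sub>m q (r * q)"
      unfolding \<theta>n using X V by (simp add: mat_simps)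
    then have "mat_adjoint (\<theta> a) * (\<Theta> * V) = 0\<^sub>m q (r * q)" if "a < r" for a
      using small[of a] that rS by (cases "a = n") auto
    then have "mat_adjoint (hcat N' q \<theta> r) * (\<Theta> * V) = 0\<^sub>m (r * q) (r * q)"
      by (intro adjoint_hcat_mult_eq_0[where N = N']) (use V \<theta> rn in auto)
    then have "mat_adjoint \<Theta> * (\<Theta> * V) = 0\<^sub>m (r * q) (r * q)" by (simp add: \<Theta>_def)
    then show ?thesis unfolding K using V by (simp add: mat_assoc)
  qed
  have "K - K * (P * H) = 0\<^sub>m (r * q) (r * q)" using KV by (simp add: V_def mat_simps)
  from mat_minus_eq_0D[OF this] have KPH: "K * (P * H) = K" by simp
  have HPK: "H * (P * K) = K"
    using arg_cong[OF KPH, of mat_adjoint] by (simp add: mat_simps Kadj H P)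
  let ?Y = "P * mat_adjoint G"
  have "nonneg_herm (mat_adjoint ?Y * K * ?Y)"
    by (rule nonneg_herm_congruence[of _ "r * q" _ N]) (auto simp: K_def M(1) intro: carrier_matI)
  moreover have "mat_adjoint ?Y * K * ?Y \<in> carrier_mat N N" by simp
  ultimately obtain R where R: "R \<in> carrier_mat N N" "mat_adjoint ?Y * K * ?Y = mat_adjoint R * R"
    using nonneg_herm_factor by metis
  define S where "S = mat_adjoint R * R"
  have Sdims [simp]: "dim_row S = N" "dim_col S = N" using R by (auto simp: S_def)
  have S: "S = G * (P * (K * (P * mat_adjoint G)))" using R(2) P(4) by (simp add: S_def mat_simps)
  have GSG: "mat_adjoint G * (S * G) = K"
  proof -
    have "mat_adjoint G * (S * G) = H * (P * (K * (P * H)))" by (simp add: S H_def mat_assoc)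
    then show ?thesis by (simp add: KPH HPK)
  qed
  have "S * G = hcat N q (\<lambda>b. S * g b) r" unfolding G_def using g rn by (intro mult_hcat) (auto intro: carrier_matI)
  moreover have "mat_adjoint G * hcat N q (\<lambda>b. S * g b) r = blocks q r (\<lambda>a b. mat_adjoint (g a) * (S * g b))"
    unfolding G_def by (rule adjoint_hcat_mult_hcat) (use g rn in auto)
  ultimately have eqJ: "blocks q r (\<lambda>a b. mat_adjoint (g a) * (S * g b)) = blocks q r J"
    using GSG by (simp add: K_def)
  have gSg: "mat_adjoint (g a) * (S * g b) = J a b" if "a < r" "b < r" for a b
    by (rule blocks_eqD[OF eqJ that]) (use g[OF rn[OF that(1)]] g[OF rn[OF that(2)]] M(2)[OF that] in auto)
  \<comment> \<open>The difference of both sides is orthogonal to the range of \<open>G\<close> by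
    \<open>gSg\<close>, and it also lies in that range, so it vanishes.\<close>
  have Sg: "S * g b = g (Suc b) - complex_of_real \<alpha> \<cdot>\<^sub>m g b" if b: "b < n" for b
  proof -
    let ?D = "g (Suc b) - complex_of_real \<alpha> \<cdot>\<^sub>m g b"
    have gb: "dim_row (g b) = N" "dim_col (g b) = q" "dim_row (g (Suc b)) = N" "dim_col (g (Suc b)) = q"
      using g[of b] g[of "Suc b"] b by auto
    have br: "b < r" using b r by auto
    have "mat_adjoint G * (S * g b - ?D) = 0\<^sub>m (r * q) q"
      unfolding G_def
    proof (rule adjoint_hcat_mult_eq_0)
      fix a assume a: "a < r"
      have "mat_adjoint (g a) * (S * g b - ?D) = mat_adjoint (g a) * (S * g b) - mat_adjoint (g a) * ?D"
        using gb g[OF rn[OF a]] by (simp add: mat_distribs)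
      then show "mat_adjoint (g a) * (S * g b - ?D) = 0\<^sub>m q q"
        using gSg[OF a br] J[OF a b] M(2)[OF a br] by (auto intro!: eq_matI)
    qed (use gb g rn in auto)
    then have "G * (P * (mat_adjoint G * (S * g b - ?D))) = 0\<^sub>m N q" by simp
    moreover have "G * (P * (mat_adjoint G * (S * g b - ?D)))
        = G * (P * (mat_adjoint G * (S * g b))) - (G * (P * (mat_adjoint G * g (Suc b))) - complex_of_real \<alpha> \<cdot>\<^sub>m (G * (P * (mat_adjoint G * g b))))"
      using gb by (simp add: mat_distribs)
    moreover have "G * (P * (mat_adjoint G * (S * g b))) = S * g b"
    proof -
      have "G * (P * (mat_adjoint G * (S * g b))) = G * (P * H) * (P * (K * (P * (mat_adjoint G * g b))))"
        using gb by (simp add: S H_def mat_assoc)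
      also have "\<dots> = S * g b" unfolding GPH using gb by (simp add: S mat_assoc)
      finally show ?thesis .
    qed
    ultimately have e: "S * g b - ?D = 0\<^sub>m N q" using proj b by simp
    show ?thesis by (rule mat_minus_eq_0D[OF e]) (use gb in simp_all)
  qed
  show ?thesis
  proof
    fix b assume b: "b < n"
    have gb: "dim_row (g b) = N" "dim_col (g b) = q" "dim_row (g (Suc b)) = N" "dim_col (g (Suc b)) = q"
      using g[of b] g[of "Suc b"] b by auto
    have "model_op \<alpha> R * g b = complex_of_real \<alpha> \<cdot>\<^sub>m g b + S * g b"
      using R(1) gb by (simp add: model_op_def S_def mat_distribs)
    also have "\<dots> = g (Suc b)" unfolding Sg[OF b] using gb by (auto intro!: eq_matI)
    finally show "model_op \<alpha> R * g b = g (Suc b)" .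
  qed (use R(1) gSg in \<open>auto simp: S_def\<close>)
qed

lemma krylov_eq:
  assumes "\<And>b. b < n \<Longrightarrow> model_op \<alpha> R * g b = g (Suc b)" "j \<le> n"
  shows "krylov \<alpha> R (g 0) j = g j"
  using assms(2) by (induction j) (simp_all add: assms(1))

text \<open>The operator found by \<open>operator_from_gram\<close> turns the Gram vectors of
  \<open>H\<^sub>n\<close> into Krylov vectors with \<open>B = g 0\<close>. The parities differ in
  which Hankel matrix carries the degeneracy.\<close>

lemma model_exists:
  assumes "0 < q" and cd: "K_nonneg_cd q m \<alpha> s"
  obtains N R B X where "R \<in> carrier_mat N N" "B \<in> carrier_mat N q" "X \<in> carrier_mat (m div 2 * q) q"
    "\<And>j. j \<le> m \<Longrightarrow> s j = model_moment \<alpha> R B j"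
    "model_vec \<alpha> m R B (m div 2) = hcat N q (model_vec \<alpha> m R B) (m div 2) * X"
proof -
  define n where "n = m div 2"
  define N where "N = Suc n * q"
  have s: "s j \<in> carrier_mat q q" if "j \<le> m" for j using cd that by (auto simp: K_nonneg_cd_def K_nonneg_def)
  have "nonneg_herm (block_hankel q s n)"
  proof (cases "m = 0")
    case True
    have "block_hankel q s 0 = s 0"
      by (rule eq_matI) (use s[of 0] in \<open>auto simp: block_hankel_def\<close>)
    then show ?thesis using True cd by (simp add: n_def K_nonneg_cd_def K_nonneg_def)
  next
    case False
    then show ?thesis using cd by (auto simp: n_def K_nonneg_cd_def K_nonneg_def split: if_splits)
  qed
  then have H: "nonneg_herm (blocks q (Suc n) (\<lambda>a b. s (a + b)))" by (simp add: block_hankel_eq_blocks)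
  obtain g where g: "\<And>a. g a \<in> carrier_mat N q" and gg: "\<And>a b. a < Suc n \<Longrightarrow> b < Suc n \<Longrightarrow> mat_adjoint (g a) * g b = s (a + b)"
    unfolding N_def by (rule blocks_gram[OF H]) (auto simp: n_def intro!: s)
  have gdims [simp]: "dim_row (g a) = N" "dim_col (g a) = q" for a using g[of a] by auto
  define J where "J a b = shift_seq \<alpha> s (a + b)" for a b
  have Jg: "J a b = mat_adjoint (g a) * (g (Suc b) - complex_of_real \<alpha> \<cdot>\<^sub>m g b)" if "a < Suc n" "b < n" for a b
  proof -
    have "mat_adjoint (g a) * (g (Suc b) - complex_of_real \<alpha> \<cdot>\<^sub>m g b) = s (Suc (a + b)) - complex_of_real \<alpha> \<cdot>\<^sub>m s (a + b)"
      using gg[of a b] gg[of a "Suc b"] that by (simp add: mat_distribs)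
    moreover have "s (Suc (a + b)) \<in> carrier_mat q q" "s (a + b) \<in> carrier_mat q q" using that by (auto simp: n_def intro!: s)
    ultimately show ?thesis by (auto intro!: eq_matI simp: J_def shift_seq_def)
  qed
  have Jc: "J a b \<in> carrier_mat q q" if "Suc (a + b) \<le> m" for a b
    using s[of "a + b"] s[of "Suc (a + b)"] that by (simp add: J_def shift_seq_def)
  have moments: "s j = model_moment \<alpha> R (g 0) j" if R: "R \<in> carrier_mat N N" and Rg: "\<And>b. b < n \<Longrightarrow> model_op \<alpha> R * g b = g (Suc b)"
    and jn: "j \<le> 2 * n" for R j
  proof -
    interpret stieltjes_model N q \<alpha> R "g 0" using R g by unfold_locales
    \<comment> \<open>An index up to \<open>2n\<close> is split into two indices up to
      \<open>n\<close>, where the Krylov vectors are known to be the \<open>g a\<close>.\<close>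
    have j: "min j n + (j - min j n) = j" "min j n \<le> n" "j - min j n \<le> n" using jn by auto
    have "s j = mat_adjoint (g (min j n)) * g (j - min j n)"
      using gg[of "min j n" "j - min j n"] j by simp
    also have "g (min j n) = k (min j n)" using krylov_eq[where g = g, OF Rg j(2)] by simp
    also have "g (j - min j n) = k (j - min j n)" using krylov_eq[where g = g, OF Rg j(3)] by simp
    finally show ?thesis using j(1) by (simp add: k_move)
  qed
  show ?thesis
  proof (cases "even m")
    case True
    then have m: "m = 2 * n" by (simp add: n_def)
    have L: "L_mat q s n = 0\<^sub>m q q" using cd True by (simp add: K_nonneg_cd_def n_def)
    obtain X where X: "X \<in> carrier_mat (n * q) q" "g n = hcat N q g n * X"
      by (rule L_mat_eq_0[of n g N q s]) (use g gg L in auto)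
    have psd: "nonneg_herm (blocks q n J)"
    proof (cases n)
      case 0
      then show ?thesis by (intro nonneg_hermI[of _ 0]) (auto intro!: eq_matI)
    next
      case (Suc n')
      then have "nonneg_herm (complex_of_real (- \<alpha>) \<cdot>\<^sub>m block_hankel q s n' + block_K q s n')"
        using cd True m by (simp add: K_nonneg_cd_def K_nonneg_def)
      then show ?thesis unfolding J_def using Suc m by (subst (asm) shift_seq_blocks) (auto intro!: s)
    qed
    obtain R where R: "R \<in> carrier_mat N N" "\<And>b. b < n \<Longrightarrow> model_op \<alpha> R * g b = g (Suc b)"
    proof (rule operator_from_gram[of n g N q n J \<alpha>])
      show "\<exists>X\<in>carrier_mat (n * q) q. g n = hcat N q g n * X" using X by blast
      show "J a b \<in> carrier_mat q q" if "a < n" "b < n" for a b using that m by (intro Jc) auto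
      show "J a b = mat_adjoint (g a) * (g (Suc b) - complex_of_real \<alpha> \<cdot>\<^sub>m g b)" if "a < n" "b < n" for a b
        using that by (intro Jg) auto
    qed (use g psd in auto)
    have W: "model_vec \<alpha> m R (g 0) j = g j" if "j \<le> n" for j
      using krylov_eq[where g = g, OF R(2) that] True by (simp add: model_vec_def)
    have Wh: "hcat N q (model_vec \<alpha> m R (g 0)) n = hcat N q g n" by (intro hcat_cong refl) (simp add: W)
    show ?thesis
    proof (rule that[of R N "g 0" X])
      show "model_vec \<alpha> m R (g 0) (m div 2) = hcat N q (model_vec \<alpha> m R (g 0)) (m div 2) * X"
        unfolding n_def[symmetric] Wh using W[of n] X(2) by simp
      show "s j = model_moment \<alpha> R (g 0) j" if "j \<le> m" for j
        using moments[OF R, of j] that m by simp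
      show "X \<in> carrier_mat (m div 2 * q) q" unfolding n_def[symmetric] by (rule X(1))
    qed (use R(1) g in auto)
  next
    case False
    then have m: "m = 2 * n + 1" by (simp add: n_def odd_two_times_div_two_succ)
    have "nonneg_herm (complex_of_real (- \<alpha>) \<cdot>\<^sub>m block_hankel q s n + block_K q s n)"
    proof -
      have "m \<noteq> 0" using False by (cases m) auto
      then show ?thesis
        using cd False unfolding n_def by (simp add: K_nonneg_cd_def K_nonneg_def del: of_real_minus)
    qed
    then have psd: "nonneg_herm (blocks q (Suc n) J)"
      unfolding J_def using m by (subst (asm) shift_seq_blocks) (auto intro!: s)
    have L: "L_mat q (shift_seq \<alpha> s) n = 0\<^sub>m q q" using cd False by (simp add: K_nonneg_cd_def n_def)
    have Jc': "J a b \<in> carrier_mat q q" if "a < Suc n" "b < Suc n" for a b using that m by (intro Jc) auto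
    obtain \<theta> where \<theta>: "\<And>a. \<theta> a \<in> carrier_mat N q" "\<And>a b. a < Suc n \<Longrightarrow> b < Suc n \<Longrightarrow> mat_adjoint (\<theta> a) * \<theta> b = J a b"
      unfolding N_def using blocks_gram[OF psd Jc'] by blast
    obtain Y where Y: "Y \<in> carrier_mat (n * q) q" "\<theta> n = hcat N q \<theta> n * Y"
      by (rule L_mat_eq_0[of n \<theta> N q "shift_seq \<alpha> s"]) (use \<theta> L in \<open>auto simp: J_def\<close>)
    obtain R where R: "R \<in> carrier_mat N N" "\<And>b. b < n \<Longrightarrow> model_op \<alpha> R * g b = g (Suc b)"
      and RJ: "\<And>a b. a < Suc n \<Longrightarrow> b < Suc n \<Longrightarrow> mat_adjoint (g a) * (mat_adjoint R * R * g b) = J a b"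
    proof (rule operator_from_gram[of n g N q "Suc n" J \<alpha>])
      show "\<exists>\<theta> N' X. (\<forall>a\<le>n. \<theta> a \<in> carrier_mat N' q) \<and> X \<in> carrier_mat (n * q) q \<and>
          (\<forall>a\<le>n. \<forall>b\<le>n. J a b = mat_adjoint (\<theta> a) * \<theta> b) \<and> \<theta> n = hcat N' q \<theta> n * X"
        using \<theta> Y by (intro exI[of _ \<theta>] exI[of _ N] exI[of _ Y]) auto
    qed (use g psd Jg Jc' in auto)
    \<comment> \<open>The vectors \<open>R * g a\<close> have the same Gram matrix as the
      \<open>\<theta> a\<close>, so complete degeneracy supplies a dependence among them
      too.\<close>
    obtain X where X: "X \<in> carrier_mat (n * q) q" "R * g n = hcat N q (\<lambda>a. R * g a) n * X"
    proof (rule L_mat_eq_0[of n "\<lambda>a. R * g a" N q "shift_seq \<alpha> s"])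
      fix a b assume "a \<le> n" "b \<le> n"
      then show "mat_adjoint (R * g a) * (R * g b) = shift_seq \<alpha> s (a + b)"
        using RJ[of a b] R(1) by (simp add: mat_simps J_def)
    qed (use R L in auto)
    have kg: "krylov \<alpha> R (g 0) j = g j" if "j \<le> n" for j
      using krylov_eq[where g = g, OF R(2) that] .
    have W: "model_vec \<alpha> m R (g 0) j = R * g j" if "j \<le> n" for j
      using kg[OF that] False by (simp add: model_vec_def)
    have Wh: "hcat N q (model_vec \<alpha> m R (g 0)) n = hcat N q (\<lambda>a. R * g a) n" by (intro hcat_cong refl) (simp add: W)
    have mom2: "s j = model_moment \<alpha> R (g 0) j" if "j \<le> 2 * n" for j
      using moments[OF R, of j] that by simp
    interpret stieltjes_model N q \<alpha> R "g 0" using R g by unfold_locales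
    \<comment> \<open>The index \<open>m = 2n + 1\<close> cannot be split as above. The last moment
      is read off from \<open>J n n\<close>, since the moment of index \<open>2n\<close> is already
      known.\<close>
    have last: "s m = model_moment \<alpha> R (g 0) m"
    proof -
      have "J n n = w (n + n)" using RJ[of n n] w_move[of n n] kg[of n] by (simp add: S_def)
      then have e: "complex_of_real (- \<alpha>) \<cdot>\<^sub>m s (2 * n) + s m
          = complex_of_real (- \<alpha>) \<cdot>\<^sub>m model_moment \<alpha> R (g 0) (2 * n) + model_moment \<alpha> R (g 0) m"
        by (simp add: J_def shift_seq_def w_eq m mult_2)
      have e2: "s (2 * n) = model_moment \<alpha> R (g 0) (2 * n)" by (rule mom2) simp
      show ?thesis
      proof (rule eq_matI)
        fix i j assume "i < dim_row (model_moment \<alpha> R (g 0) m)" "j < dim_col (model_moment \<alpha> R (g 0) m)"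
        then show "s m $$ (i, j) = model_moment \<alpha> R (g 0) m $$ (i, j)"
          using arg_cong[OF e, of "\<lambda>M. M $$ (i, j)"] s[of m] by (simp add: e2)
      qed (use s[of m] in auto)
    qed
    have "s j = model_moment \<alpha> R (g 0) j" if "j \<le> m" for j
      using last mom2[of j] that m by (cases "j = m") auto
    note mom = this
    show ?thesis
    proof (rule that[of R N "g 0" X])
      show "model_vec \<alpha> m R (g 0) (m div 2) = hcat N q (model_vec \<alpha> m R (g 0)) (m div 2) * X"
        unfolding n_def[symmetric] Wh using W[of n] X(2) by simp
      show "X \<in> carrier_mat (m div 2 * q) q" unfolding n_def[symmetric] by (rule X(1))
    qed (use R(1) g mom in auto)
  qed
qed

section \<open>Integration against non-negative Hermitian measures\<close>

definition mform :: "complex mat \<Rightarrow> complex vec \<Rightarrow> real" where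
  "mform A x = Re ((A *\<^sub>v x) \<bullet>c x)"

lemma mform_nonneg: "nonneg_herm A \<Longrightarrow> A \<in> carrier_mat q q \<Longrightarrow> x \<in> carrier_vec q \<Longrightarrow> 0 \<le> mform A x"
  by (auto simp: nonneg_herm_def mform_def)

lemma mform_sums:
  assumes "A \<in> carrier_mat q q" "x \<in> carrier_vec q" "\<And>n. B n \<in> carrier_mat q q"
    and "\<And>i j. i < q \<Longrightarrow> j < q \<Longrightarrow> (\<lambda>n. B n $$ (i, j)) sums (A $$ (i, j))"
  shows "(\<lambda>n. mform (B n) x) sums mform A x"
proof -
  have "(\<lambda>n. \<Sum>i<q. \<Sum>j<q. cnj (vec_index x i) * B n $$ (i, j) * vec_index x j)
      sums (\<Sum>i<q. \<Sum>j<q. cnj (vec_index x i) * A $$ (i, j) * vec_index x j)"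
    by (intro sums_sum sums_mult sums_mult2 assms(4)) auto
  from sums_Re[OF this] show ?thesis
    unfolding mform_def using assms(1-3) by (subst (1 2) quadratic_form[where n = q]) auto
qed

text \<open>The form at \<open>e\<^sub>j + c e\<^sub>k\<close> consists of four terms; averaging
  over the fourth roots of unity \<open>c\<close> with weight \<open>cnj c\<close> leaves only the
  entry \<open>A $$ (j, k)\<close>.\<close>

lemma polarization:
  assumes A: "A \<in> carrier_mat q q" and jk: "j < q" "k < q"
  shows "A $$ (j, k) = 1 / 4 * (\<Sum>r<4::nat. (- \<i>) ^ r *
    ((A *\<^sub>v (unit_vec q j + (\<i> ^ r) \<cdot>\<^sub>v unit_vec q k)) \<bullet>c (unit_vec q j + (\<i> ^ r) \<cdot>\<^sub>v unit_vec q k)))"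
proof -
  have *: "(A *\<^sub>v (unit_vec q j + c \<cdot>\<^sub>v unit_vec q k)) \<bullet>c (unit_vec q j + c \<cdot>\<^sub>v unit_vec q k)
      = A $$ (j, j) + c * A $$ (j, k) + cnj c * A $$ (k, j) + cnj c * c * A $$ (k, k)" for c
  proof -
    have "(A *\<^sub>v (unit_vec q j + c \<cdot>\<^sub>v unit_vec q k)) \<bullet>c (unit_vec q j + c \<cdot>\<^sub>v unit_vec q k)
      = (\<Sum>l<q. \<Sum>p<q. cnj (vec_index (unit_vec q j + c \<cdot>\<^sub>v unit_vec q k) l) * A $$ (l, p)
          * vec_index (unit_vec q j + c \<cdot>\<^sub>v unit_vec q k) p)"
      by (rule quadratic_form) (use A in auto)
    also have "\<dots> = (\<Sum>l<q. \<Sum>p<q. ((if l = j then 1 else 0) + cnj c * (if l = k then 1 else 0)) * A $$ (l, p)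
          * ((if p = j then 1 else 0) + c * (if p = k then 1 else 0)))"
      by (intro sum.cong refl) (auto simp: unit_vec_def ring_distribs)
    also have "\<dots> = (\<Sum>l<q. ((if l = j then 1 else 0) + cnj c * (if l = k then 1 else 0)) * (A $$ (l, j) + c * A $$ (l, k)))"
    proof (intro sum.cong refl)
      fix l
      have "(\<Sum>p<q. (b * A $$ (l, p)) * ((if p = j then 1 else 0) + c * (if p = k then 1 else 0)))
        = b * (A $$ (l, j) + c * A $$ (l, k))" for b
      proof -
        have "(\<Sum>p<q. (b * A $$ (l, p)) * ((if p = j then 1 else 0) + c * (if p = k then 1 else 0)))
          = (\<Sum>p<q. if p = j then b * A $$ (l, p) else 0) + (\<Sum>p<q. if p = k then b * c * A $$ (l, p) else 0)"
          unfolding sum.distrib[symmetric] by (intro sum.cong refl) (auto simp: unit_vec_def ring_distribs)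
        then show ?thesis using jk by (simp add: ring_distribs)
      qed
      then show "(\<Sum>p<q. ((if l = j then 1 else 0) + cnj c * (if l = k then 1 else 0)) * A $$ (l, p)
          * ((if p = j then 1 else 0) + c * (if p = k then 1 else 0)))
        = ((if l = j then 1 else 0) + cnj c * (if l = k then 1 else 0)) * (A $$ (l, j) + c * A $$ (l, k))" .
    qed
    also have "\<dots> = (\<Sum>l<q. if l = j then A $$ (l, j) + c * A $$ (l, k) else 0)
        + (\<Sum>l<q. if l = k then cnj c * (A $$ (l, j) + c * A $$ (l, k)) else 0)"
      unfolding sum.distrib[symmetric] by (intro sum.cong refl) (auto simp: unit_vec_def ring_distribs)
    also have "\<dots> = A $$ (j, j) + c * A $$ (j, k) + cnj c * A $$ (k, j) + cnj c * c * A $$ (k, k)"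
      using jk by (simp add: ring_distribs)
    finally show ?thesis .
  qed
  show ?thesis unfolding * by (simp add: eval_nat_numeral right_diff_distrib distrib_left)
qed

lemma cscalar_prod_self: "(y :: complex vec) \<bullet>c y = of_real (\<Sum>i<dim_vec y. (cmod (vec_index y i))\<^sup>2)"
  by (simp add: scalar_prod_def atLeast0LessThan complex_norm_square del: of_real_power)

text \<open>For non-negative \<open>A\<close> the form is real, so the real part taken in
  \<open>form_measure\<close> loses nothing.\<close>

lemma polarization_nonneg_herm:
  assumes A: "A \<in> carrier_mat q q" "nonneg_herm A" and jk: "j < q" "k < q"
  shows "A $$ (j, k) = 1 / 4 * (\<Sum>r<4::nat. (- \<i>) ^ r *
    of_real (mform A (unit_vec q j + (\<i> ^ r) \<cdot>\<^sub>v unit_vec q k)))"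
proof -
  have "(A *\<^sub>v x) \<bullet>c x = of_real (mform A x)" if x: "x \<in> carrier_vec q" for x
  proof -
    obtain C where C: "C \<in> carrier_mat q q" "A = mat_adjoint C * C" using nonneg_herm_factor[OF A(2,1)] .
    have "A *\<^sub>v x = mat_adjoint C *\<^sub>v (C *\<^sub>v x)"
      unfolding C(2) by (rule assoc_mult_mat_vec[of _ q q _ q]) (use C x in auto)
    then have "(A *\<^sub>v x) \<bullet>c x = (C *\<^sub>v x) \<bullet>c (C *\<^sub>v x)" using C x by (simp add: adjoint_inner)
    also have "\<dots> = of_real (Re \<dots>)"
      unfolding cscalar_prod_self by simp
    finally show ?thesis by (simp add: mform_def \<open>(A *\<^sub>v x) \<bullet>c x = (C *\<^sub>v x) \<bullet>c (C *\<^sub>v x)\<close>)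
  qed
  then show ?thesis by (subst polarization[OF A(1) jk]) simp
qed

section \<open>The scalar measures \<open>x\<^sup>* \<sigma> x\<close>\<close>

abbreviation half_line :: "real \<Rightarrow> real measure" where
  "half_line \<alpha> \<equiv> restrict_space borel {\<alpha>..}"

lemma space_half_line [simp]: "space (half_line \<alpha>) = {\<alpha>..}"
  by (simp add: space_restrict_space)

lemma space_form_measure [simp]: "space (form_measure \<alpha> \<sigma> x) = {\<alpha>..}"
  unfolding form_measure_def by (rule space_measure_of) (use sets.sets_into_space[of _ "half_line \<alpha>"] in \<open>auto simp: half_line_sets_def\<close>)

lemma sets_form_measure [simp]: "sets (form_measure \<alpha> \<sigma> x) = sets (half_line \<alpha>)"
  unfolding form_measure_def half_line_sets_def
  by (metis sets.sets_measure_of_eq space_half_line)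

lemma measurable_form_measure [simp]: "measurable (form_measure \<alpha> \<sigma> x) M = measurable (half_line \<alpha>) M"
  by (rule measurable_cong_sets) simp_all

text \<open>\<open>measure_of\<close> returns the prescribed values only for a countably additive
  set function; here this is derived from the entrywise additivity of \<open>\<sigma>\<close> and
  the non-negativity of its values.\<close>

lemma
  assumes \<sigma>: "nonneg_herm_measure q \<alpha> \<sigma>" and x: "x \<in> carrier_vec q"
  shows emeasure_form_measure: "B \<in> sets (half_line \<alpha>) \<Longrightarrow> emeasure (form_measure \<alpha> \<sigma> x) B = ennreal (mform (\<sigma> B) x)"
    and finite_form_measure: "finite_measure (form_measure \<alpha> \<sigma> x)"
    and measure_form_measure: "B \<in> sets (half_line \<alpha>) \<Longrightarrow> measure (form_measure \<alpha> \<sigma> x) B = mform (\<sigma> B) x"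
proof -
  have \<sigma>1: "\<sigma> B \<in> carrier_mat q q" "nonneg_herm (\<sigma> B)" if "B \<in> sets (half_line \<alpha>)" for B
    using \<sigma> that by (auto simp: nonneg_herm_measure_def half_line_sets_def)
  have \<sigma>2: "(\<lambda>n. mform (\<sigma> (B n)) x) sums mform (\<sigma> (\<Union>n. B n)) x"
    if B: "range B \<subseteq> sets (half_line \<alpha>)" "disjoint_family B" for B :: "nat \<Rightarrow> real set"
  proof (rule mform_sums[OF _ x])
    show "\<sigma> (\<Union>n. B n) \<in> carrier_mat q q" using B by (intro \<sigma>1) auto
    show "\<sigma> (B n) \<in> carrier_mat q q" for n using B by (intro \<sigma>1) auto
  qed (use \<sigma> B in \<open>auto simp: nonneg_herm_measure_def half_line_sets_def\<close>)
  have nn: "0 \<le> mform (\<sigma> B) x" if "B \<in> sets (half_line \<alpha>)" for B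
    using mform_nonneg[OF \<sigma>1(2,1) x] that by simp
  have 0: "mform (\<sigma> {}) x = 0"
  proof -
    \<comment> \<open>The empty set is repeated infinitely often: a convergent series with constant
      terms has terms zero.\<close>
    have "(\<lambda>n. mform (\<sigma> {}) x) sums mform (\<sigma> {}) x"
      using \<sigma>2[of "\<lambda>_. {}"] by (simp add: disjoint_family_on_def)
    then show ?thesis using summable_const_iff sums_summable by blast
  qed
  show em: "emeasure (form_measure \<alpha> \<sigma> x) B = ennreal (mform (\<sigma> B) x)" if B: "B \<in> sets (half_line \<alpha>)" for B
    unfolding form_measure_def mform_def[symmetric]
  proof (rule emeasure_measure_of_sigma)
    show "sigma_algebra {\<alpha>..} (half_line_sets \<alpha>)"
      using sets.sigma_algebra_axioms[of "half_line \<alpha>"] by (simp add: half_line_sets_def)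
    show "positive (half_line_sets \<alpha>) (\<lambda>B. ennreal (mform (\<sigma> B) x))" by (simp add: positive_def 0)
    show "countably_additive (half_line_sets \<alpha>) (\<lambda>B. ennreal (mform (\<sigma> B) x))"
    proof (rule countably_additiveI)
      fix A :: "nat \<Rightarrow> real set" assume A: "range A \<subseteq> half_line_sets \<alpha>" "disjoint_family A" "\<Union> (range A) \<in> half_line_sets \<alpha>"
      have "(\<lambda>n. ennreal (mform (\<sigma> (A n)) x)) sums ennreal (mform (\<sigma> (\<Union>n. A n)) x)"
        using \<sigma>2[of A] A nn by (subst sums_ennreal) (auto simp: half_line_sets_def)
      then show "(\<Sum>n. ennreal (mform (\<sigma> (A n)) x)) = ennreal (mform (\<sigma> (\<Union> (range A))) x)"
        by (simp add: sums_iff)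
    qed
    show "B \<in> half_line_sets \<alpha>" using B by (simp add: half_line_sets_def)
  qed
  have "{\<alpha>..} \<in> sets (half_line \<alpha>)" using sets.top[of "half_line \<alpha>"] by simp
  then show "finite_measure (form_measure \<alpha> \<sigma> x)" by (intro finite_measureI) (simp add: em)
  show "measure (form_measure \<alpha> \<sigma> x) B = mform (\<sigma> B) x" if B: "B \<in> sets (half_line \<alpha>)" for B
    using em[OF B] nn[OF B] by (simp add: measure_def)
qed

abbreviation polar_vec :: "nat \<Rightarrow> nat \<Rightarrow> nat \<Rightarrow> nat \<Rightarrow> complex vec" where
  "polar_vec q j k r \<equiv> unit_vec q j + (\<i> ^ r) \<cdot>\<^sub>v unit_vec q k"

lemma mat_integral_carrier [simp]: "mat_integral q \<alpha> \<sigma> f \<in> carrier_mat q q"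
  by (simp add: mat_integral_def)

lemma mat_integral_dims [simp]: "dim_row (mat_integral q \<alpha> \<sigma> f) = q" "dim_col (mat_integral q \<alpha> \<sigma> f) = q"
  by (simp_all add: mat_integral_def)

lemma index_mat_integral:
  "j < q \<Longrightarrow> k < q \<Longrightarrow> mat_integral q \<alpha> \<sigma> f $$ (j, k) =
    1 / 4 * (\<Sum>r<4::nat. (- \<i>) ^ r * integral\<^sup>L (form_measure \<alpha> \<sigma> (polar_vec q j k r)) f)"
  by (simp add: mat_integral_def)

lemma mat_integrableD: "mat_integrable q \<alpha> \<sigma> f \<Longrightarrow> integrable (form_measure \<alpha> \<sigma> (polar_vec q j k r)) f"
  by (simp add: mat_integrable_def)

lemma mat_integral_cong:
  "(\<And>t. \<alpha> \<le> t \<Longrightarrow> f t = g t) \<Longrightarrow> mat_integral q \<alpha> \<sigma> f = mat_integral q \<alpha> \<sigma> g"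
  by (rule eq_matI) (auto simp: index_mat_integral intro!: arg_cong2[where f = "(*)"] sum.cong Bochner_Integration.integral_cong)

lemma mat_integrable_cong:
  assumes "\<And>t. \<alpha> \<le> t \<Longrightarrow> f t = g t"
  shows "mat_integrable q \<alpha> \<sigma> f \<longleftrightarrow> mat_integrable q \<alpha> \<sigma> g"
  unfolding mat_integrable_def by (intro ball_cong refl Bochner_Integration.integrable_cong) (use assms in auto)

lemma mat_integral_add:
  assumes "mat_integrable q \<alpha> \<sigma> f" "mat_integrable q \<alpha> \<sigma> g"
  shows "mat_integral q \<alpha> \<sigma> (\<lambda>t. f t + g t) = mat_integral q \<alpha> \<sigma> f + mat_integral q \<alpha> \<sigma> g"
  by (rule eq_matI)
    (simp_all add: index_mat_integral mat_integrableD assms sum.distrib distrib_left add_divide_distrib)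

lemma mat_integral_mult:
  assumes "mat_integrable q \<alpha> \<sigma> f"
  shows "mat_integral q \<alpha> \<sigma> (\<lambda>t. c * f t) = c \<cdot>\<^sub>m mat_integral q \<alpha> \<sigma> f"
  by (rule eq_matI) (simp_all add: index_mat_integral sum_distrib_left mult_ac)

lemma mat_integrable_add:
  "mat_integrable q \<alpha> \<sigma> f \<Longrightarrow> mat_integrable q \<alpha> \<sigma> g \<Longrightarrow> mat_integrable q \<alpha> \<sigma> (\<lambda>t. f t + g t)"
  by (simp add: mat_integrable_def)

lemma mat_integrable_mult: "mat_integrable q \<alpha> \<sigma> f \<Longrightarrow> mat_integrable q \<alpha> \<sigma> (\<lambda>t. c * f t)"
  by (simp add: mat_integrable_def)

lemma mat_integrable_bound:
  assumes "mat_integrable q \<alpha> \<sigma> f" "g \<in> borel_measurable (half_line \<alpha>)"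
    and "\<And>t. \<alpha> \<le> t \<Longrightarrow> cmod (g t) \<le> C * cmod (f t)"
  shows "mat_integrable q \<alpha> \<sigma> g"
  unfolding mat_integrable_def
proof
  fix x :: "complex vec" assume "x \<in> carrier_vec q"
  then have "integrable (form_measure \<alpha> \<sigma> x) (\<lambda>t. of_real C * f t)" using assms(1) by (simp add: mat_integrable_def)
  then show "integrable (form_measure \<alpha> \<sigma> x) g"
  proof (rule Bochner_Integration.integrable_bound)
    show "AE t in form_measure \<alpha> \<sigma> x. cmod (g t) \<le> cmod (of_real C * f t)"
    proof (rule AE_I2)
      fix t assume "t \<in> space (form_measure \<alpha> \<sigma> x)"
      then have "cmod (g t) \<le> C * cmod (f t)" using assms(3) by simp
      also have "\<dots> \<le> \<bar>C\<bar> * cmod (f t)" by (intro mult_right_mono) auto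
      finally show "cmod (g t) \<le> cmod (of_real C * f t)" by (simp add: norm_mult)
    qed
  qed (use assms(2) in simp)
qed

text \<open>On simple functions the polarization hidden in \<open>mat_integral\<close> is undone and
  the entries of \<open>\<sigma>\<close> reappear.\<close>

lemma mat_integral_indicators:
  assumes \<sigma>: "nonneg_herm_measure q \<alpha> \<sigma>" and L: "finite L" "\<And>l. l \<in> L \<Longrightarrow> B l \<in> sets (half_line \<alpha>)"
  shows "mat_integral q \<alpha> \<sigma> (\<lambda>t. \<Sum>l\<in>L. indicator (B l) t * c l) = mat_sum q (\<lambda>l. c l \<cdot>\<^sub>m \<sigma> (B l)) L"
proof (rule eq_matI)
  have \<sigma>1: "\<sigma> B \<in> carrier_mat q q" "nonneg_herm (\<sigma> B)" if "B \<in> sets (half_line \<alpha>)" for B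
    using \<sigma> that by (auto simp: nonneg_herm_measure_def half_line_sets_def)
  fix j k assume "j < dim_row (mat_sum q (\<lambda>l. c l \<cdot>\<^sub>m \<sigma> (B l)) L)" "k < dim_col (mat_sum q (\<lambda>l. c l \<cdot>\<^sub>m \<sigma> (B l)) L)"
  then have jk: "j < q" "k < q" by auto
  have int: "integral\<^sup>L (form_measure \<alpha> \<sigma> x) (\<lambda>t. \<Sum>l\<in>L. indicator (B l) t * c l) = (\<Sum>l\<in>L. of_real (mform (\<sigma> (B l)) x) * c l)"
    if x: "x \<in> carrier_vec q" for x
  proof -
    interpret finite_measure "form_measure \<alpha> \<sigma> x" by (rule finite_form_measure[OF \<sigma> x])
    have "integral\<^sup>L (form_measure \<alpha> \<sigma> x) (\<lambda>t. \<Sum>l\<in>L. indicator (B l) t * c l)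
      = integral\<^sup>L (form_measure \<alpha> \<sigma> x) (\<lambda>t. \<Sum>l\<in>L. indicat_real (B l) t *\<^sub>R c l)"
      by (intro Bochner_Integration.integral_cong sum.cong refl) (auto simp: indicator_def)
    also have "\<dots> = (\<Sum>l\<in>L. integral\<^sup>L (form_measure \<alpha> \<sigma> x) (\<lambda>t. indicat_real (B l) t *\<^sub>R c l))"
      by (intro Bochner_Integration.integral_sum integrable_scaleR_left integrable_real_indicator) (use L in \<open>auto simp: emeasure_finite less_top[symmetric]\<close>)
    also have "\<dots> = (\<Sum>l\<in>L. of_real (mform (\<sigma> (B l)) x) * c l)"
    proof (rule sum.cong[OF refl])
      fix l assume l: "l \<in> L"
      have "integral\<^sup>L (form_measure \<alpha> \<sigma> x) (\<lambda>t. indicat_real (B l) t *\<^sub>R c l) = measure (form_measure \<alpha> \<sigma> x) (B l) *\<^sub>R c l"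
        using L(2)[OF l] by (subst has_bochner_integral_integral_eq[OF has_bochner_integral_indicator]) (auto simp: emeasure_finite less_top[symmetric])
      then show "integral\<^sup>L (form_measure \<alpha> \<sigma> x) (\<lambda>t. indicat_real (B l) t *\<^sub>R c l) = of_real (mform (\<sigma> (B l)) x) * c l"
        using measure_form_measure[OF \<sigma> x L(2)[OF l]] by (simp add: scaleR_conv_of_real)
    qed
    finally show ?thesis .
  qed
  have "mat_integral q \<alpha> \<sigma> (\<lambda>t. \<Sum>l\<in>L. indicator (B l) t * c l) $$ (j, k)
    = (\<Sum>l\<in>L. c l * (1 / 4 * (\<Sum>r<4::nat. (- \<i>) ^ r * of_real (mform (\<sigma> (B l)) (polar_vec q j k r)))))"
  proof -
    have "(\<Sum>r<4::nat. (- \<i>) ^ r * (\<Sum>l\<in>L. of_real (mform (\<sigma> (B l)) (polar_vec q j k r)) * c l))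
      = (\<Sum>l\<in>L. \<Sum>r<4::nat. (- \<i>) ^ r * (of_real (mform (\<sigma> (B l)) (polar_vec q j k r)) * c l))"
      unfolding sum_distrib_left by (rule sum.swap)
    then show ?thesis
      by (subst index_mat_integral[OF jk], subst int) (simp_all add: sum_distrib_left mult_ac)
  qed
  also have "\<dots> = (\<Sum>l\<in>L. c l * \<sigma> (B l) $$ (j, k))"
    using L \<sigma>1 jk by (intro sum.cong refl) (simp add: polarization_nonneg_herm[of _ q j k])
  finally show "mat_integral q \<alpha> \<sigma> (\<lambda>t. \<Sum>l\<in>L. indicator (B l) t * c l) $$ (j, k) = mat_sum q (\<lambda>l. c l \<cdot>\<^sub>m \<sigma> (B l)) L $$ (j, k)"
    using jk L \<sigma>1 by (simp add: index_mat_sum carrier_matD[OF \<sigma>1(1)])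
qed simp_all

section \<open>Non-negativity of Gram matrices of functions\<close>

lemma nonneg_herm_cnj:
  assumes "nonneg_herm A" "A \<in> carrier_mat q q" "i < q" "j < q"
  shows "cnj (A $$ (j, i)) = A $$ (i, j)"
proof -
  have "dim_row A = q" "dim_col A = q" using assms(2) by auto
  then show ?thesis using index_adjoint[of i A j] nonneg_hermD(1)[OF assms(1,2)] assms(3,4) by simp
qed

lemma nonneg_herm_mat_sum:
  assumes "\<And>l. l \<in> L \<Longrightarrow> nonneg_herm (f l) \<and> f l \<in> carrier_mat q q"
  shows "nonneg_herm (mat_sum q f L)"
proof (rule nonneg_hermI)
  show "mat_adjoint (mat_sum q f L) = mat_sum q f L"
  proof (rule eq_matI)
    fix i j assume "i < dim_row (mat_sum q f L)" "j < dim_col (mat_sum q f L)"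
    then have ij: "i < q" "j < q" by auto
    have "cnj (f l $$ (j, i)) = f l $$ (i, j)" if "l \<in> L" for l
      using assms[OF that] ij by (intro nonneg_herm_cnj[of _ q]) auto
    then show "mat_adjoint (mat_sum q f L) $$ (i, j) = mat_sum q f L $$ (i, j)"
      using ij by (simp add: index_mat_sum)
  qed auto
  fix x :: "nat \<Rightarrow> complex"
  have "(\<Sum>i<q. \<Sum>j<q. cnj (x i) * mat_sum q f L $$ (i, j) * x j)
      = (\<Sum>i<q. \<Sum>j<q. \<Sum>l\<in>L. cnj (x i) * f l $$ (i, j) * x j)"
    by (intro sum.cong refl) (simp add: index_mat_sum sum_distrib_left sum_distrib_right)
  also have "\<dots> = (\<Sum>i<q. \<Sum>l\<in>L. \<Sum>j<q. cnj (x i) * f l $$ (i, j) * x j)"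
    by (intro sum.cong refl sum.swap)
  also have "\<dots> = (\<Sum>l\<in>L. \<Sum>i<q. \<Sum>j<q. cnj (x i) * f l $$ (i, j) * x j)" by (rule sum.swap)
  finally have "Re (\<Sum>i<q. \<Sum>j<q. cnj (x i) * mat_sum q f L $$ (i, j) * x j)
      = (\<Sum>l\<in>L. Re (\<Sum>i<q. \<Sum>j<q. cnj (x i) * f l $$ (i, j) * x j))" by simp
  also have "\<dots> \<ge> 0" by (intro sum_nonneg nonneg_hermD(2)) (use assms in auto)
  finally show "0 \<le> Re (\<Sum>i<q. \<Sum>j<q. cnj (x i) * mat_sum q f L $$ (i, j) * x j)" .
qed simp

lemma nonneg_herm_limit:
  assumes "\<And>n. nonneg_herm (M n)" "\<And>n. M n \<in> carrier_mat q q" "A \<in> carrier_mat q q"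
    and lim: "\<And>i j. i < q \<Longrightarrow> j < q \<Longrightarrow> (\<lambda>n. M n $$ (i, j)) \<longlonglongrightarrow> A $$ (i, j)"
  shows "nonneg_herm A"
proof (rule nonneg_hermI[OF assms(3)])
  show "mat_adjoint A = A"
  proof (rule eq_matI)
    fix i j assume "i < dim_row A" "j < dim_col A"
    then have ij: "i < q" "j < q" using assms(3) by auto
    have "cnj (M n $$ (j, i)) = M n $$ (i, j)" for n
      using ij by (intro nonneg_herm_cnj[OF assms(1,2)])
    then have "(\<lambda>n. M n $$ (i, j)) \<longlonglongrightarrow> cnj (A $$ (j, i))" using tendsto_cnj[OF lim[OF ij(2,1)]] by simp
    then have "cnj (A $$ (j, i)) = A $$ (i, j)" using LIMSEQ_unique lim[OF ij] by blast
    then show "mat_adjoint A $$ (i, j) = A $$ (i, j)" using ij assms(3) by simp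
  qed (use assms(3) in auto)
  fix x :: "nat \<Rightarrow> complex"
  have "(\<lambda>n. Re (\<Sum>i<q. \<Sum>j<q. cnj (x i) * M n $$ (i, j) * x j)) \<longlonglongrightarrow> Re (\<Sum>i<q. \<Sum>j<q. cnj (x i) * A $$ (i, j) * x j)"
    by (intro tendsto_intros lim) auto
  then show "0 \<le> Re (\<Sum>i<q. \<Sum>j<q. cnj (x i) * A $$ (i, j) * x j)"
    by (rule LIMSEQ_le_const) (use nonneg_hermD(2)[OF assms(1,2)] in blast)
qed

text \<open>On a common level set \<open>B l\<close> of all functions the products are constant, so
  the Gram matrix is a finite sum of congruences \<open>Y\<^sup>* \<sigma> (B l) Y\<close> of
  non-negative matrices.\<close>

lemma nonneg_herm_simple_gram:
  assumes \<sigma>: "nonneg_herm_measure q \<alpha> \<sigma>"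
    and s: "\<And>a. a < K \<Longrightarrow> simple_function (half_line \<alpha>) (s a)"
  shows "nonneg_herm (blocks q K (\<lambda>a b. mat_integral q \<alpha> \<sigma> (\<lambda>t. cnj (s a t) * s b t)))"
proof -
  \<comment> \<open>The list of all function values at \<open>t\<close>. Its finitely many values
    index the partition into common level sets.\<close>
  define h where "h t = map (\<lambda>a. s a t) [0..<K]" for t
  define L where "L = h ` {\<alpha>..}"
  define B where "B l = {t \<in> {\<alpha>..}. h t = l}" for l
  have fin: "finite L"
  proof (rule finite_subset)
    show "L \<subseteq> {l. set l \<subseteq> (\<Union>a<K. s a ` {\<alpha>..}) \<and> length l = K}" by (fastforce simp: L_def h_def)
    show "finite {l. set l \<subseteq> (\<Union>a<K. s a ` {\<alpha>..}) \<and> length l = K}"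
      using simple_functionD(1)[OF s] by (intro finite_lists_length_eq) simp
  qed
  have BM: "B l \<in> sets (half_line \<alpha>)" if "l \<in> L" for l
  proof -
    have len: "length l = K" using that by (auto simp: L_def h_def)
    have pre: "s a -` {l ! a} \<inter> {\<alpha>..} \<in> sets (half_line \<alpha>)" if "a < K" for a
      using simple_functionD(2)[OF s[OF that], of "{l ! a}"] by simp
    show ?thesis
    proof (cases "K = 0")
      case True
      then have "B l = {\<alpha>..}" using len by (auto simp: B_def h_def)
      then show ?thesis using sets.top[of "half_line \<alpha>"] by simp
    next
      case False
      then have "B l = (\<Inter>a\<in>{..<K}. s a -` {l ! a} \<inter> {\<alpha>..})"
        using len by (auto simp: B_def h_def list_eq_iff_nth_eq)
      then show ?thesis using pre False by (simp only:) (intro sets.finite_INT; force)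
    qed
  qed
  have \<sigma>1: "\<sigma> (B l) \<in> carrier_mat q q" "nonneg_herm (\<sigma> (B l))" if "l \<in> L" for l
    using \<sigma> BM[OF that] by (auto simp: nonneg_herm_measure_def half_line_sets_def)
  have eq: "mat_integral q \<alpha> \<sigma> (\<lambda>t. cnj (s a t) * s b t) = mat_sum q (\<lambda>l. (cnj (l ! a) * l ! b) \<cdot>\<^sub>m \<sigma> (B l)) L"
    if "a < K" "b < K" for a b
  proof -
    have "mat_integral q \<alpha> \<sigma> (\<lambda>t. cnj (s a t) * s b t)
        = mat_integral q \<alpha> \<sigma> (\<lambda>t. \<Sum>l\<in>L. indicator (B l) t * (cnj (l ! a) * l ! b))"
    proof (rule mat_integral_cong)
      fix t assume t: "\<alpha> \<le> t"
      have "(\<Sum>l\<in>L. indicator (B l) t * (cnj (l ! a) * l ! b)) = (\<Sum>l\<in>L. if l = h t then cnj (l ! a) * l ! b else 0)"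
        by (intro sum.cong refl) (use t in \<open>auto simp: B_def indicator_def\<close>)
      also have "\<dots> = cnj (h t ! a) * h t ! b" using t fin by (simp add: L_def)
      finally show "cnj (s a t) * s b t = (\<Sum>l\<in>L. indicator (B l) t * (cnj (l ! a) * l ! b))"
        using that by (simp add: h_def)
    qed
    then show ?thesis using mat_integral_indicators[OF \<sigma> fin BM] by simp
  qed
  define Y where "Y l = hcat q q (\<lambda>a. (l ! a) \<cdot>\<^sub>m 1\<^sub>m q) K" for l :: "complex list"
  have "blocks q K (\<lambda>a b. mat_integral q \<alpha> \<sigma> (\<lambda>t. cnj (s a t) * s b t))
      = mat_sum (K * q) (\<lambda>l. mat_adjoint (Y l) * \<sigma> (B l) * Y l) L"
  proof (rule eq_matI)
    fix i j assume "i < dim_row (mat_sum (K * q) (\<lambda>l. mat_adjoint (Y l) * \<sigma> (B l) * Y l) L)"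
      "j < dim_col (mat_sum (K * q) (\<lambda>l. mat_adjoint (Y l) * \<sigma> (B l) * Y l) L)"
    then have ij: "i < K * q" "j < K * q" by auto
    note dm = div_mod_bound[OF ij(1)] div_mod_bound[OF ij(2)]
    have "(mat_adjoint (Y l) * \<sigma> (B l) * Y l) $$ (i, j) = (cnj (l ! (i div q)) * l ! (j div q)) * \<sigma> (B l) $$ (i mod q, j mod q)"
      if l: "l \<in> L" for l
    proof -
      have "\<sigma> (B l) * Y l = hcat q q (\<lambda>b. \<sigma> (B l) * ((l ! b) \<cdot>\<^sub>m 1\<^sub>m q)) K"
        unfolding Y_def using \<sigma>1[OF l] by (intro mult_hcat) auto
      then have "mat_adjoint (Y l) * \<sigma> (B l) * Y l
          = mat_adjoint (hcat q q (\<lambda>a. (l ! a) \<cdot>\<^sub>m 1\<^sub>m q) K) * hcat q q (\<lambda>b. \<sigma> (B l) * ((l ! b) \<cdot>\<^sub>m 1\<^sub>m q)) K"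
        using \<sigma>1[OF l] by (simp add: mat_assoc Y_def)
      also have "\<dots> = blocks q K (\<lambda>a b. mat_adjoint ((l ! a) \<cdot>\<^sub>m 1\<^sub>m q) * (\<sigma> (B l) * ((l ! b) \<cdot>\<^sub>m 1\<^sub>m q)))"
        using \<sigma>1[OF l] by (intro adjoint_hcat_mult_hcat) auto
      also have "\<dots> = blocks q K (\<lambda>a b. (cnj (l ! a) * l ! b) \<cdot>\<^sub>m \<sigma> (B l))"
        using \<sigma>1[OF l] by (intro blocks_cong refl) (auto intro!: eq_matI simp: mat_simps)
      finally show ?thesis using ij dm \<sigma>1[OF l] by (simp add: blocks_def)
    qed
    moreover have "mat_sum q (\<lambda>l. (cnj (l ! a) * l ! b) \<cdot>\<^sub>m \<sigma> (B l)) L $$ (i mod q, j mod q)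
        = (\<Sum>l\<in>L. (cnj (l ! a) * l ! b) * \<sigma> (B l) $$ (i mod q, j mod q))" for a b
      using dm \<sigma>1 by (simp add: index_mat_sum carrier_matD[OF \<sigma>1(1)])
    ultimately show "blocks q K (\<lambda>a b. mat_integral q \<alpha> \<sigma> (\<lambda>t. cnj (s a t) * s b t)) $$ (i, j)
        = mat_sum (K * q) (\<lambda>l. mat_adjoint (Y l) * \<sigma> (B l) * Y l) L $$ (i, j)"
      using ij dm by (simp add: index_mat_sum blocks_def eq)
  qed simp_all
  moreover have "nonneg_herm (mat_sum (K * q) (\<lambda>l. mat_adjoint (Y l) * \<sigma> (B l) * Y l) L)"
  proof (intro nonneg_herm_mat_sum conjI)
    fix l assume "l \<in> L"
    then show "nonneg_herm (mat_adjoint (Y l) * \<sigma> (B l) * Y l)"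
      by (intro nonneg_herm_congruence[of _ q _ "K * q"] \<sigma>1) (simp_all add: Y_def)
  qed (simp add: Y_def)
  ultimately show ?thesis by (simp only:)
qed

lemma borel_measurable_cnj [measurable]:
  "f \<in> borel_measurable M \<Longrightarrow> (\<lambda>x. cnj (f x)) \<in> borel_measurable M"
  by (rule measurable_compose[OF _ borel_measurable_continuous_onI]) (auto intro: continuous_intros)

text \<open>Each \<open>f a\<close> is approximated by simple functions of modulus at most
  \<open>2 * cmod (f a t)\<close>. The products are dominated with the factor \<open>4\<close>, so
  dominated convergence carries non-negativity to the limit.\<close>

lemma nonneg_herm_function_gram:
  assumes \<sigma>: "nonneg_herm_measure q \<alpha> \<sigma>"
    and f: "\<And>a. a < K \<Longrightarrow> f a \<in> borel_measurable (half_line \<alpha>)"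
    and int: "\<And>a b. a < K \<Longrightarrow> b < K \<Longrightarrow> mat_integrable q \<alpha> \<sigma> (\<lambda>t. cnj (f a t) * f b t)"
  shows "nonneg_herm (blocks q K (\<lambda>a b. mat_integral q \<alpha> \<sigma> (\<lambda>t. cnj (f a t) * f b t)))"
proof -
  have "\<exists>S. \<forall>a<K. (\<forall>i. simple_function (half_line \<alpha>) (S a i)) \<and> (\<forall>t\<ge>\<alpha>. (\<lambda>i. S a i t) \<longlonglongrightarrow> f a t) \<and>
      (\<forall>i. \<forall>t\<ge>\<alpha>. dist (S a i t) 0 \<le> 2 * dist (f a t) 0)"
  proof (rule choice, rule allI)
    fix a
    show "\<exists>Sa. a < K \<longrightarrow> (\<forall>i. simple_function (half_line \<alpha>) (Sa i)) \<and> (\<forall>t\<ge>\<alpha>. (\<lambda>i. Sa i t) \<longlonglongrightarrow> f a t) \<and>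
      (\<forall>i. \<forall>t\<ge>\<alpha>. dist (Sa i t) 0 \<le> 2 * dist (f a t) 0)"
    proof (cases "a < K")
      case True
      show ?thesis using borel_measurable_implies_sequence_metric[OF f[OF True], of 0]
        unfolding space_half_line Ball_def atLeast_iff by metis
    qed simp
  qed
  then obtain S where S: "\<And>a i. a < K \<Longrightarrow> simple_function (half_line \<alpha>) (S a i)"
    "\<And>a t. a < K \<Longrightarrow> \<alpha> \<le> t \<Longrightarrow> (\<lambda>i. S a i t) \<longlonglongrightarrow> f a t"
    "\<And>a i t. a < K \<Longrightarrow> \<alpha> \<le> t \<Longrightarrow> cmod (S a i t) \<le> 2 * cmod (f a t)"
    unfolding dist_0_norm dist_commute[of _ 0] by metis
  have lim: "(\<lambda>i. integral\<^sup>L (form_measure \<alpha> \<sigma> x) (\<lambda>t. cnj (S a i t) * S b i t))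
      \<longlonglongrightarrow> integral\<^sup>L (form_measure \<alpha> \<sigma> x) (\<lambda>t. cnj (f a t) * f b t)"
    if ab: "a < K" "b < K" and x: "x \<in> carrier_vec q" for a b x
  proof (rule integral_dominated_convergence[where w = "\<lambda>t. 4 * cmod (cnj (f a t) * f b t)"])
    note [measurable] = f[OF ab(1)] f[OF ab(2)]
    have [measurable]: "S a i \<in> borel_measurable (half_line \<alpha>)" "S b i \<in> borel_measurable (half_line \<alpha>)" for i
      using S(1) ab by (auto intro: borel_measurable_simple_function)
    show "(\<lambda>t. cnj (f a t) * f b t) \<in> borel_measurable (form_measure \<alpha> \<sigma> x)" by simp measurable
    show "(\<lambda>t. cnj (S a i t) * S b i t) \<in> borel_measurable (form_measure \<alpha> \<sigma> x)" for i by simp measurable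
    show "integrable (form_measure \<alpha> \<sigma> x) (\<lambda>t. 4 * cmod (cnj (f a t) * f b t))"
      using int[OF ab] x by (auto simp: mat_integrable_def intro!: integrable_norm)
    show "AE t in form_measure \<alpha> \<sigma> x. (\<lambda>i. cnj (S a i t) * S b i t) \<longlonglongrightarrow> cnj (f a t) * f b t"
      by (rule AE_I2) (auto intro!: tendsto_intros S ab)
    show "AE t in form_measure \<alpha> \<sigma> x. cmod (cnj (S a i t) * S b i t) \<le> 4 * cmod (cnj (f a t) * f b t)" for i
    proof (rule AE_I2)
      fix t assume "t \<in> space (form_measure \<alpha> \<sigma> x)"
      then have t: "\<alpha> \<le> t" by simp
      have "cmod (S a i t) * cmod (S b i t) \<le> (2 * cmod (f a t)) * (2 * cmod (f b t))"
        by (intro mult_mono S t ab) auto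
      then show "cmod (cnj (S a i t) * S b i t) \<le> 4 * cmod (cnj (f a t) * f b t)" by (simp add: norm_mult)
    qed
  qed
  show ?thesis
  proof (rule nonneg_herm_limit[where q = "K * q" and M = "\<lambda>i. blocks q K (\<lambda>a b. mat_integral q \<alpha> \<sigma> (\<lambda>t. cnj (S a i t) * S b i t))"])
    show "nonneg_herm (blocks q K (\<lambda>a b. mat_integral q \<alpha> \<sigma> (\<lambda>t. cnj (S a i t) * S b i t)))" for i
      by (rule nonneg_herm_simple_gram[OF \<sigma> S(1)])
    fix i j assume ij: "i < K * q" "j < K * q"
    note dm = div_mod_bound[OF ij(1)] div_mod_bound[OF ij(2)]
    show "(\<lambda>n. blocks q K (\<lambda>a b. mat_integral q \<alpha> \<sigma> (\<lambda>t. cnj (S a n t) * S b n t)) $$ (i, j))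
        \<longlonglongrightarrow> blocks q K (\<lambda>a b. mat_integral q \<alpha> \<sigma> (\<lambda>t. cnj (f a t) * f b t)) $$ (i, j)"
      using ij dm by (simp add: blocks_def index_mat_integral) (intro tendsto_intros lim dm; simp)
  qed simp_all
qed

section \<open>Uniqueness of the solution\<close>

lemma open_slit_plane: "open (slit_plane \<alpha>)"
proof -
  have "complex_of_real ` {\<alpha>..} = {z. \<alpha> \<le> Re z} \<inter> {z. Im z = 0}"
    by (auto simp: image_iff complex_eq_iff)
  then have "closed (complex_of_real ` {\<alpha>..})"
    by (simp only:) (intro closed_Int closed_Collect_le closed_Collect_eq continuous_intros)
  then show ?thesis by (simp add: slit_plane_def open_Compl)
qed

text \<open>The slit plane is star-shaped about \<open>\<alpha> - 1\<close>: a segment from there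
  reaches the ray only if its endpoint already lies on the ray.\<close>

lemma connected_slit_plane: "connected (slit_plane \<alpha>)"
proof (rule starlike_imp_connected)
  let ?a = "complex_of_real (\<alpha> - 1)"
  show "starlike (slit_plane \<alpha>)" unfolding starlike_def
  proof (intro bexI[of _ ?a] ballI subsetI)
    fix x y assume x: "x \<in> slit_plane \<alpha>" and y: "y \<in> closed_segment ?a x"
    then obtain u where u: "0 \<le> u" "u \<le> 1" "y = (1 - u) *\<^sub>R ?a + u *\<^sub>R x" by (auto simp: closed_segment_def)
    show "y \<in> slit_plane \<alpha>"
    proof (rule ccontr)
      assume "y \<notin> slit_plane \<alpha>"
      then obtain t where t: "\<alpha> \<le> t" "y = of_real t" by (auto simp: slit_plane_def)
      have im: "u * Im x = 0" using arg_cong[OF u(3), of Im] t(2) by simp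
      have re: "t = (1 - u) * (\<alpha> - 1) + u * Re x" using arg_cong[OF u(3), of Re] t(2) by simp
      have "u \<noteq> 0" using re t(1) by auto
      then have "Im x = 0" using im by simp
      have "u \<le> u * (Re x - \<alpha> + 1)" using re t(1) u(2) by (simp add: algebra_simps)
      then have "1 \<le> Re x - \<alpha> + 1" using \<open>u \<noteq> 0\<close> u(1) by simp
      then have "x = complex_of_real (Re x)" "\<alpha> \<le> Re x" using \<open>Im x = 0\<close> by (auto simp: complex_eq_iff)
      then show False using x unfolding slit_plane_def by (metis ComplD atLeast_iff imageI)
    qed
  qed (auto simp: slit_plane_def simp del: of_real_diff)
qed

text \<open>A point off the closed ray has positive distance from it. The bound makes the Cauchy
  kernel harmless for integrability.\<close>

lemma slit_plane_dist:
  assumes "z \<in> slit_plane \<alpha>"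
  shows "\<exists>C. \<forall>t\<ge>\<alpha>. cmod (1 / (complex_of_real t - z)) \<le> C"
proof -
  obtain e where e: "e > 0" "ball z e \<subseteq> slit_plane \<alpha>" by (rule openE[OF open_slit_plane assms])
  have "cmod (1 / (complex_of_real t - z)) \<le> 1 / e" if "\<alpha> \<le> t" for t
  proof -
    have "complex_of_real t \<notin> ball z e" using e(2) that by (auto simp: slit_plane_def)
    then have "e \<le> cmod (complex_of_real t - z)" by (simp add: dist_norm norm_minus_commute)
    then show ?thesis using e(1) by (simp add: norm_divide divide_simps)
  qed
  then show ?thesis by blast
qed

text \<open>The matrix is the value at \<open>z\<close> of a monic matrix polynomial with lower
  coefficients from \<open>- X\<close>. For a kernel vector the leading term equals the lower ones,
  and comparing largest entries gives \<open>cmod z \<le> C\<close> unless the vector is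
  zero.\<close>

lemma det_monic_nonzero:
  fixes X :: "complex mat"
  assumes X: "X \<in> carrier_mat (n * q) q"
  obtains \<rho> where "\<And>z. \<rho> < cmod z \<Longrightarrow> Determinant.det (z ^ n \<cdot>\<^sub>m 1\<^sub>m q - hcat q q (\<lambda>b. z ^ b \<cdot>\<^sub>m 1\<^sub>m q) n * X) \<noteq> 0"
proof -
  define C where "C = (\<Sum>c<n * q. \<Sum>k<q. cmod (X $$ (c, k)))"
  \<comment> \<open>The bound \<open>1\<close> makes the powers of \<open>cmod z\<close> increasing
    in the exponent.\<close>
  have "Determinant.det (z ^ n \<cdot>\<^sub>m 1\<^sub>m q - hcat q q (\<lambda>b. z ^ b \<cdot>\<^sub>m 1\<^sub>m q) n * X) \<noteq> 0" if z: "max 1 C < cmod z" for z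
  proof (rule det_nonzeroI)
    let ?H = "hcat q q (\<lambda>b. z ^ b \<cdot>\<^sub>m 1\<^sub>m q) n"
    fix V :: "complex mat" assume V: "V \<in> carrier_mat q 1" "(z ^ n \<cdot>\<^sub>m 1\<^sub>m q - ?H * X) * V = 0\<^sub>m q 1"
    have Vd [simp]: "dim_row V = q" "dim_col V = 1" using V(1) by auto
    have Xd [simp]: "dim_row X = n * q" "dim_col X = q" using X by auto
    define v where "v = Max (insert 0 ((\<lambda>i. cmod (V $$ (i, 0))) ` {..<q}))"
    have v: "cmod (V $$ (i, 0)) \<le> v" if "i < q" for i unfolding v_def using that by (intro Max_ge) auto
    have v0: "0 \<le> v" unfolding v_def by (intro Max_ge) auto
    have XV: "cmod ((X * V) $$ (c, 0)) \<le> (\<Sum>k<q. cmod (X $$ (c, k))) * v" if "c < n * q" for c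
    proof -
      have "(X * V) $$ (c, 0) = (\<Sum>k<q. X $$ (c, k) * V $$ (k, 0))"
        using that by (subst index_mult_sum) auto
      also have "cmod \<dots> \<le> (\<Sum>k<q. cmod (X $$ (c, k)) * cmod (V $$ (k, 0)))"
        by (rule order_trans[OF norm_sum]) (simp add: norm_mult)
      also have "\<dots> \<le> (\<Sum>k<q. cmod (X $$ (c, k)) * v)" by (intro sum_mono mult_left_mono v) auto
      finally show ?thesis by (simp add: sum_distrib_right)
    qed
    have bound: "cmod (V $$ (i, 0)) * cmod z \<le> C * v" if i: "i < q" for i
    proof -
      have "z ^ n * V $$ (i, 0) = (?H * (X * V)) $$ (i, 0)"
        using arg_cong[OF V(2), of "\<lambda>M. M $$ (i, 0)"] i by (simp add: mat_simps del: index_mult_mat(1))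
      also have "\<dots> = (\<Sum>c<n * q. ?H $$ (i, c) * (X * V) $$ (c, 0))" using i by (subst index_mult_sum) auto
      finally have "cmod (z ^ n * V $$ (i, 0)) \<le> (\<Sum>c<n * q. cmod (?H $$ (i, c)) * cmod ((X * V) $$ (c, 0)))"
        by (simp only:) (rule order_trans[OF norm_sum], simp add: norm_mult)
      also have "\<dots> \<le> (\<Sum>c<n * q. cmod z ^ (n - 1) * ((\<Sum>k<q. cmod (X $$ (c, k))) * v))"
      proof (intro sum_mono mult_mono XV)
        fix c assume "c \<in> {..<n * q}"
        then have c: "c < n * q" by simp
        note dm = div_mod_bound[OF c]
        have "cmod (?H $$ (i, c)) \<le> cmod z ^ (c div q)"
          using i c dm by (auto simp: hcat_def norm_mult norm_power)
        also have "\<dots> \<le> cmod z ^ (n - 1)" using dm z by (intro power_increasing) auto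
        finally show "cmod (?H $$ (i, c)) \<le> cmod z ^ (n - 1)" .
      qed auto
      also have "\<dots> = cmod z ^ (n - 1) * (C * v)" by (simp add: C_def sum_distrib_left sum_distrib_right)
      finally have le: "cmod z ^ n * cmod (V $$ (i, 0)) \<le> cmod z ^ (n - 1) * (C * v)" by (simp add: norm_mult norm_power)
      show ?thesis
      \<comment> \<open>For \<open>n = 0\<close> the exponent \<open>n - 1\<close> is truncated to
        \<open>0\<close>, but then \<open>C\<close> is an empty sum.\<close>
      proof (cases n)
        case 0
        then show ?thesis using le by (simp add: C_def)
      next
        case (Suc n')
        then have "cmod z ^ n' * (cmod (V $$ (i, 0)) * cmod z) \<le> cmod z ^ n' * (C * v)" using le by (simp add: mult_ac)
        moreover have "0 < cmod z ^ n'"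
          by (intro zero_less_power le_less_trans[OF _ z]) (simp add: le_max_iff_disj)
        ultimately show ?thesis by simp
      qed
    qed
    have "v = 0"
    proof (rule ccontr)
      assume "v \<noteq> 0"
      have "v \<in> insert 0 ((\<lambda>i. cmod (V $$ (i, 0))) ` {..<q})" unfolding v_def by (intro Max_in) auto
      then obtain i where "i < q" "v = cmod (V $$ (i, 0))" using \<open>v \<noteq> 0\<close> by auto
      then have "v * cmod z \<le> v * C" using bound by (simp add: mult.commute)
      then show False using z v0 \<open>v \<noteq> 0\<close> by simp
    qed
    then show "V = 0\<^sub>m q 1" using v by (intro eq_matI) auto
  qed (use X in auto)
  then show ?thesis by (rule that)
qed

text \<open>\<open>W\<close> stands for the model vectors and \<open>g\<close> for those of an
  arbitrary solution. Their Gram matrices agree outside the corner \<open>(n, n)\<close>, where only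
  an inequality is given. The residual \<open>e\<close> of the relation for \<open>g\<close>
  satisfies \<open>- e\<^sup>* e = W n\<^sup>* W n - g n\<^sup>* g n\<close>, which is non-negative,
  so \<open>e = 0\<close>.\<close>

lemma gram_kernel_transfer:
  assumes W: "\<And>a. a \<le> n \<Longrightarrow> W a \<in> carrier_mat N q" and X: "X \<in> carrier_mat (n * q) q"
    and Wn: "W n = hcat N q W n * X"
    and g: "\<And>a. a \<le> n \<Longrightarrow> g a \<in> carrier_mat N' q"
    and eq: "\<And>a b. a \<le> n \<Longrightarrow> b < n \<Longrightarrow> mat_adjoint (g a) * g b = mat_adjoint (W a) * W b"
    and le: "nonneg_herm (mat_adjoint (W n) * W n - mat_adjoint (g n) * g n)"
  shows "g n = hcat N' q g n * X"
proof -
  define G where "G = hcat N' q g n"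
  define V where "V = hcat N q W n"
  have [simp]: "dim_row G = N'" "dim_col G = n * q" "dim_row V = N" "dim_col V = n * q" by (simp_all add: G_def V_def)
  have [simp]: "dim_row (g n) = N'" "dim_col (g n) = q" "dim_row (W n) = N" "dim_col (W n) = q" "dim_row X = n * q" "dim_col X = q"
    using g[of n] W[of n] X by auto
  have GG: "mat_adjoint G * G = mat_adjoint V * V"
    unfolding G_def V_def using g W by (simp add: adjoint_hcat_mult_hcat eq cong: blocks_cong)
  have gG: "mat_adjoint (g n) * G = mat_adjoint (W n) * V"
    unfolding G_def V_def using g W by (simp add: mult_hcat[of _ q] eq cong: hcat_cong)
  have Gg: "mat_adjoint G * g n = mat_adjoint V * W n"
    using arg_cong[OF gG, of mat_adjoint] by (simp add: mat_simps)
  define e where "e = g n - G * X"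
  have edim [simp]: "dim_row e = N'" "dim_col e = q" by (simp_all add: e_def)
  define D where "D = mat_adjoint (W n) * V * X + (mat_adjoint X * (mat_adjoint V * W n) - mat_adjoint X * (mat_adjoint V * V * X))"
  have [simp]: "dim_row D = q" "dim_col D = q" by (simp_all add: D_def)
  have "mat_adjoint e * e = mat_adjoint (g n) * g n - (mat_adjoint (g n) * G * X
      + (mat_adjoint X * (mat_adjoint G * g n) - mat_adjoint X * (mat_adjoint G * G * X)))"
    by (auto intro!: eq_matI simp: e_def mat_simps simp del: index_mult_mat(1))
  then have ee: "mat_adjoint e * e = mat_adjoint (g n) * g n - D" unfolding gG Gg GG D_def .
  have "W n - V * X = 0\<^sub>m N q" using Wn unfolding V_def[symmetric] by (auto intro!: eq_matI)
  then have "mat_adjoint (W n - V * X) * (W n - V * X) = 0\<^sub>m q q" by simp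
  moreover have "mat_adjoint (W n - V * X) * (W n - V * X) = mat_adjoint (W n) * W n - D"
    by (auto intro!: eq_matI simp: D_def mat_simps simp del: index_mult_mat(1))
  ultimately have WW: "mat_adjoint (W n) * W n - D = 0\<^sub>m q q" by simp
  have "- (mat_adjoint e * e) = mat_adjoint (W n) * W n - mat_adjoint (g n) * g n"
  proof (rule eq_matI)
    fix i j assume "i < dim_row (mat_adjoint (W n) * W n - mat_adjoint (g n) * g n)"
      "j < dim_col (mat_adjoint (W n) * W n - mat_adjoint (g n) * g n)"
    then show "(- (mat_adjoint e * e)) $$ (i, j) = (mat_adjoint (W n) * W n - mat_adjoint (g n) * g n) $$ (i, j)"
      using arg_cong[OF WW, of "\<lambda>M. M $$ (i, j)"] unfolding ee
      by (simp del: index_mult_mat(1))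
  qed simp_all
  then have "nonneg_herm (- (mat_adjoint e * e))" using le by simp
  from adjoint_mult_self_eq_0D[OF this] have e0: "e = 0\<^sub>m N' q" by simp
  then have "g n = G * X" unfolding e_def by (rule mat_minus_eq_0D) simp_all
  then show ?thesis by (simp add: G_def)
qed

section \<open>The relation satisfied by every solution\<close>

lemma (in stieltjes_model) model_vec_gram:
  assumes "\<And>j. j \<le> m \<Longrightarrow> t j = s j" "a \<le> m div 2" "b \<le> m div 2"
  shows "mat_adjoint (model_vec \<alpha> m R B a) * model_vec \<alpha> m R B b = (if even m then t (a + b) else shift_seq \<alpha> t (a + b))"
proof (cases "even m")
  case True
  then have "a + b \<le> m" using assms(2,3) by (auto elim!: evenE)
  then show ?thesis using True assms(1) by (simp add: model_vec_def k_move)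
next
  case False
  then have "Suc (a + b) \<le> m" using assms(2,3) by (auto elim!: oddE)
  then show ?thesis using False assms(1)[of "a + b"] assms(1)[of "Suc (a + b)"] w_move[of a b]
    by (simp add: model_vec_def mat_simps S_def shift_seq_def w_eq)
qed

text \<open>The weight \<open>(u - \<alpha>) ^ (m mod 2)\<close> treats both parities at once; the
  condition on \<open>c\<close> bounds the degree of the integrand by \<open>m\<close>.\<close>

lemma weighted_moment:
  assumes "moments_exist q \<alpha> \<sigma> m" "c + m mod 2 \<le> m"
  shows "mat_integrable q \<alpha> \<sigma> (\<lambda>u. complex_of_real ((u - \<alpha>) ^ (m mod 2) * u ^ c))"
    and "mat_integral q \<alpha> \<sigma> (\<lambda>u. complex_of_real ((u - \<alpha>) ^ (m mod 2) * u ^ c)) =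
      (if even m then mat_moment q \<alpha> \<sigma> c else shift_seq \<alpha> (mat_moment q \<alpha> \<sigma>) c)"
proof -
  have M: "mat_integrable q \<alpha> \<sigma> (\<lambda>u. complex_of_real (u ^ j))" if "j \<le> m" for j
    using assms(1) that by (simp add: moments_exist_def)
  have "mat_integrable q \<alpha> \<sigma> (\<lambda>u. complex_of_real ((u - \<alpha>) ^ (m mod 2) * u ^ c)) \<and>
    mat_integral q \<alpha> \<sigma> (\<lambda>u. complex_of_real ((u - \<alpha>) ^ (m mod 2) * u ^ c)) =
      (if even m then mat_moment q \<alpha> \<sigma> c else shift_seq \<alpha> (mat_moment q \<alpha> \<sigma>) c)"
  proof (cases "even m")
    case True
    then show ?thesis using M[of c] assms(2) by (simp add: mat_moment_def even_iff_mod_2_eq_zero)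
  next
    case False
    then have e: "m mod 2 = 1" by presburger
    have eq: "complex_of_real ((u - \<alpha>) ^ (m mod 2) * u ^ c)
        = complex_of_real (- \<alpha>) * complex_of_real (u ^ c) + complex_of_real (u ^ Suc c)" for u
      by (simp add: e algebra_simps)
    have int: "mat_integrable q \<alpha> \<sigma> (\<lambda>u. complex_of_real (u ^ c))" "mat_integrable q \<alpha> \<sigma> (\<lambda>u. complex_of_real (u ^ Suc c))"
      using M[of c] M[of "Suc c"] assms(2) e by simp_all
    show ?thesis
      unfolding eq mat_integral_add[OF mat_integrable_mult[OF int(1)] int(2)] mat_integral_mult[OF int(1)]
      by (intro conjI mat_integrable_add mat_integrable_mult int) (use False in \<open>simp add: shift_seq_def mat_moment_def\<close>)
  qed
  then show "mat_integrable q \<alpha> \<sigma> (\<lambda>u. complex_of_real ((u - \<alpha>) ^ (m mod 2) * u ^ c))"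
    "mat_integral q \<alpha> \<sigma> (\<lambda>u. complex_of_real ((u - \<alpha>) ^ (m mod 2) * u ^ c)) =
      (if even m then mat_moment q \<alpha> \<sigma> c else shift_seq \<alpha> (mat_moment q \<alpha> \<sigma>) c)" by blast+
qed

text \<open>The Gram matrix of the weighted monomials is enlarged by one function containing the
  Cauchy kernel. The dependence among the monomial vectors comes from
  \<open>gram_kernel_transfer\<close>, and pairing it with the extra vector gives the relation for
  the Cauchy transforms \<open>Y b\<close>.\<close>

lemma (in stieltjes_model) solution_relation:
  assumes t: "\<And>j. j \<le> m \<Longrightarrow> t j = s j"
    and X: "X \<in> carrier_mat (m div 2 * q) q"
      "model_vec \<alpha> m R B (m div 2) = hcat N q (model_vec \<alpha> m R B) (m div 2) * X"
    and \<sigma>: "nonneg_herm_measure q \<alpha> \<sigma>" "moments_exist q \<alpha> \<sigma> m"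
      "\<And>j. j < m \<Longrightarrow> mat_moment q \<alpha> \<sigma> j = t j" "nonneg_herm (t m - mat_moment q \<alpha> \<sigma> m)"
    and z: "z \<in> slit_plane \<alpha>"
  defines "Y \<equiv> \<lambda>b. mat_integral q \<alpha> \<sigma> (\<lambda>u. complex_of_real ((u - \<alpha>) ^ (m mod 2) * u ^ b) / (complex_of_real u - z))"
  shows "Y (m div 2) = hcat q q Y (m div 2) * X"
    and "b \<le> m div 2 \<Longrightarrow> mat_integrable q \<alpha> \<sigma> (\<lambda>u. complex_of_real ((u - \<alpha>) ^ (m mod 2) * u ^ b) / (complex_of_real u - z))"
proof -
  define n where "n = m div 2"
  define e where "e = m mod 2"
  have m: "m = 2 * n + e" "e = 0 \<or> e = 1" "even m \<longleftrightarrow> e = 0" unfolding n_def e_def by presburger+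
  define mo where "mo c u = complex_of_real ((u - \<alpha>) ^ e * u ^ c)" for c and u :: real
  have deg: "c + m mod 2 \<le> m" if "c \<le> 2 * n" for c using that m(1) unfolding e_def[symmetric] by linarith
  have mo_int: "mat_integrable q \<alpha> \<sigma> (mo c)" if "c \<le> 2 * n" for c
    unfolding mo_def[abs_def] e_def by (rule weighted_moment(1)[OF \<sigma>(2) deg[OF that]])
  have mo_moment: "mat_integral q \<alpha> \<sigma> (mo c) = (if e = 0 then mat_moment q \<alpha> \<sigma> c
      else complex_of_real (- \<alpha>) \<cdot>\<^sub>m mat_moment q \<alpha> \<sigma> c + mat_moment q \<alpha> \<sigma> (Suc c))" if "c \<le> 2 * n" for c
    unfolding mo_def[abs_def] e_def weighted_moment(2)[OF \<sigma>(2) deg[OF that]]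
    by (simp add: shift_seq_def even_iff_mod_2_eq_zero)
  obtain C where "\<forall>u\<ge>\<alpha>. cmod (1 / (complex_of_real u - z)) \<le> C" using slit_plane_dist[OF z] ..
  then have C: "cmod (1 / (complex_of_real u - z)) \<le> C" if "\<alpha> \<le> u" for u using that by blast
  have C0: "0 \<le> C" using order_trans[OF norm_ge_zero C[of \<alpha>]] by simp
  \<comment> \<open>The square root splits the weight evenly between two factors. The kernel
    contains \<open>cnj z\<close> because \<open>f (Suc n)\<close> appears conjugated in the pairing
    that produces \<open>Y b\<close>.\<close>
  define f where "f a u = (if a \<le> n then complex_of_real (sqrt ((u - \<alpha>) ^ e)) * complex_of_real (u ^ a)
     else complex_of_real (sqrt ((u - \<alpha>) ^ e)) / (complex_of_real u - cnj z))" for a and u :: real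
  have f_meas: "f a \<in> borel_measurable (half_line \<alpha>)" for a
    unfolding f_def[abs_def] by (rule measurable_restrict_space1) (cases "a \<le> n"; simp; measurable)
  have sq: "complex_of_real (sqrt ((u - \<alpha>) ^ e)) * complex_of_real (sqrt ((u - \<alpha>) ^ e)) = complex_of_real ((u - \<alpha>) ^ e)" if "\<alpha> \<le> u" for u
    using that by (simp flip: of_real_mult)
  have ff: "cnj (f a u) * f b u = mo (a + b) u" if "a \<le> n" "b \<le> n" "\<alpha> \<le> u" for a b u
  proof -
    have "cnj (f a u) * f b u = (complex_of_real (sqrt ((u - \<alpha>) ^ e)) * complex_of_real (sqrt ((u - \<alpha>) ^ e))) * complex_of_real (u ^ (a + b))"
      using that by (simp add: f_def power_add)
    then show ?thesis unfolding sq[OF that(3)] by (simp add: mo_def)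
  qed
  have fz: "cnj (f (Suc n) u) * f b u = mo b u / (complex_of_real u - z)" if "b \<le> n" "\<alpha> \<le> u" for b u
  proof -
    have "cnj (f (Suc n) u) * f b u = (complex_of_real (sqrt ((u - \<alpha>) ^ e)) * complex_of_real (sqrt ((u - \<alpha>) ^ e))) * complex_of_real (u ^ b) / (complex_of_real u - z)"
      using that by (simp add: f_def)
    then show ?thesis unfolding sq[OF that(2)] by (simp add: mo_def)
  qed
  have fn: "cmod (f a u) = (if a \<le> n then sqrt ((u - \<alpha>) ^ e) * \<bar>u\<bar> ^ a else sqrt ((u - \<alpha>) ^ e) * cmod (1 / (complex_of_real u - z)))"
    if "\<alpha> \<le> u" for a u
  proof -
    have "cmod (complex_of_real u - cnj z) = cmod (complex_of_real u - z)"
      by (metis complex_cnj_complex_of_real complex_cnj_diff complex_mod_cnj)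
    then show ?thesis using that by (simp add: f_def norm_mult norm_divide norm_power)
  qed
  have int: "mat_integrable q \<alpha> \<sigma> (\<lambda>u. cnj (f a u) * f b u)" if ab: "a < Suc (Suc n)" "b < Suc (Suc n)" for a b
  proof (rule mat_integrable_bound[where C = "(if a \<le> n then 1 else C) * (if b \<le> n then 1 else C)"])
    \<comment> \<open>The kernel is bounded by \<open>C\<close>, so it costs a constant and no power
      of \<open>u\<close>; the comparison moment then has index at most \<open>2n\<close>.\<close>
    let ?a = "if a \<le> n then a else 0" and ?b = "if b \<le> n then b else 0"
    show "mat_integrable q \<alpha> \<sigma> (mo (?a + ?b))" by (rule mo_int) auto
    note [measurable] = f_meas
    show "(\<lambda>u. cnj (f a u) * f b u) \<in> borel_measurable (half_line \<alpha>)" by measurable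
    fix u assume u: "\<alpha> \<le> u"
    have le: "cmod (f a u) \<le> (if a \<le> n then 1 else C) * (sqrt ((u - \<alpha>) ^ e) * \<bar>u\<bar> ^ (if a \<le> n then a else 0))" for a
    proof (cases "a \<le> n")
      case False
      have "sqrt ((u - \<alpha>) ^ e) * cmod (1 / (complex_of_real u - z)) \<le> sqrt ((u - \<alpha>) ^ e) * C"
        using u by (intro mult_left_mono C) auto
      then show ?thesis using False fn[OF u, of a] by (simp add: mult.commute)
    qed (use fn[OF u, of a] in simp)
    have "cmod (cnj (f a u) * f b u) \<le> ((if a \<le> n then 1 else C) * (sqrt ((u - \<alpha>) ^ e) * \<bar>u\<bar> ^ ?a)) *
        ((if b \<le> n then 1 else C) * (sqrt ((u - \<alpha>) ^ e) * \<bar>u\<bar> ^ ?b))"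
      unfolding norm_mult complex_mod_cnj by (intro mult_mono le) (use C0 u in auto)
    also have "\<dots> = (if a \<le> n then 1 else C) * (if b \<le> n then 1 else C) * ((sqrt ((u - \<alpha>) ^ e) * sqrt ((u - \<alpha>) ^ e)) * \<bar>u\<bar> ^ (?a + ?b))"
      by (simp only: power_add mult_ac)
    also have "(sqrt ((u - \<alpha>) ^ e) * sqrt ((u - \<alpha>) ^ e)) * \<bar>u\<bar> ^ (?a + ?b) = cmod (mo (?a + ?b) u)"
      unfolding mo_def norm_of_real abs_mult power_abs using u by simp
    finally show "cmod (cnj (f a u) * f b u) \<le> (if a \<le> n then 1 else C) * (if b \<le> n then 1 else C) * cmod (mo (?a + ?b) u)" .
  qed
  define J where "J a b = mat_integral q \<alpha> \<sigma> (\<lambda>u. cnj (f a u) * f b u)" for a b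
  have "nonneg_herm (blocks q (Suc (Suc n)) J)"
    unfolding J_def[abs_def] by (rule nonneg_herm_function_gram[OF \<sigma>(1)]) (use f_meas int in auto)
  note psd = this
  obtain g where g: "\<And>a. g a \<in> carrier_mat (Suc (Suc n) * q) q"
    and gg: "\<And>a b. a < Suc (Suc n) \<Longrightarrow> b < Suc (Suc n) \<Longrightarrow> mat_adjoint (g a) * g b = J a b"
    using blocks_gram[OF psd] unfolding J_def by (metis mat_integral_carrier)
  let ?N = "Suc (Suc n) * q"
  have J1: "J a b = mat_integral q \<alpha> \<sigma> (mo (a + b))" if "a \<le> n" "b \<le> n" for a b
    unfolding J_def using ff that by (intro mat_integral_cong) auto
  have J2: "J (Suc n) b = Y b" if "b \<le> n" for b
    unfolding J_def Y_def e_def[symmetric] mo_def[symmetric] using fz that by (intro mat_integral_cong) auto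
  have W: "model_vec \<alpha> m R B a \<in> carrier_mat N q" for a
    by (auto simp: model_vec_def intro!: carrier_matI)
  have WW: "mat_adjoint (model_vec \<alpha> m R B a) * model_vec \<alpha> m R B b = (if e = 0 then t (a + b) else shift_seq \<alpha> t (a + b))"
    if "a \<le> n" "b \<le> n" for a b
    using model_vec_gram[of m t a b] t that m(3) by (simp add: n_def)
  \<comment> \<open>Gram entries other than the corner involve moments of index below
    \<open>m\<close>, which are prescribed. The corner leaves exactly the defect
    \<open>t m - mat_moment q \<alpha> \<sigma> m\<close>.\<close>
  have gn: "g n = hcat ?N q g n * X"
  proof (rule gram_kernel_transfer[of n "model_vec \<alpha> m R B" N q])
    show "X \<in> carrier_mat (n * q) q" using X(1) by (simp add: n_def)
    show "model_vec \<alpha> m R B n = hcat N q (model_vec \<alpha> m R B) n * X" using X(2) by (simp add: n_def)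
    show "mat_adjoint (g a) * g b = mat_adjoint (model_vec \<alpha> m R B a) * model_vec \<alpha> m R B b" if "a \<le> n" "b < n" for a b
    proof -
      have "mat_adjoint (g a) * g b = mat_integral q \<alpha> \<sigma> (mo (a + b))" using gg[of a b] J1[of a b] that by simp
      also have "\<dots> = (if e = 0 then t (a + b) else shift_seq \<alpha> t (a + b))"
        using mo_moment[of "a + b"] \<sigma>(3)[of "a + b"] \<sigma>(3)[of "Suc (a + b)"] that m by (auto simp: shift_seq_def)
      finally show ?thesis using WW[of a b] that by simp
    qed
    have "mat_adjoint (model_vec \<alpha> m R B n) * model_vec \<alpha> m R B n - mat_adjoint (g n) * g n = t m - mat_moment q \<alpha> \<sigma> m"
    proof -
      have "mat_adjoint (g n) * g n = mat_integral q \<alpha> \<sigma> (mo (n + n))" using gg[of n n] J1[of n n] by simp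
      then show ?thesis
        using WW[of n n] mo_moment[of "n + n"] m(2) t[of m] t[of "2 * n"] \<sigma>(3)[of "2 * n"]
        by (auto intro!: eq_matI simp: m(1) shift_seq_def mat_moment_def mult_2)
    qed
    then show "nonneg_herm (mat_adjoint (model_vec \<alpha> m R B n) * model_vec \<alpha> m R B n - mat_adjoint (g n) * g n)"
      using \<sigma>(4) by simp
  qed (use W g in auto)
  have "Y n = mat_adjoint (g (Suc n)) * g n" using gg[of "Suc n" n] J2[of n] by simp
  also have "\<dots> = mat_adjoint (g (Suc n)) * hcat ?N q g n * X"
    using g[of "Suc n"] X(1) by (subst gn) (simp add: mat_assoc n_def)
  also have "mat_adjoint (g (Suc n)) * hcat ?N q g n = hcat q q (\<lambda>b. mat_adjoint (g (Suc n)) * g b) n"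
    using g by (intro mult_hcat) auto
  also have "\<dots> = hcat q q Y n" using gg J2 by (intro hcat_cong) auto
  finally show "Y (m div 2) = hcat q q Y (m div 2) * X" by (simp add: n_def)
  show "mat_integrable q \<alpha> \<sigma> (\<lambda>u. complex_of_real ((u - \<alpha>) ^ (m mod 2) * u ^ b) / (complex_of_real u - z))" if "b \<le> m div 2"
    using int[of "Suc n" b] that fz[of b] unfolding e_def[symmetric] mo_def[symmetric] n_def[symmetric]
    by (subst mat_integrable_cong) auto
qed

section \<open>Comparison of two solutions\<close>

lemma det_nonzero_inverse:
  fixes A :: "complex mat"
  assumes A: "A \<in> carrier_mat n n" and "Determinant.det A \<noteq> 0"
  obtains B where "B \<in> carrier_mat n n" "A * B = 1\<^sub>m n" "B * A = 1\<^sub>m n" "mat_inverse A = Some B"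
proof -
  have U: "A \<in> Units (ring_mat TYPE(complex) n ())" by (rule det_non_zero_imp_unit[OF assms])
  show ?thesis
  proof (cases "mat_inverse A")
    case None
    from mat_inverse(1)[OF A None, of "()"] U show ?thesis by blast
  next
    case (Some B)
    from mat_inverse(2)[OF A Some] show ?thesis by (intro that[of B] Some) auto
  qed
qed

lemma mat_moment_dims [simp]: "dim_row (mat_moment q \<alpha> \<sigma> j) = q" "dim_col (mat_moment q \<alpha> \<sigma> j) = q"
  by (simp_all add: mat_moment_def)

text \<open>From \<open>(u - c) / (u - z) = 1 + (z - c) / (u - z)\<close>. With \<open>c = 0\<close>
  it raises the power of \<open>u\<close>, with \<open>c = \<alpha>\<close> it introduces the
  weight.\<close>

lemma cauchy_transform_Suc:
  assumes z: "z \<in> slit_plane \<alpha>"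
    and "mat_integrable q \<alpha> \<sigma> (\<lambda>u. complex_of_real (w u))"
    and "mat_integrable q \<alpha> \<sigma> (\<lambda>u. complex_of_real (w u) / (complex_of_real u - z))"
  shows "mat_integral q \<alpha> \<sigma> (\<lambda>u. complex_of_real (w u * (u - c)) / (complex_of_real u - z))
    = mat_integral q \<alpha> \<sigma> (\<lambda>u. complex_of_real (w u)) + (z - of_real c) \<cdot>\<^sub>m mat_integral q \<alpha> \<sigma> (\<lambda>u. complex_of_real (w u) / (complex_of_real u - z))"
proof -
  have "mat_integral q \<alpha> \<sigma> (\<lambda>u. complex_of_real (w u * (u - c)) / (complex_of_real u - z))
    = mat_integral q \<alpha> \<sigma> (\<lambda>u. complex_of_real (w u) + (z - of_real c) * (complex_of_real (w u) / (complex_of_real u - z)))"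
  proof (rule mat_integral_cong)
    fix u assume "\<alpha> \<le> u"
    then have "complex_of_real u \<noteq> z" using z by (auto simp: slit_plane_def)
    then show "complex_of_real (w u * (u - c)) / (complex_of_real u - z)
        = complex_of_real (w u) + (z - of_real c) * (complex_of_real (w u) / (complex_of_real u - z))"
      by (simp add: field_simps)
  qed
  then show ?thesis using assms(2,3) by (simp only: mat_integral_add mat_integral_mult mat_integrable_mult)
qed

text \<open>The recursion for \<open>Y\<close> only adds moments shared by both measures, so the two
  values of \<open>Y\<close> at \<open>b\<close> differ by
  \<open>c z\<^sup>b (F \<sigma> - F \<tau>)\<close>. Both satisfy the relation with the same
  \<open>X\<close>; subtraction shows that \<open>c (F \<sigma> - F \<tau>)\<close> times the monic
  polynomial vanishes, and that polynomial is invertible at \<open>z\<close>.\<close>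

lemma (in stieltjes_model) cauchy_transform_difference:
  assumes t: "\<And>j. j \<le> m \<Longrightarrow> t j = s j"
    and X: "X \<in> carrier_mat (m div 2 * q) q"
      "model_vec \<alpha> m R B (m div 2) = hcat N q (model_vec \<alpha> m R B) (m div 2) * X"
    and \<sigma>: "nonneg_herm_measure q \<alpha> \<sigma>" "moments_exist q \<alpha> \<sigma> m"
      "\<And>j. j < m \<Longrightarrow> mat_moment q \<alpha> \<sigma> j = t j" "nonneg_herm (t m - mat_moment q \<alpha> \<sigma> m)"
    and \<tau>: "nonneg_herm_measure q \<alpha> \<tau>" "moments_exist q \<alpha> \<tau> m"
      "\<And>j. j < m \<Longrightarrow> mat_moment q \<alpha> \<tau> j = t j" "nonneg_herm (t m - mat_moment q \<alpha> \<tau> m)"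
    and z: "z \<in> slit_plane \<alpha>"
    and det: "Determinant.det (z ^ (m div 2) \<cdot>\<^sub>m 1\<^sub>m q - hcat q q (\<lambda>b. z ^ b \<cdot>\<^sub>m 1\<^sub>m q) (m div 2) * X) \<noteq> 0"
  shows "mat_integral q \<alpha> \<sigma> (\<lambda>u. 1 / (complex_of_real u - z)) = mat_integral q \<alpha> \<tau> (\<lambda>u. 1 / (complex_of_real u - z))"
proof -
  define n where "n = m div 2"
  define e where "e = m mod 2"
  have m: "m = 2 * n + e" "e = 0 \<or> e = 1" "even m \<longleftrightarrow> e = 0" unfolding n_def e_def by presburger+
  define Y where "Y \<sigma> b = mat_integral q \<alpha> \<sigma> (\<lambda>u. complex_of_real ((u - \<alpha>) ^ e * u ^ b) / (complex_of_real u - z))" for \<sigma> b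
  define F where "F \<sigma> = mat_integral q \<alpha> \<sigma> (\<lambda>u. 1 / (complex_of_real u - z))" for \<sigma>
  have Yc [simp]: "dim_row (Y \<sigma> b) = q" "dim_col (Y \<sigma> b) = q" "Y \<sigma> b \<in> carrier_mat q q" for \<sigma> b by (simp_all add: Y_def)
  have Fc [simp]: "dim_row (F \<sigma>) = q" "dim_col (F \<sigma>) = q" for \<sigma> by (simp_all add: F_def)
  have rel\<sigma>1: "Y \<sigma> n = hcat q q (Y \<sigma>) n * X"
    unfolding Y_def[abs_def] n_def e_def by (rule solution_relation(1)[OF t X \<sigma> z])
  have rel\<sigma>2: "mat_integrable q \<alpha> \<sigma> (\<lambda>u. complex_of_real ((u - \<alpha>) ^ e * u ^ b) / (complex_of_real u - z))"
    if "b \<le> n" for b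
    using that unfolding n_def e_def by (rule solution_relation(2)[OF t X \<sigma> z, rotated 2])
  have rel\<tau>1: "Y \<tau> n = hcat q q (Y \<tau>) n * X"
    unfolding Y_def[abs_def] n_def e_def by (rule solution_relation(1)[OF t X \<tau> z])
  have rel\<tau>2: "mat_integrable q \<alpha> \<tau> (\<lambda>u. complex_of_real ((u - \<alpha>) ^ e * u ^ b) / (complex_of_real u - z))"
    if "b \<le> n" for b
    using that unfolding n_def e_def by (rule solution_relation(2)[OF t X \<tau> z, rotated 2])
  define c where "c = (z - of_real \<alpha>) ^ e"
  have z\<alpha>: "z \<noteq> of_real \<alpha>" using z by (auto simp: slit_plane_def)
  have Y0: "Y \<rho> 0 = (if e = 0 then F \<rho> else mat_moment q \<alpha> \<rho> 0 + (z - of_real \<alpha>) \<cdot>\<^sub>m F \<rho>)"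
    if \<rho>: "moments_exist q \<alpha> \<rho> m" for \<rho>
  proof (cases "e = 0")
    case True
    then show ?thesis by (simp add: Y_def F_def)
  next
    case False
    then have e: "e = 1" using m by simp
    have i0: "mat_integrable q \<alpha> \<rho> (\<lambda>u. complex_of_real 1)"
      using \<rho>[unfolded moments_exist_def, rule_format, of 0] by (simp only: power_0 le0)
    obtain C where C: "\<forall>u\<ge>\<alpha>. cmod (1 / (complex_of_real u - z)) \<le> C" using slit_plane_dist[OF z] ..
    have "(\<lambda>u. complex_of_real 1 / (complex_of_real u - z)) \<in> borel_measurable (half_line \<alpha>)"
      by (rule measurable_restrict_space1) measurable
    then have i1: "mat_integrable q \<alpha> \<rho> (\<lambda>u. complex_of_real 1 / (complex_of_real u - z))"
      by (rule mat_integrable_bound[where C = C, OF i0]) (use C in simp)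
    show ?thesis using cauchy_transform_Suc[OF z i0 i1, of \<alpha>] e by (simp add: Y_def F_def mat_moment_def)
  qed
  have YS: "Y \<rho> (Suc b) = mat_integral q \<alpha> \<rho> (\<lambda>u. complex_of_real ((u - \<alpha>) ^ e * u ^ b)) + z \<cdot>\<^sub>m Y \<rho> b"
    if "mat_integrable q \<alpha> \<rho> (\<lambda>u. complex_of_real ((u - \<alpha>) ^ e * u ^ b))"
      "mat_integrable q \<alpha> \<rho> (\<lambda>u. complex_of_real ((u - \<alpha>) ^ e * u ^ b) / (complex_of_real u - z))" for \<rho> b
    using cauchy_transform_Suc[OF z that, of 0] by (simp add: Y_def mult_ac)
  have D: "Y \<sigma> b = Y \<tau> b + (c * z ^ b) \<cdot>\<^sub>m (F \<sigma> - F \<tau>)" if "b \<le> n" for b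
    using that
  proof (induction b)
    case 0
    have "mat_moment q \<alpha> \<sigma> 0 = mat_moment q \<alpha> \<tau> 0" if "e = 1" using that m(1) \<sigma>(3)[of 0] \<tau>(3)[of 0] by simp
    then show ?case using Y0[OF \<sigma>(2)] Y0[OF \<tau>(2)] m(2)
      by (auto intro!: eq_matI simp: c_def right_diff_distrib)
  next
    case (Suc b)
    \<comment> \<open>Because \<open>Suc b \<le> n\<close>, the moments entering here have index
      below \<open>m\<close>, where both measures agree.\<close>
    have b: "b + m mod 2 \<le> m" "b + m mod 2 < m" "b \<le> n" using Suc.prems m(1) by (auto simp: e_def)
    have be: "even m \<or> Suc b < m" using Suc.prems m by auto
    note w\<sigma> = weighted_moment[OF \<sigma>(2) b(1), folded e_def]
    note w\<tau> = weighted_moment[OF \<tau>(2) b(1), folded e_def]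
    have eq: "mat_integral q \<alpha> \<sigma> (\<lambda>u. complex_of_real ((u - \<alpha>) ^ e * u ^ b)) = mat_integral q \<alpha> \<tau> (\<lambda>u. complex_of_real ((u - \<alpha>) ^ e * u ^ b))"
      unfolding w\<sigma>(2) w\<tau>(2) using \<sigma>(3) \<tau>(3) b(2) be by (auto simp: shift_seq_def)
    show ?case
      unfolding YS[OF w\<sigma>(1) rel\<sigma>2[OF b(3)]] YS[OF w\<tau>(1) rel\<tau>2[OF b(3)]] eq Suc.IH[OF b(3)]
      by (auto intro!: eq_matI simp: distrib_left mult_ac)
  qed
  let ?H = "hcat q q (\<lambda>b. z ^ b \<cdot>\<^sub>m 1\<^sub>m q) n" and ?D = "c \<cdot>\<^sub>m (F \<sigma> - F \<tau>)"
  have Xd [simp]: "dim_row X = n * q" "dim_col X = q" using X(1) by (auto simp: n_def)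
  have h: "hcat q q (Y \<sigma>) n = hcat q q (Y \<tau>) n + ?D * ?H"
  proof -
    have "?D * ?H = hcat q q (\<lambda>b. ?D * (z ^ b \<cdot>\<^sub>m 1\<^sub>m q)) n" by (rule mult_hcat) auto
    also have "\<dots> = hcat q q (\<lambda>b. (c * z ^ b) \<cdot>\<^sub>m (F \<sigma> - F \<tau>)) n"
      by (rule hcat_cong[OF refl]) (auto intro!: eq_matI simp: mat_simps)
    finally have "?D * ?H = hcat q q (\<lambda>b. (c * z ^ b) \<cdot>\<^sub>m (F \<sigma> - F \<tau>)) n" .
    moreover have "hcat q q (Y \<sigma>) n = hcat q q (\<lambda>b. Y \<tau> b + (c * z ^ b) \<cdot>\<^sub>m (F \<sigma> - F \<tau>)) n"
      by (rule hcat_cong[OF refl]) (simp add: D)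
    ultimately show ?thesis by (auto intro!: eq_matI simp: hcat_def div_mod_bound)
  qed
  have "Y \<tau> n + (c * z ^ n) \<cdot>\<^sub>m (F \<sigma> - F \<tau>) = (hcat q q (Y \<tau>) n + ?D * ?H) * X"
    using rel\<sigma>1 D[of n] h by simp
  also have "\<dots> = hcat q q (Y \<tau>) n * X + ?D * (?H * X)" by (simp add: mat_simps)
  also have "hcat q q (Y \<tau>) n * X = Y \<tau> n" using rel\<tau>1 by simp
  finally have e1: "Y \<tau> n + (c * z ^ n) \<cdot>\<^sub>m (F \<sigma> - F \<tau>) = Y \<tau> n + ?D * (?H * X)" .
  have DM: "?D * (z ^ n \<cdot>\<^sub>m 1\<^sub>m q - ?H * X) = 0\<^sub>m q q"
  proof (rule eq_matI)
    fix i j assume "i < dim_row (0\<^sub>m q q :: complex mat)" "j < dim_col (0\<^sub>m q q :: complex mat)"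
    then have ij: "i < q" "j < q" by auto
    then have "c * z ^ n * (F \<sigma> $$ (i, j) - F \<tau> $$ (i, j)) = (?D * (?H * X)) $$ (i, j)"
      using arg_cong[OF e1, of "\<lambda>M. M $$ (i, j)"] by (simp del: index_mult_mat(1))
    then show "(?D * (z ^ n \<cdot>\<^sub>m 1\<^sub>m q - ?H * X)) $$ (i, j) = 0\<^sub>m q q $$ (i, j)"
      using ij by (simp add: mat_distribs mult_ac del: index_mult_mat(1))
  qed simp_all
  obtain K where K: "K \<in> carrier_mat q q" "(z ^ n \<cdot>\<^sub>m 1\<^sub>m q - ?H * X) * K = 1\<^sub>m q"
    by (rule det_nonzero_inverse[of "z ^ n \<cdot>\<^sub>m 1\<^sub>m q - ?H * X" q]) (use det in \<open>simp_all add: n_def\<close>)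
  have "?D = ?D * ((z ^ n \<cdot>\<^sub>m 1\<^sub>m q - ?H * X) * K)" unfolding K(2) by simp
  also have "\<dots> = ?D * (z ^ n \<cdot>\<^sub>m 1\<^sub>m q - ?H * X) * K" using K(1) by (intro mat_assoc[symmetric]) auto
  also have "\<dots> = 0\<^sub>m q q" unfolding DM using K(1) by simp
  finally have D0: "?D = 0\<^sub>m q q" .
  have "c \<noteq> 0" using z\<alpha> by (simp add: c_def)
  have "F \<sigma> = F \<tau>"
  proof (rule eq_matI)
    fix i j assume "i < dim_row (F \<tau>)" "j < dim_col (F \<tau>)"
    then show "F \<sigma> $$ (i, j) = F \<tau> $$ (i, j)"
      using arg_cong[OF D0, of "\<lambda>M. M $$ (i, j)"] \<open>c \<noteq> 0\<close> by simp
  qed simp_all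
  then show ?thesis by (simp add: F_def)
qed

lemma (in stieltjes_model) solution_unique:
  assumes t: "\<And>j. j \<le> m \<Longrightarrow> t j = s j"
    and X: "X \<in> carrier_mat (m div 2 * q) q"
      "model_vec \<alpha> m R B (m div 2) = hcat N q (model_vec \<alpha> m R B) (m div 2) * X"
    and F: "F \<in> S_moment_le q \<alpha> t m" and G: "G \<in> S_moment_le q \<alpha> t m"
  shows "F = G"
proof -
  have Fh: "F \<in> mat_holomorphic q \<alpha>" and Gh: "G \<in> mat_holomorphic q \<alpha>"
    using F G by (auto simp: S_moment_le_def S0_class_def S_class_def)
  obtain \<sigma> where \<sigma>: "is_stieltjes_measure q \<alpha> F \<sigma>" "moments_exist q \<alpha> \<sigma> m"
      "\<And>j. j < m \<Longrightarrow> mat_moment q \<alpha> \<sigma> j = t j" "nonneg_herm (t m - mat_moment q \<alpha> \<sigma> m)"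
    using F by (auto simp: S_moment_le_def)
  obtain \<tau> where \<tau>: "is_stieltjes_measure q \<alpha> G \<tau>" "moments_exist q \<alpha> \<tau> m"
      "\<And>j. j < m \<Longrightarrow> mat_moment q \<alpha> \<tau> j = t j" "nonneg_herm (t m - mat_moment q \<alpha> \<tau> m)"
    using G by (auto simp: S_moment_le_def)
  obtain \<rho> where \<rho>: "\<And>z. \<rho> < cmod z \<Longrightarrow>
      Determinant.det (z ^ (m div 2) \<cdot>\<^sub>m 1\<^sub>m q - hcat q q (\<lambda>b. z ^ b \<cdot>\<^sub>m 1\<^sub>m q) (m div 2) * X) \<noteq> 0"
    using det_monic_nonzero[OF X(1)] by blast
  have far: "F z = G z" if "z \<in> slit_plane \<alpha>" "\<rho> < cmod z" for z
    using cauchy_transform_difference[OF t X _ \<sigma>(2-4) _ \<tau>(2-4) that(1) \<rho>[OF that(2)]] \<sigma>(1) \<tau>(1) that(1)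
    by (simp add: is_stieltjes_measure_def)
  have eq: "F z = G z" if z: "z \<in> slit_plane \<alpha>" for z
  proof (rule eq_matI)
    have c: "F z \<in> carrier_mat q q" "G z \<in> carrier_mat q q" using Fh Gh z by (auto simp: mat_holomorphic_def)
    then show "dim_row (F z) = dim_row (G z)" "dim_col (F z) = dim_col (G z)" by auto
    fix i j assume "i < dim_row (G z)" "j < dim_col (G z)"
    then have ij: "i < q" "j < q" using c by auto
    let ?U = "slit_plane \<alpha> \<inter> {z. \<rho> < cmod z}"
    show "F z $$ (i, j) = G z $$ (i, j)"
    proof (rule analytic_continuation_open[of ?U "slit_plane \<alpha>" "\<lambda>z. F z $$ (i, j)" "\<lambda>z. G z $$ (i, j)"])
      show "open ?U" by (intro open_Int open_slit_plane open_Collect_less continuous_intros)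
      have "\<i> * of_real (\<bar>\<rho>\<bar> + 1) \<in> ?U" by (auto simp: slit_plane_def complex_eq_iff norm_mult)
      then show "?U \<noteq> {}" by blast
      show "(\<lambda>z. F z $$ (i, j)) holomorphic_on slit_plane \<alpha>" "(\<lambda>z. G z $$ (i, j)) holomorphic_on slit_plane \<alpha>"
        using Fh Gh ij by (simp_all add: mat_holomorphic_def)
      show "F z $$ (i, j) = G z $$ (i, j)" if "z \<in> ?U" for z using far[of z] that by simp
    qed (rule open_slit_plane connected_slit_plane Int_lower1 z)+
  qed
  show ?thesis
  proof
    fix z show "F z = G z"
    proof (cases "z \<in> slit_plane \<alpha>")
      case False
      have "F \<in> slit_plane \<alpha> \<rightarrow>\<^sub>E carrier_mat q q" "G \<in> slit_plane \<alpha> \<rightarrow>\<^sub>E carrier_mat q q"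
        using Fh Gh by (simp_all add: mat_holomorphic_def)
      from this[THEN PiE_arb, OF False] show ?thesis by simp
    qed (rule eq)
  qed
qed

section \<open>The solution given by the spectral measure of a model\<close>

locale atomic_model =
  fixes q N :: nat and \<alpha> :: real and C :: "complex mat" and d :: "nat \<Rightarrow> real"
  assumes C: "C \<in> carrier_mat q N" and d: "\<And>i. i < N \<Longrightarrow> \<alpha> \<le> d i"
begin

text \<open>The integral of \<open>f\<close> for the matrix measure that puts the mass
  \<open>v v\<^sup>*\<close> at \<open>d i\<close>, for each column \<open>v\<close> of
  \<open>C\<close> with index \<open>i\<close>; \<open>\<mu>\<close> is this measure.\<close>

definition "\<Phi> f = C * mat_diag N (\<lambda>i. f (d i)) * mat_adjoint C"

definition "\<mu> A = \<Phi> (\<lambda>t. of_real (indicat_real A t))"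

lemma \<Phi>_carrier [simp]: "\<Phi> f \<in> carrier_mat q q" "dim_row (\<Phi> f) = q" "dim_col (\<Phi> f) = q"
  using C by (simp_all add: \<Phi>_def)

lemma index_\<Phi>: "i < q \<Longrightarrow> j < q \<Longrightarrow> \<Phi> f $$ (i, j) = (\<Sum>l<N. C $$ (i, l) * f (d l) * cnj (C $$ (j, l)))"
  unfolding \<Phi>_def by (rule index_mult_diag_adjoint[OF C])

lemma \<Phi>_nonneg: 
  assumes "\<And>t. \<alpha> \<le> t \<Longrightarrow> 0 \<le> f t"
  shows "nonneg_herm (\<Phi> (\<lambda>t. of_real (f t)))"
proof -
  let ?E = "mat_diag N (\<lambda>i. complex_of_real (sqrt (f (d i)))) * mat_adjoint C"
  have eq: "mat_diag N (\<lambda>i. of_real (f (d i))) = (mat_diag N (\<lambda>i. of_real (sqrt (f (d i))) * of_real (sqrt (f (d i)))) :: complex mat)"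
    by (rule eq_matI) (auto simp: mat_diag_def d assms simp flip: of_real_mult)
  have "mat_adjoint ?E * ?E = C * ((mat_diag N (\<lambda>i. of_real (sqrt (f (d i)))) * mat_diag N (\<lambda>i. of_real (sqrt (f (d i))))) * mat_adjoint C)"
    using C by (simp add: mat_simps adjoint_diag del: mat_diag_diag)
  then have "mat_adjoint ?E * ?E = \<Phi> (\<lambda>t. of_real (f t))"
    unfolding \<Phi>_def eq using C by (simp add: mat_assoc)
  then show ?thesis using nonneg_herm_adjoint_mult[of ?E] by simp
qed

lemma measure_\<mu>: "nonneg_herm_measure q \<alpha> \<mu>"
  unfolding nonneg_herm_measure_def
proof (intro conjI ballI allI impI)
  fix B show "\<mu> B \<in> carrier_mat q q" by (simp add: \<mu>_def)
  show "nonneg_herm (\<mu> B)" unfolding \<mu>_def by (rule \<Phi>_nonneg) simp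
next
  fix B :: "nat \<Rightarrow> real set" and i j
  assume B: "disjoint_family B" and ij: "i < q" "j < q"
  show "(\<lambda>n. \<mu> (B n) $$ (i, j)) sums \<mu> (\<Union>n. B n) $$ (i, j)"
    unfolding \<mu>_def index_\<Phi>[OF ij]
  proof (intro sums_sum sums_mult sums_mult2 sums_of_real)
    show "(\<lambda>n. indicat_real (B n) t) sums indicat_real (\<Union>n. B n) t" for t
      using B by (intro indicator_sums) (auto simp: disjoint_family_on_def)
  qed
qed

text \<open>The points \<open>d i\<close> may coincide, so integrals are first computed over the
  distinct atoms and regrouped afterwards.\<close>

definition "D = d ` {..<N}"

lemma D: "finite D" "l \<in> D \<Longrightarrow> \<alpha> \<le> l" using d by (auto simp: D_def)

lemma D_sets: "l \<in> D \<Longrightarrow> {l} \<in> sets (half_line \<alpha>)"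
  using D(2) by (auto simp: sets_restrict_space_iff)

text \<open>The complement of the atoms is a null set. Hence every integrand may be replaced by a
  simple one, to which \<open>mat_integral_indicators\<close> applies.\<close>

lemma AE_\<mu>: 
  assumes "x \<in> carrier_vec q"
  shows "AE t in form_measure \<alpha> \<mu> x. f t = (\<Sum>l\<in>D. indicator {l} t * f l :: complex)"
proof (rule AE_I[of _ _ "{\<alpha>..} - D"])
  have "D \<in> sets (half_line \<alpha>)" using D by (auto simp: sets_restrict_space_iff intro: finite_imp_closed borel_closed)
  then have S: "{\<alpha>..} - D \<in> sets (half_line \<alpha>)" using sets.compl_sets[of D "half_line \<alpha>"] by simp
  then show "{\<alpha>..} - D \<in> sets (form_measure \<alpha> \<mu> x)" by simp
  have "\<mu> ({\<alpha>..} - D) = 0\<^sub>m q q"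
    by (rule eq_matI) (auto simp: \<mu>_def index_\<Phi> D_def indicator_def intro!: sum.neutral)
  then have "mform (\<mu> ({\<alpha>..} - D)) x = 0"
    using assms by (simp add: mform_def quadratic_form[where n = q])
  then show "emeasure (form_measure \<alpha> \<mu> x) ({\<alpha>..} - D) = 0"
    using emeasure_form_measure[OF measure_\<mu> assms S] by simp
  show "{t \<in> space (form_measure \<alpha> \<mu> x). f t \<noteq> (\<Sum>l\<in>D. indicator {l} t * f l)} \<subseteq> {\<alpha>..} - D"
  proof
    fix t assume t: "t \<in> {t \<in> space (form_measure \<alpha> \<mu> x). f t \<noteq> (\<Sum>l\<in>D. indicator {l} t * f l)}"
    have "(\<Sum>l\<in>D. indicator {l} t * f l) = (\<Sum>l\<in>D. if l = t then f l else 0)"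
      by (intro sum.cong refl) (auto simp: indicator_def)
    then show "t \<in> {\<alpha>..} - D" using t D(1) by auto
  qed
qed

lemma step_measurable: "(\<lambda>t. \<Sum>l\<in>D. indicator {l} t * f l :: complex) \<in> borel_measurable (half_line \<alpha>)"
  by (rule measurable_restrict_space1) measurable

lemma step_integrable: "x \<in> carrier_vec q \<Longrightarrow> integrable (form_measure \<alpha> \<mu> x) (\<lambda>t. \<Sum>l\<in>D. indicator {l} t * f l :: complex)"
proof -
  assume x: "x \<in> carrier_vec q"
  interpret finite_measure "form_measure \<alpha> \<mu> x" by (rule finite_form_measure[OF measure_\<mu> x])
  show ?thesis
  proof (rule integrable_const_bound[where B = "\<Sum>l\<in>D. cmod (f l)"])
    show "AE t in form_measure \<alpha> \<mu> x. cmod (\<Sum>l\<in>D. indicator {l} t * f l) \<le> (\<Sum>l\<in>D. cmod (f l))"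
      by (intro AE_I2 sum_norm_le) (auto simp: norm_mult indicator_def)
  qed (simp add: step_measurable)
qed

lemma mat_integrable_\<mu>:
  assumes "f \<in> borel_measurable (half_line \<alpha>)"
  shows "mat_integrable q \<alpha> \<mu> f"
  unfolding mat_integrable_def
proof
  fix x :: "complex vec" assume x: "x \<in> carrier_vec q"
  have "integrable (form_measure \<alpha> \<mu> x) f \<longleftrightarrow> integrable (form_measure \<alpha> \<mu> x) (\<lambda>t. \<Sum>l\<in>D. indicator {l} t * f l :: complex)"
    by (rule integrable_cong_AE) (use assms step_measurable AE_\<mu>[OF x] in auto)
  then show "integrable (form_measure \<alpha> \<mu> x) f" using step_integrable[OF x] by simp
qed

lemma mat_integral_\<mu>:
  assumes "f \<in> borel_measurable (half_line \<alpha>)"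
  shows "mat_integral q \<alpha> \<mu> f = \<Phi> f"
proof -
  have "mat_integral q \<alpha> \<mu> f = mat_integral q \<alpha> \<mu> (\<lambda>t. \<Sum>l\<in>D. indicator {l} t * f l)"
  proof (rule eq_matI)
    fix j k assume "j < dim_row (mat_integral q \<alpha> \<mu> (\<lambda>t. \<Sum>l\<in>D. indicator {l} t * f l))"
      "k < dim_col (mat_integral q \<alpha> \<mu> (\<lambda>t. \<Sum>l\<in>D. indicator {l} t * f l))"
    then have jk: "j < q" "k < q" by auto
    have "integral\<^sup>L (form_measure \<alpha> \<mu> x) f = integral\<^sup>L (form_measure \<alpha> \<mu> x) (\<lambda>t. \<Sum>l\<in>D. indicator {l} t * f l)"
      if "x \<in> carrier_vec q" for x
      by (rule integral_cong_AE) (use assms step_measurable AE_\<mu>[OF that] in auto)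
    then show "mat_integral q \<alpha> \<mu> f $$ (j, k) = mat_integral q \<alpha> \<mu> (\<lambda>t. \<Sum>l\<in>D. indicator {l} t * f l) $$ (j, k)"
      using jk by (simp add: index_mat_integral)
  qed simp_all
  also have "\<dots> = mat_sum q (\<lambda>l. f l \<cdot>\<^sub>m \<mu> {l}) D"
    by (rule mat_integral_indicators[OF measure_\<mu> D(1) D_sets])
  also have "\<dots> = \<Phi> f"
  proof (rule eq_matI)
    fix i j assume "i < dim_row (\<Phi> f)" "j < dim_col (\<Phi> f)"
    then have ij: "i < q" "j < q" by auto
    have "mat_sum q (\<lambda>l. f l \<cdot>\<^sub>m \<mu> {l}) D $$ (i, j) = (\<Sum>l\<in>D. \<Sum>p<N. if l = d p then C $$ (i, p) * f (d p) * cnj (C $$ (j, p)) else 0)"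
      using ij by (simp add: index_mat_sum \<mu>_def index_\<Phi> sum_distrib_left) (intro sum.cong refl, auto simp: indicator_def)
    also have "\<dots> = (\<Sum>p<N. \<Sum>l\<in>D. if l = d p then C $$ (i, p) * f (d p) * cnj (C $$ (j, p)) else 0)"
      by (rule sum.swap)
    also have "\<dots> = (\<Sum>p<N. C $$ (i, p) * f (d p) * cnj (C $$ (j, p)))"
      using D(1) by (intro sum.cong refl) (auto simp: D_def)
    finally show "mat_sum q (\<lambda>l. f l \<cdot>\<^sub>m \<mu> {l}) D $$ (i, j) = \<Phi> f $$ (i, j)" by (simp add: index_\<Phi> ij)
  qed simp_all
  finally show ?thesis .
qed

section \<open>The Stieltjes transform of the atomic measure\<close>

definition "F = restrict (\<lambda>z. \<Phi> (\<lambda>t. 1 / (complex_of_real t - z))) (slit_plane \<alpha>)"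

lemma F_eq: "z \<in> slit_plane \<alpha> \<Longrightarrow> F z = \<Phi> (\<lambda>t. 1 / (complex_of_real t - z))"
  by (simp add: F_def)

lemma stieltjes_\<mu>: "is_stieltjes_measure q \<alpha> F \<mu>"
  unfolding is_stieltjes_measure_def
proof (intro conjI ballI measure_\<mu>)
  fix z assume z: "z \<in> slit_plane \<alpha>"
  have "(\<lambda>t. 1 / (complex_of_real t - z)) \<in> borel_measurable (half_line \<alpha>)"
    by (rule measurable_restrict_space1) measurable
  then show "F z = mat_integral q \<alpha> \<mu> (\<lambda>t. 1 / (complex_of_real t - z))"
    by (simp add: mat_integral_\<mu> F_eq[OF z])
qed

lemma moments_\<mu>: "moments_exist q \<alpha> \<mu> m" "mat_moment q \<alpha> \<mu> j = \<Phi> (\<lambda>t. complex_of_real t ^ j)"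
proof -
  have "(\<lambda>t. complex_of_real (t ^ j)) \<in> borel_measurable (half_line \<alpha>)" for j
    by (rule measurable_restrict_space1) measurable
  then show "moments_exist q \<alpha> \<mu> m" "mat_moment q \<alpha> \<mu> j = \<Phi> (\<lambda>t. complex_of_real t ^ j)"
    by (simp_all add: moments_exist_def mat_integrable_\<mu> mat_moment_def mat_integral_\<mu>)
qed

lemma F_holomorphic: "F \<in> mat_holomorphic q \<alpha>"
proof -
  have "(\<lambda>z. F z $$ (i, j)) holomorphic_on slit_plane \<alpha>" if ij: "i < q" "j < q" for i j
  proof -
    have "(\<lambda>z. \<Sum>l<N. C $$ (i, l) * (1 / (complex_of_real (d l) - z)) * cnj (C $$ (j, l))) holomorphic_on slit_plane \<alpha>"
      by (intro holomorphic_intros) (auto simp: slit_plane_def d)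
    then show ?thesis by (rule holomorphic_transform) (simp add: F_eq index_\<Phi> ij)
  qed
  then show ?thesis by (auto simp: mat_holomorphic_def F_def)
qed

lemma F_S_class: "F \<in> S_class q \<alpha>"
  unfolding S_class_def
proof (intro CollectI conjI allI impI F_holomorphic)
  fix w :: complex assume w: "Im w > 0"
  then have ws: "w \<in> slit_plane \<alpha>" by (auto simp: slit_plane_def)
  \<comment> \<open>The masses are Hermitian, so the imaginary part passes to the scalar kernel,
    where it is non-negative.\<close>
  have "mat_Im (F w) = \<Phi> (\<lambda>t. of_real (Im (1 / (complex_of_real t - w))))"
  proof (rule eq_matI)
    fix i j assume "i < dim_row (\<Phi> (\<lambda>t. complex_of_real (Im (1 / (complex_of_real t - w)))))"
      "j < dim_col (\<Phi> (\<lambda>t. complex_of_real (Im (1 / (complex_of_real t - w)))))"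
    then have ij: "i < q" "j < q" by auto
    have im: "complex_of_real (Im z) = 1 / (2 * \<i>) * (z - cnj z)" for z
      by (simp add: complex_diff_cnj) (simp add: complex_eq_iff)
    have key: "1 / (2 * \<i>) * (a * z * cnj b - cnj (b * z * cnj a)) = a * complex_of_real (Im z) * cnj b" for a b z
    proof -
      have "a * z * cnj b - cnj (b * z * cnj a) = (z - cnj z) * (a * cnj b)" by (simp add: ring_distribs)
      then show ?thesis unfolding im by (simp only: mult_ac)
    qed
    show "mat_Im (F w) $$ (i, j) = \<Phi> (\<lambda>t. complex_of_real (Im (1 / (complex_of_real t - w)))) $$ (i, j)"
    proof -
      have "mat_Im (F w) $$ (i, j) = 1 / (2 * \<i>) * (\<Phi> (\<lambda>t. 1 / (complex_of_real t - w)) $$ (i, j) - cnj (\<Phi> (\<lambda>t. 1 / (complex_of_real t - w)) $$ (j, i)))"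
        using ij by (simp add: mat_Im_def F_eq[OF ws])
      also have "\<dots> = (\<Sum>l<N. 1 / (2 * \<i>) * (C $$ (i, l) * (1 / (complex_of_real (d l) - w)) * cnj (C $$ (j, l))
          - cnj (C $$ (j, l) * (1 / (complex_of_real (d l) - w)) * cnj (C $$ (i, l)))))"
        unfolding index_\<Phi>[OF ij] index_\<Phi>[OF ij(2,1)] cnj_sum sum_subtractf[symmetric] sum_distrib_left ..
      also have "\<dots> = (\<Sum>l<N. C $$ (i, l) * complex_of_real (Im (1 / (complex_of_real (d l) - w))) * cnj (C $$ (j, l)))"
        by (simp only: key)
      finally show ?thesis by (simp only: index_\<Phi>[OF ij])
    qed
  qed (simp_all add: mat_Im_def F_eq[OF ws])
  moreover have "0 \<le> Im (1 / (complex_of_real t - w))" for t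
    using w by (auto simp: Im_divide intro!: divide_nonneg_nonneg add_nonneg_nonneg)
  ultimately show "nonneg_herm (mat_Im (F w))" by (simp only: \<Phi>_nonneg)
next
  fix w assume w: "w < \<alpha>"
  then have ws: "complex_of_real w \<in> slit_plane \<alpha>" by (auto simp: slit_plane_def)
  have "F (complex_of_real w) = \<Phi> (\<lambda>t. of_real (1 / (t - w)))" by (simp add: F_eq[OF ws])
  moreover have "nonneg_herm (\<Phi> (\<lambda>t. of_real (1 / (t - w))))" by (rule \<Phi>_nonneg) (use w in simp)
  ultimately show "nonneg_herm (F (complex_of_real w))" by simp
qed

lemma F_S0_class: "F \<in> S0_class q \<alpha>"
  unfolding S0_class_def
proof (intro CollectI conjI F_S_class bdd_aboveI2)
  \<comment> \<open>On the imaginary axis the kernel is at most \<open>1 / y\<close>, since its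
    denominator has imaginary part \<open>- y\<close>; the operator norm is bounded by the sum of
    the entry bounds.\<close>
  define K where "K = (\<Sum>i<q. \<Sum>j<q. \<Sum>l<N. cmod (C $$ (i, l)) * cmod (C $$ (j, l)))"
  fix y :: real assume "y \<in> {1..}"
  then have y: "1 \<le> y" by simp
  let ?z = "\<i> * complex_of_real y"
  have zs: "?z \<in> slit_plane \<alpha>" using y by (auto simp: slit_plane_def complex_eq_iff)
  have Fd: "dim_row (F ?z) = q" "dim_col (F ?z) = q" by (simp_all add: F_eq[OF zs])
  have entry: "cmod (F ?z $$ (i, j)) \<le> (\<Sum>l<N. cmod (C $$ (i, l)) * cmod (C $$ (j, l))) / y" if ij: "i < q" "j < q" for i j
  proof -
    have "cmod (F ?z $$ (i, j)) \<le> (\<Sum>l<N. cmod (C $$ (i, l)) * cmod (1 / (complex_of_real (d l) - ?z)) * cmod (C $$ (j, l)))"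
      unfolding F_eq[OF zs] index_\<Phi>[OF ij]
      by (rule order_trans[OF norm_sum]) (simp only: norm_mult complex_mod_cnj order_refl)
    also have "\<dots> \<le> (\<Sum>l<N. cmod (C $$ (i, l)) * (1 / y) * cmod (C $$ (j, l)))"
    proof (intro sum_mono mult_mono order_refl)
      fix l
      have "y \<le> cmod (complex_of_real (d l) - ?z)" using abs_Im_le_cmod[of "complex_of_real (d l) - ?z"] y by simp
      then show "cmod (1 / (complex_of_real (d l) - ?z)) \<le> 1 / y" unfolding norm_divide norm_one
        using y by (intro divide_left_mono mult_pos_pos) auto
    qed (use y in auto)
    finally show ?thesis by (simp add: sum_divide_distrib)
  qed
  have en: "euclid_norm v = L2_set (\<lambda>i. cmod (vec_index v i)) {..<dim_vec v}" for v
    unfolding euclid_norm_def cscalar_prod_self L2_set_def by simp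
  have "op_norm (F ?z) \<le> K / y"
    unfolding op_norm_def
  proof (rule cSUP_least)
    show "{x \<in> carrier_vec (dim_col (F ?z)). euclid_norm x \<le> 1} \<noteq> {}"
    proof -
      have "0\<^sub>v (dim_col (F ?z)) \<in> {x \<in> carrier_vec (dim_col (F ?z)). euclid_norm x \<le> 1}"
        by (auto simp: en L2_set_def)
      then show ?thesis by blast
    qed
    fix x assume "x \<in> {x \<in> carrier_vec (dim_col (F ?z)). euclid_norm x \<le> 1}"
    then have x: "dim_vec x = q" "euclid_norm x \<le> 1" by (auto simp: Fd)
    have xj: "cmod (vec_index x j) \<le> 1" if "j < q" for j
      using member_le_L2_set[of "{..<q}" j "\<lambda>i. cmod (vec_index x i)"] that x by (simp add: en)
    have "euclid_norm (F ?z *\<^sub>v x) \<le> (\<Sum>i<q. cmod (vec_index (F ?z *\<^sub>v x) i))"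
      unfolding en using L2_set_le_sum[of "{..<q}" "\<lambda>i. cmod (vec_index (F ?z *\<^sub>v x) i)"] Fd by simp
    also have "\<dots> \<le> (\<Sum>i<q. \<Sum>j<q. (\<Sum>l<N. cmod (C $$ (i, l)) * cmod (C $$ (j, l))) / y)"
    proof (rule sum_mono)
      fix i assume "i \<in> {..<q}"
      then have i: "i < q" by simp
      have "vec_index (F ?z *\<^sub>v x) i = (\<Sum>j<q. F ?z $$ (i, j) * vec_index x j)"
        using i x Fd by (simp add: scalar_prod_def atLeast0LessThan)
      also have "cmod \<dots> \<le> (\<Sum>j<q. cmod (F ?z $$ (i, j)) * cmod (vec_index x j))"
        by (rule order_trans[OF norm_sum]) (simp add: norm_mult)
      also have "\<dots> \<le> (\<Sum>j<q. (\<Sum>l<N. cmod (C $$ (i, l)) * cmod (C $$ (j, l))) / y * 1)"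
        by (intro sum_mono mult_mono entry i xj) (use y in \<open>auto intro!: sum_nonneg divide_nonneg_nonneg\<close>)
      finally show "cmod (vec_index (F ?z *\<^sub>v x) i) \<le> (\<Sum>j<q. (\<Sum>l<N. cmod (C $$ (i, l)) * cmod (C $$ (j, l))) / y)" by simp
    qed
    also have "\<dots> = K / y" by (simp add: K_def sum_divide_distrib)
    finally show "euclid_norm (F ?z *\<^sub>v x) \<le> K / y" .
  qed
  then show "y * op_norm (F ?z) \<le> K" using y by (simp add: field_simps)
qed

end

section \<open>The completely degenerate problem\<close>

text \<open>Diagonalizing \<open>S\<close> by \<open>U\<close> turns the model into an atomic
  measure: the atoms are the eigenvalues of \<open>T = \<alpha> + S\<close>, hence at least
  \<open>\<alpha>\<close>, and the columns of \<open>C = B\<^sup>* U\<close> give the masses.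
  Moments and compressed resolvents then become integrals.\<close>

lemma (in stieltjes_model) spectral_model:
  shows "\<exists>C d. C \<in> carrier_mat q N \<and> (\<forall>i<N. \<alpha> \<le> d i) \<and>
    (\<forall>j. s j = atomic_model.\<Phi> N C d (\<lambda>t. complex_of_real t ^ j)) \<and>
    (\<forall>z \<in> slit_plane \<alpha>. \<exists>X \<in> carrier_mat N q. S * X - (z - complex_of_real \<alpha>) \<cdot>\<^sub>m X = B \<and>
      mat_adjoint B * X = atomic_model.\<Phi> N C d (\<lambda>t. 1 / (complex_of_real t - z)))"
proof -
  have "nonneg_herm S" "S \<in> carrier_mat N N" by (auto simp: S_def nonneg_herm_adjoint_mult)
  then obtain U and d :: "nat \<Rightarrow> real" where U: "U \<in> carrier_mat N N" "mat_adjoint U * U = 1\<^sub>m N" "U * mat_adjoint U = 1\<^sub>m N"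
    and S: "S = U * mat_diag N (\<lambda>i. of_real (d i)) * mat_adjoint U" and d: "\<And>i. i < N \<Longrightarrow> 0 \<le> d i"
    using nonneg_herm_spectral by metis
  define C where "C = mat_adjoint B * U"
  define d' where "d' i = \<alpha> + d i" for i
  have Ud [simp]: "dim_row U = N" "dim_col U = N" using U(1) by auto
  have C: "C \<in> carrier_mat q N" by (simp add: C_def)
  have d': "\<alpha> \<le> d' i" if "i < N" for i using d[OF that] by (simp add: d'_def)
  interpret atomic_model q N \<alpha> C d' using C d' by unfold_locales
  \<comment> \<open>Functional calculus in the eigenbasis, with functions given by their values at
    the indices of the eigenvalues.\<close>
  define E where "E f = U * mat_diag N f * mat_adjoint U" for f
  have E_dims [simp]: "dim_row (E f) = N" "dim_col (E f) = N" for f by (simp_all add: E_def)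
  have EE: "E f * (E g * X) = E (\<lambda>i. f i * g i) * X" if "dim_row X = N" for f g X
    using that diag_calculus_mult[OF U(1,2), of f g] by (simp add: E_def flip: mat_assoc)
  have E1: "E f = 1\<^sub>m N" if "\<And>i. i < N \<Longrightarrow> f i = 1" for f
  proof -
    have "mat_diag N f = 1\<^sub>m N" using that by (auto intro!: eq_matI simp: mat_diag_def)
    then show ?thesis using U by (simp add: E_def)
  qed
  have E_lin: "E (\<lambda>i. a * f i + g i) = a \<cdot>\<^sub>m E f + E g" for a f g
  proof -
    have "mat_diag N (\<lambda>i. a * f i + g i) = a \<cdot>\<^sub>m mat_diag N f + mat_diag N g"
      by (auto intro!: eq_matI simp: mat_diag_def)
    then show ?thesis by (simp add: E_def mat_distribs)
  qed
  have \<Phi>: "\<Phi> f = mat_adjoint B * (E (\<lambda>i. f (d' i)) * B)" for f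
    unfolding \<Phi>_def unfolding C_def E_def by (simp add: mat_simps)
  have T: "T = E (\<lambda>i. of_real (d' i))"
  proof -
    have "T = complex_of_real \<alpha> \<cdot>\<^sub>m E (\<lambda>_. 1) + E (\<lambda>i. of_real (d i))" by (simp add: T_def S E1 flip: E_def)
    then show ?thesis unfolding E_lin[symmetric] by (simp add: d'_def)
  qed
  have "k j = E (\<lambda>i. of_real (d' i) ^ j) * B" for j
  proof (induction j)
    case (Suc j)
    then show ?case unfolding krylov.simps model_op T by (simp add: EE)
  qed (simp add: E1)
  then have moment: "s j = \<Phi> (\<lambda>t. complex_of_real t ^ j)" for j by (simp add: model_moment_def \<Phi>)
  have resolvent: "\<exists>X \<in> carrier_mat N q. S * X - (z - complex_of_real \<alpha>) \<cdot>\<^sub>m X = B \<and>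
      mat_adjoint B * X = \<Phi> (\<lambda>t. 1 / (complex_of_real t - z))" if z: "z \<in> slit_plane \<alpha>" for z
  proof (intro bexI conjI)
    let ?f = "\<lambda>i. 1 / (complex_of_real (d' i) - z)" and ?w = "z - complex_of_real \<alpha>"
    show "E ?f * B \<in> carrier_mat N q" by simp
    show "mat_adjoint B * (E ?f * B) = \<Phi> (\<lambda>t. 1 / (complex_of_real t - z))" by (simp add: \<Phi>)
    have nz: "complex_of_real (d' i) - z \<noteq> 0" if "i < N" for i using z d'[OF that] by (auto simp: slit_plane_def)
    have eq: "E (\<lambda>i. (- ?w) * ?f i + of_real (d i) * ?f i) = 1\<^sub>m N"
    proof (rule E1)
      fix i assume "i < N"
      have "- ?w + of_real (d i) = complex_of_real (d' i) - z" by (simp add: d'_def)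
      then show "(- ?w) * ?f i + of_real (d i) * ?f i = 1"
        unfolding distrib_right[symmetric] using nz[OF \<open>i < N\<close>] by simp
    qed
    have "S * (E ?f * B) - ?w \<cdot>\<^sub>m (E ?f * B) = E (\<lambda>i. of_real (d i) * ?f i) * B - ?w \<cdot>\<^sub>m (E ?f * B)"
      unfolding S E_def[symmetric] by (simp add: EE)
    also have "\<dots> = ((- ?w) \<cdot>\<^sub>m E ?f + E (\<lambda>i. of_real (d i) * ?f i)) * B"
      by (auto intro!: eq_matI simp: mat_distribs ring_distribs simp del: index_mult_mat(1))
    also have "\<dots> = B" unfolding E_lin[symmetric] eq by simp
    finally show "S * (E ?f * B) - ?w \<cdot>\<^sub>m (E ?f * B) = B" .
  qed
  show ?thesis using C d' moment resolvent by (intro exI[of _ C] exI[of _ d'] conjI allI impI ballI)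
qed

theorem theorem13p2:
  fixes q m :: nat and \<alpha> :: real and s :: "nat \<Rightarrow> complex mat"
  assumes "0 < q"
    and "K_nonneg_cd q m \<alpha> s"
  shows "K_nonneg_ext q m \<alpha> s \<and> S_transform q \<alpha> m s 0 = 0\<^sub>m q q \<and>
    (\<exists>G. is_quotient q \<alpha> (\<lambda>z. block12 q (V_prod q \<alpha> s m z)) (\<lambda>z. block22 q (V_prod q \<alpha> s m z)) G \<and>
         S_moment_le q \<alpha> s m = {G}) \<and>
    S_moment_eq q \<alpha> s m = S_moment_le q \<alpha> s m"
proof -
  obtain N R B X where R: "R \<in> carrier_mat N N" and B: "B \<in> carrier_mat N q" and X: "X \<in> carrier_mat (m div 2 * q) q"
    "model_vec \<alpha> m R B (m div 2) = hcat N q (model_vec \<alpha> m R B) (m div 2) * X"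
    and s: "\<And>j. j \<le> m \<Longrightarrow> s j = model_moment \<alpha> R B j"
    using model_exists[OF assms] by metis
  interpret M: stieltjes_model N q \<alpha> R B using R B by unfold_locales
  have V: "S_transform q \<alpha> m s 0 = 0\<^sub>m q q"
    "\<forall>z \<in> slit_plane \<alpha>. \<forall>X \<in> carrier_mat N q. M.S * X - (z - complex_of_real \<alpha>) \<cdot>\<^sub>m X = B \<longrightarrow>
      block12 q (V_prod q \<alpha> s m z) = mat_adjoint B * X * block22 q (V_prod q \<alpha> s m z)"
    "Determinant.det (block22 q (V_prod q \<alpha> s m (complex_of_real (\<alpha> - 1)))) \<noteq> 0"
    using V_prod_model[OF R B _ degenerate_hcat[OF R B X], of s] s unfolding M.S_def by blast+
  obtain C d where C: "C \<in> carrier_mat q N" and d: "\<forall>i<N. \<alpha> \<le> d i"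
    and moment: "\<forall>j. model_moment \<alpha> R B j = atomic_model.\<Phi> N C d (\<lambda>t. complex_of_real t ^ j)"
    and resolvent: "\<forall>z \<in> slit_plane \<alpha>. \<exists>X \<in> carrier_mat N q. M.S * X - (z - complex_of_real \<alpha>) \<cdot>\<^sub>m X = B \<and>
      mat_adjoint B * X = atomic_model.\<Phi> N C d (\<lambda>t. 1 / (complex_of_real t - z))"
    using M.spectral_model by blast
  interpret atomic_model q N \<alpha> C d using C d by unfold_locales auto
  \<comment> \<open>The next moment of the same model is the witness for
    \<open>s\<^sub>m\<^sub>+\<^sub>1\<close>.\<close>
  have ext: "K_nonneg_ext q m \<alpha> s"
    unfolding K_nonneg_ext_def
  proof (rule bexI)
    show "K_nonneg q (m + 1) \<alpha> (s(m + 1 := model_moment \<alpha> R B (m + 1)))"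
      by (rule M.K_nonneg_model) (use s in auto)
  qed simp
  \<comment> \<open>\<open>F\<close> is holomorphic on the whole slit plane; the product identity
    gives the quotient wherever \<open>v\<^sub>2\<^sub>2\<close> is invertible, and
    \<open>\<alpha> - 1\<close> is such a point.\<close>
  have quot: "is_quotient q \<alpha> (\<lambda>z. block12 q (V_prod q \<alpha> s m z)) (\<lambda>z. block22 q (V_prod q \<alpha> s m z)) F"
    unfolding is_quotient_def
  proof (intro conjI ballI impI F_holomorphic)
    have "complex_of_real (\<alpha> - 1) \<in> slit_plane \<alpha>" by (auto simp: slit_plane_def simp del: of_real_diff)
    then show "\<exists>z\<in>slit_plane \<alpha>. Determinant.det (block22 q (V_prod q \<alpha> s m z)) \<noteq> 0" using V(3) by blast
    fix z assume z: "z \<in> slit_plane \<alpha>" and det: "Determinant.det (block22 q (V_prod q \<alpha> s m z)) \<noteq> 0"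
    have c: "block22 q (V_prod q \<alpha> s m z) \<in> carrier_mat q q" by (rule block_carrier) (auto intro: carrier_matI)
    obtain Y where Y: "Y \<in> carrier_mat N q" "M.S * Y - (z - complex_of_real \<alpha>) \<cdot>\<^sub>m Y = B" "mat_adjoint B * Y = F z"
      using resolvent z F_eq[OF z] by force
    have b12: "block12 q (V_prod q \<alpha> s m z) = F z * block22 q (V_prod q \<alpha> s m z)"
      using V(2)[rule_format, OF z Y(1,2)] unfolding Y(3) .
    obtain K where K: "K \<in> carrier_mat q q" "block22 q (V_prod q \<alpha> s m z) * K = 1\<^sub>m q"
      "mat_inverse (block22 q (V_prod q \<alpha> s m z)) = Some K"
      using det_nonzero_inverse[OF c det] by metis
    have Fz: "dim_row (F z) = q" "dim_col (F z) = q" by (simp_all add: F_eq[OF z])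
    have "block12 q (V_prod q \<alpha> s m z) * K = F z * (block22 q (V_prod q \<alpha> s m z) * K)"
      unfolding b12 using c K(1) Fz by (intro mat_assoc) auto
    then show "F z = block12 q (V_prod q \<alpha> s m z) * the (mat_inverse (block22 q (V_prod q \<alpha> s m z)))"
      using K Fz by simp
  qed
  have eq: "F \<in> S_moment_eq q \<alpha> s m"
    unfolding S_moment_eq_def using F_S0_class stieltjes_\<mu> moments_\<mu> s moment by auto
  have sub: "S_moment_eq q \<alpha> s m \<subseteq> S_moment_le q \<alpha> s m"
  proof
    fix H assume "H \<in> S_moment_eq q \<alpha> s m"
    then obtain \<sigma> where H: "H \<in> S0_class q \<alpha>" "is_stieltjes_measure q \<alpha> H \<sigma>" "moments_exist q \<alpha> \<sigma> m"
      "\<forall>j\<le>m. mat_moment q \<alpha> \<sigma> j = s j" by (auto simp: S_moment_eq_def)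
    have "s m - mat_moment q \<alpha> \<sigma> m = 0\<^sub>m q q" using H(4) s[of m] by (auto intro!: eq_matI)
    moreover have "nonneg_herm (0\<^sub>m q q)" by (rule nonneg_hermI[of _ q]) auto
    ultimately show "H \<in> S_moment_le q \<alpha> s m" using H unfolding S_moment_le_def by force
  qed
  \<comment> \<open>Uniqueness holds in the larger class, and \<open>F\<close> already lies in the
    smaller one, so both classes collapse to \<open>F\<close>.\<close>
  have le: "S_moment_le q \<alpha> s m = {F}"
    using M.solution_unique[OF s X] eq sub by blast
  have "S_moment_eq q \<alpha> s m = {F}" using eq sub unfolding le by auto
  then show ?thesis using ext V(1) quot le by auto
qed

end
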